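(* Algorithm Square$^+$Imp is a $\frac75$-approximation algorithm for wMIS on weighted $\{2,3\}$-intersection graphs: for every weighted $\{2,3\}$-intersection graph $(G,w)$ it runs in polynomial time and returns an independent set $A$ with $w(A^* )\le\frac75\,w(A)$, where $A^*$ is a maximum-weight independent set of $G$.
   Context: A hereditary $\{2,3\}$-collection is $(V,U)$ with $V$ finite and $U=\{U_v:v\in V\}$ sets of size 2 or 3, such that for each $v$ with $U_v=\{a,b,c\}$ there are $v_a,v_b,v_c\in V$ with $U_{v_a}=\{b,c\}$, $U_{v_b}=\{a,c\}$, $U_{v_c}=\{a,b\}$. Its weighted $\{2,3\}$-intersection graph $(G,w)$ is the multigraph on $V$ with $|U_x\cap U_y|$ parallel edges between distinct $x,y$ (adjacent iff the sets intersect) and weights $w_v=|U_v|-1$. wMIS: find an independent set maximizing total weight. A $d$-claw is an induced subgraph consisting of an independent set $T_C$ of $d$ vertices and a center adjacent to all of them (a single vertex is a 1-claw with no center). $N(S)$ is the set of vertices adjacent to some vertex of $S$. For a vertex set $S$, $w_+^2(S)=\sum_{v\in S}(w_v+1)^2$; a claw $C$ improves $w_+^2(A)$ if $w_+^2(A)<w_+^2((A\cup T_C)\setminus N(T_C))$. Matching terminology: for a matching $M$ in a graph $H$, an $M$-augmenting path is a path alternating between edges not in $M$ and edges in $M$ whose two ends are not covered by $M$. Algorithm Square$^+$Imp$(G,w)$: start with $A=\emptyset$. Repeat: (a) while some claw $C$ improves $w_+^2(A)$, set $A\leftarrow(A\cup T_C)\setminus N(T_C)$; (b) let $X=\bigcup\{U_v: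 v\in A, w_v=2\}$; let $H$ be the graph with vertex set $V'=\bigcup\{U_v: v\in V, w_v=1, U_v\cap X=\emptyset\}$ and with an edge $xy$ whenever some $v\in V$ has $U_v=\{x,y\}\subseteq V'$; let $M=\{xy\in E(H):$ some $v\in A$ has $U_v=\{x,y\}\}$ (a matching in $H$); (c) if $H$ has an $M$-augmenting path $P$, replace $A$ by $A\oplus P$, obtained by removing from $A$ the vertices $v$ with $U_v$ an edge of $P$ in $M$ and adding, for each edge $xy$ of $P$ not in $M$, a vertex $v$ of $G$ with $U_v=\{x,y\}$; until no $M$-augmenting path exists. Return $A$. *)

theory Defs
  imports "HOL-Computational_Algebra.Polynomial"
begin

section \<open>Weighted multigraphs\<close>

text \<open>
  \<open>mult G x y\<close> is the number of parallel edges between \<open>x\<close> and \<open>y\<close>.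
\<close>

record 'v wgraph =
  verts :: "'v set"
  mult :: "'v \<Rightarrow> 'v \<Rightarrow> nat"
  weight :: "'v \<Rightarrow> nat"

definition adjacent :: "'v wgraph \<Rightarrow> 'v \<Rightarrow> 'v \<Rightarrow> bool" where
  "adjacent G x y \<longleftrightarrow> x \<in> verts G \<and> y \<in> verts G \<and> mult G x y > 0"

definition independent_set :: "'v wgraph \<Rightarrow> 'v set \<Rightarrow> bool" where
  "independent_set G S \<longleftrightarrow> S \<subseteq> verts G \<and> (\<forall>x\<in>S. \<forall>y\<in>S. \<not> adjacent G x y)"

definition nbhd :: "'v wgraph \<Rightarrow> 'v set \<Rightarrow> 'v set" where
  "nbhd G S = {v. \<exists>u\<in>S. adjacent G u v}"

definition total_weight :: "'v wgraph \<Rightarrow> 'v set \<Rightarrow> nat" where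
  "total_weight G S = (\<Sum>v\<in>S. weight G v)"

definition max_weight_independent_set :: "'v wgraph \<Rightarrow> 'v set \<Rightarrow> bool" where
  "max_weight_independent_set G S \<longleftrightarrow>
     independent_set G S \<and>
     (\<forall>T. independent_set G T \<longrightarrow> total_weight G T \<le> total_weight G S)"

text \<open>
  A claw is given by its set \<open>T\<close> of talons; the center only has to exist, since the local
  search uses nothing but \<open>T\<close>.  A single vertex counts as a 1-claw without a center.
\<close>

definition d_claw :: "'v wgraph \<Rightarrow> nat \<Rightarrow> 'v set \<Rightarrow> bool" where
  "d_claw G d T \<longleftrightarrow>
     independent_set G T \<and> finite T \<and> card T = d \<and>
     (d = 1 \<or> (\<exists>c\<in>verts G. \<forall>t\<in>T. adjacent G c t))"

definition claw :: "'v wgraph \<Rightarrow> 'v set \<Rightarrow> bool" where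
  "claw G T \<longleftrightarrow> (\<exists>d\<ge>1. d_claw G d T)"

definition sq_weight_plus :: "'v wgraph \<Rightarrow> 'v set \<Rightarrow> nat" where
  "sq_weight_plus G S = (\<Sum>v\<in>S. (weight G v + 1)\<^sup>2)"

definition swap_claw :: "'v wgraph \<Rightarrow> 'v set \<Rightarrow> 'v set \<Rightarrow> 'v set" where
  "swap_claw G A T = (A \<union> T) - nbhd G T"

definition improving_claw :: "'v wgraph \<Rightarrow> 'v set \<Rightarrow> 'v set \<Rightarrow> bool" where
  "improving_claw G A T \<longleftrightarrow>
     claw G T \<and> sq_weight_plus G A < sq_weight_plus G (swap_claw G A T)"


section \<open>Hereditary collections and their intersection graphs\<close>

text \<open>
  The collection is an indexed family: distinct \<open>x\<close> and \<open>y\<close> may have \<open>U x = U y\<close>.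
\<close>

definition hereditary_23_collection :: "'v set \<Rightarrow> ('v \<Rightarrow> 'e set) \<Rightarrow> bool" where
  "hereditary_23_collection V U \<longleftrightarrow>
     finite V \<and>
     (\<forall>v\<in>V. card (U v) = 2 \<or> card (U v) = 3) \<and>
     (\<forall>v\<in>V. \<forall>a b c. card (U v) = 3 \<and> U v = {a, b, c} \<longrightarrow>
        (\<exists>va\<in>V. \<exists>vb\<in>V. \<exists>vc\<in>V. U va = {b, c} \<and> U vb = {a, c} \<and> U vc = {a, b}))"

definition intersection_graph :: "'v set \<Rightarrow> ('v \<Rightarrow> 'e set) \<Rightarrow> 'v wgraph" where
  "intersection_graph V U =
     \<lparr>verts = V,
      mult = (\<lambda>x y. if x \<in> V \<and> y \<in> V \<and> x \<noteq> y then card (U x \<inter> U y) else 0),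
      weight = (\<lambda>v. card (U v) - 1)\<rparr>"


section \<open>Augmenting paths\<close>

text \<open>
  Simple graphs are given by their set of two-element edges, paths by the list of their
  vertices.
\<close>

definition path_edge :: "'e list \<Rightarrow> nat \<Rightarrow> 'e set" where
  "path_edge p i = {p ! i, p ! Suc i}"

definition path_edges :: "'e list \<Rightarrow> 'e set set" where
  "path_edges p = {path_edge p i | i. Suc i < length p}"

definition augmenting_path :: "'e set set \<Rightarrow> 'e set set \<Rightarrow> 'e list \<Rightarrow> bool" where
  "augmenting_path E M p \<longleftrightarrow>
     length p \<ge> 2 \<and> distinct p \<and> path_edges p \<subseteq> E \<and>
     (\<forall>i. Suc (Suc i) < length p \<longrightarrow>
        (path_edge p i \<in> M \<longleftrightarrow> path_edge p (Suc i) \<notin> M)) \<and>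
     hd p \<notin> \<Union>M \<and> last p \<notin> \<Union>M"


section \<open>The algorithm\<close>

definition covered_by_triples :: "'v set \<Rightarrow> ('v \<Rightarrow> 'e set) \<Rightarrow> 'v set \<Rightarrow> 'e set" where
  "covered_by_triples V U A =
     \<Union>{U v | v. v \<in> A \<and> weight (intersection_graph V U) v = 2}"

definition H_verts :: "'v set \<Rightarrow> ('v \<Rightarrow> 'e set) \<Rightarrow> 'v set \<Rightarrow> 'e set" where
  "H_verts V U A =
     \<Union>{U v | v. v \<in> V \<and> weight (intersection_graph V U) v = 1 \<and>
                U v \<inter> covered_by_triples V U A = {}}"

definition H_edges :: "'v set \<Rightarrow> ('v \<Rightarrow> 'e set) \<Rightarrow> 'v set \<Rightarrow> 'e set set" where
  "H_edges V U A =
     {{x, y} | x y. x \<noteq> y \<and> {x, y} \<subseteq> H_verts V U A \<and> (\<exists>v\<in>V. U v = {x, y})}"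

definition H_matching :: "'v set \<Rightarrow> ('v \<Rightarrow> 'e set) \<Rightarrow> 'v set \<Rightarrow> 'e set set" where
  "H_matching V U A = {e \<in> H_edges V U A. \<exists>v\<in>A. U v = e}"

definition claw_step :: "'v set \<Rightarrow> ('v \<Rightarrow> 'e set) \<Rightarrow> 'v set \<Rightarrow> 'v set \<Rightarrow> bool" where
  "claw_step V U A A' \<longleftrightarrow>
     (\<exists>T. improving_claw (intersection_graph V U) A T \<and>
          A' = swap_claw (intersection_graph V U) A T)"

text \<open>
  The function \<open>f\<close> chooses, for each edge \<open>e\<close> of \<open>p\<close> outside the matching, one of the vertices
  \<open>v\<close> with \<open>U v = e\<close>.
\<close>

definition augment_step :: "'v set \<Rightarrow> ('v \<Rightarrow> 'e set) \<Rightarrow> 'v set \<Rightarrow> 'v set \<Rightarrow> bool" where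
  "augment_step V U A A' \<longleftrightarrow>
     (let M = H_matching V U A in
      \<exists>p f. augmenting_path (H_edges V U A) M p \<and>
            (\<forall>e \<in> path_edges p - M. f e \<in> V \<and> U (f e) = e) \<and>
            A' = (A - {v \<in> A. U v \<in> path_edges p \<inter> M}) \<union> f ` (path_edges p - M))"

text \<open>
  One update of the current set: augmentation is attempted only once no claw improves.
  All choices (of the claw, of the augmenting path, of the added vertices) are left open.
\<close>

definition alg_step :: "'v set \<Rightarrow> ('v \<Rightarrow> 'e set) \<Rightarrow> 'v set \<Rightarrow> 'v set \<Rightarrow> bool" where
  "alg_step V U A A' \<longleftrightarrow>
     claw_step V U A A' \<or> ((\<nexists>B. claw_step V U A B) \<and> augment_step V U A A')"

definition partial_run :: "'v set \<Rightarrow> ('v \<Rightarrow> 'e set) \<Rightarrow> 'v set list \<Rightarrow> bool" where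
  "partial_run V U As \<longleftrightarrow>
     As \<noteq> [] \<and> hd As = {} \<and>
     (\<forall>i. Suc i < length As \<longrightarrow> alg_step V U (As ! i) (As ! Suc i))"

definition complete_run :: "'v set \<Rightarrow> ('v \<Rightarrow> 'e set) \<Rightarrow> 'v set list \<Rightarrow> bool" where
  "complete_run V U As \<longleftrightarrow> partial_run V U As \<and> (\<nexists>B. alg_step V U (last As) B)"

definition returns :: "'v set \<Rightarrow> ('v \<Rightarrow> 'e set) \<Rightarrow> 'v set \<Rightarrow> bool" where
  "returns V U A \<longleftrightarrow> (\<exists>As. complete_run V U As \<and> last As = A)"


section \<open>Model of computation\<close>

text \<open>
  Running time is measured in pure first-order Lisp.  Data are binary trees over
  uninterpreted atoms, of which a program can only test equality; a program is a finite
  list of function bodies, functions refer to each other by their position in the list and to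
  their arguments by position, and the only constant is the empty tree.  The cost of a
  computation is the number of evaluated subexpressions.  Since there is no arithmetic and
  equality is only tested on leaves, this is within a polynomial of Turing machine time
  (trees being represented by pointers).
\<close>

datatype 'a sexp = SNil | SAtom 'a | SCons "'a sexp" "'a sexp"

datatype expr =
    Var nat
  | NilE
  | ConsE expr expr
  | CarE expr
  | CdrE expr
  | ConspE expr
  | EqE expr expr
  | IfE expr expr expr
  | CallE nat "expr list"

type_synonym program = "expr list"

fun scar :: "'a sexp \<Rightarrow> 'a sexp" where
  "scar (SCons x y) = x"
| "scar _ = SNil"

fun scdr :: "'a sexp \<Rightarrow> 'a sexp" where
  "scdr (SCons x y) = y"
| "scdr _ = SNil"

fun is_cons :: "'a sexp \<Rightarrow> bool" where
  "is_cons (SCons x y) = True"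
| "is_cons _ = False"

definition sbool :: "bool \<Rightarrow> 'a sexp" where
  "sbool b = (if b then SCons SNil SNil else SNil)"

text \<open>
  \<open>eval P env e x t\<close>: in program \<open>P\<close>, with argument values \<open>env\<close>, evaluation of \<open>e\<close>
  terminates with value \<open>x\<close> at cost \<open>t\<close>.
\<close>

inductive eval :: "program \<Rightarrow> 'a sexp list \<Rightarrow> expr \<Rightarrow> 'a sexp \<Rightarrow> nat \<Rightarrow> bool"
  and evals :: "program \<Rightarrow> 'a sexp list \<Rightarrow> expr list \<Rightarrow> 'a sexp list \<Rightarrow> nat \<Rightarrow> bool"
  for P :: program where
  Var: "i < length env \<Longrightarrow> eval P env (Var i) (env ! i) 1"
| Nil: "eval P env NilE SNil 1"
| Cons: "eval P env a x s \<Longrightarrow> eval P env b y t \<Longrightarrow>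
    eval P env (ConsE a b) (SCons x y) (s + t + 1)"
| Car: "eval P env a x t \<Longrightarrow> eval P env (CarE a) (scar x) (t + 1)"
| Cdr: "eval P env a x t \<Longrightarrow> eval P env (CdrE a) (scdr x) (t + 1)"
| Consp: "eval P env a x t \<Longrightarrow> eval P env (ConspE a) (sbool (is_cons x)) (t + 1)"
| Eq: "eval P env a x s \<Longrightarrow> eval P env b y t \<Longrightarrow>
    eval P env (EqE a b) (sbool (\<not> is_cons x \<and> \<not> is_cons y \<and> x = y)) (s + t + 1)"
| If_true: "eval P env c z s \<Longrightarrow> z \<noteq> SNil \<Longrightarrow> eval P env a x t \<Longrightarrow>
    eval P env (IfE c a b) x (s + t + 1)"
| If_false: "eval P env c SNil s \<Longrightarrow> eval P env b y t \<Longrightarrow>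
    eval P env (IfE c a b) y (s + t + 1)"
| Call: "evals P env as xs s \<Longrightarrow> f < length P \<Longrightarrow> eval P xs (P ! f) y t \<Longrightarrow>
    eval P env (CallE f as) y (s + t + 1)"
| Empty: "evals P env [] [] 0"
| Args: "eval P env a x s \<Longrightarrow> evals P env as xs t \<Longrightarrow>
    evals P env (a # as) (x # xs) (s + t)"

definition computes_in_time :: "program \<Rightarrow> 'a sexp \<Rightarrow> 'a sexp \<Rightarrow> nat \<Rightarrow> bool" where
  "computes_in_time P inp out t \<longleftrightarrow> eval P [inp] (CallE 0 [Var 0]) out t"

fun slist :: "'a sexp list \<Rightarrow> 'a sexp" where
  "slist [] = SNil"
| "slist (x # xs) = SCons x (slist xs)"

definition encodes_set :: "('b \<Rightarrow> 'a) \<Rightarrow> 'a sexp \<Rightarrow> 'b set \<Rightarrow> bool" where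
  "encodes_set h x S \<longleftrightarrow>
     (\<exists>ys. distinct ys \<and> set ys = S \<and> x = slist (map (\<lambda>y. SAtom (h y)) ys))"

text \<open>
  Input: the list, in an arbitrary order, of the pairs of \<open>v\<close> and the elements of \<open>U v\<close>.
\<close>

definition encodes_collection ::
    "('v + 'e) sexp \<Rightarrow> 'v set \<Rightarrow> ('v \<Rightarrow> 'e set) \<Rightarrow> bool" where
  "encodes_collection x V U \<longleftrightarrow>
     (\<exists>vs us. distinct vs \<and> set vs = V \<and>
        (\<forall>v\<in>V. encodes_set Inr (us v) (U v)) \<and>
        x = slist (map (\<lambda>v. SCons (SAtom (Inl v)) (us v)) vs))"

text \<open>
  Output: the list of the sets that the algorithm goes through, latest first, so that the
  returned set is its head.
\<close>

definition encodes_run :: "('v + 'e) sexp \<Rightarrow> 'v set list \<Rightarrow> bool" where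
  "encodes_run x As \<longleftrightarrow>
     (\<exists>ys. list_all2 (encodes_set Inl) ys (rev As) \<and> x = slist ys)"

text \<open>
  Polynomial running time: there are polynomially many iterations whatever choices are made,
  and one program carries out a complete run on every instance in polynomial time.  The
  encoded input has size linear in \<open>card V\<close>, because the members of the collection have at most
  three elements.
\<close>

definition polynomially_many_steps :: "nat poly \<Rightarrow> 'v set \<Rightarrow> ('v \<Rightarrow> 'e set) \<Rightarrow> bool" where
  "polynomially_many_steps p V U \<longleftrightarrow>
     (\<forall>As. partial_run V U As \<longrightarrow> length As \<le> poly p (card V))"

definition carries_out_in_time ::
    "program \<Rightarrow> nat poly \<Rightarrow> 'v set \<Rightarrow> ('v \<Rightarrow> 'e set) \<Rightarrow> bool" where
  "carries_out_in_time P p V U \<longleftrightarrow>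
     (\<forall>inp :: ('v + 'e) sexp. encodes_collection inp V U \<longrightarrow>
        (\<exists>out t As. computes_in_time P inp out t \<and> t \<le> poly p (card V) \<and>
                    encodes_run out As \<and> complete_run V U As))"

end

theory Submission
  imports Defs "HOL-Library.Transitive_Closure_Table"
begin

text \<open>
  Every step increases \<^term>\<open>sq_weight_plus\<close>, which never exceeds nine times the number of vertices:
  a claw by its definition, an augmentation because it replaces \<open>k\<close> pairs by \<open>k + 1\<close> pairs.

  For the ratio, the elements covered by the returned set \<open>A\<close> pay for the members of an
  independent set \<open>S\<close>. By heredity, no member of \<open>S\<close> has two uncovered elements, and of a triple
  of \<open>A\<close> at most two elements lie in members of \<open>S\<close> with an uncovered element, since otherwise
  there is an improving claw. A suitable charge then leaves a deficit only at the members of \<open>S\<close>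
  with an uncovered element and an element of a pair of \<open>A\<close>. Link two members of \<open>S\<close> if a pair of
  \<open>A\<close> meets both. A component with two deficits would contain an augmenting path, and exploring a
  component near its only deficit yields the surplus that compensates it.

  The program enumerates the independent sets of at most three vertices to find a claw. Whether an
  augmenting path exists is decided by Edmonds' blossom algorithm: grow an alternating forest,
  and if an edge joins two outer vertices of the same tree, contract the odd cycle and start
  again. No path has to be lifted through the contractions, since the edges of a path can be
  singled out by repeated decisions.
\<close>

section \<open>Matchings and augmenting paths\<close>

text \<open>The constants come from rescaling. With weights multiplied by ten, the ratio
  \<open>7/5\<close> allows 14 per unit of weight of \<open>A\<close>: 14 for a pair, split evenly
  as 7 + 7, and 28 for a triple, split as 10 + 10 + 8, since one of its elements always lies outside
  the members of \<open>S\<close> that have an uncovered element. A member of \<open>S\<close> with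
  \<open>k\<close> elements demands \<open>10 * (k - 1)\<close>. A fully covered triple receives at
  least 21 against 20, so its surplus may be as small as 1, while a member with an uncovered element
  falls 3 short as soon as one of its elements lies in a pair of \<open>A\<close>. Up to three other
  members must therefore be found to pay for it. They exist because trading two pairs for one triple
  already gains, 9 against 8: a triple of \<open>S\<close> that avoids the triples of
  \<open>A\<close> meets three different pairs. Heredity makes any two elements of a member of
  \<open>S\<close> that avoid the triples of \<open>A\<close> an edge of \<open>H\<close>; this
  turns a chain of linked members into an alternating path. Contractions are justified by comparing
  sizes of matchings. Berge's theorem translates between these sizes and the paths of the
  algorithm.\<close>

definition matching :: "'a set set \<Rightarrow> bool" where
  "matching M \<longleftrightarrow> (\<forall>e\<in>M. card e = 2) \<and> (\<forall>e\<in>M. \<forall>f\<in>M. e \<inter> f \<noteq> {} \<longrightarrow> e = f)"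

text \<open>The recursive form of the index condition in \<open>augmenting_path\<close>. The flag
  records whether the first edge is matched, so that an induction can pass to tails that start in
  the other phase.\<close>

fun alternating :: "'a set set \<Rightarrow> bool \<Rightarrow> 'a list \<Rightarrow> bool" where
  "alternating M b (x # y # p) \<longleftrightarrow> ({x, y} \<in> M \<longleftrightarrow> b) \<and> alternating M (\<not> b) (y # p)"
| "alternating M b _ \<longleftrightarrow> True"

lemma path_edge_Cons_Suc [simp]: "path_edge (x # p) (Suc i) = path_edge p i"
  by (simp add: path_edge_def)

lemma path_edges_simps [simp]:
  "path_edges [] = {}"
  "path_edges [x] = {}"
  "path_edges (x # y # p) = insert {x, y} (path_edges (y # p))"
proof -
  show "path_edges (x # y # p) = insert {x, y} (path_edges (y # p))"
  proof (intro set_eqI iffI)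
    fix e assume "e \<in> path_edges (x # y # p)"
    then obtain i where i: "e = path_edge (x # y # p) i" "Suc i < length (x # y # p)"
      unfolding path_edges_def by blast
    then show "e \<in> insert {x, y} (path_edges (y # p))"
      by (cases i) (auto simp: path_edges_def path_edge_def)
  next
    fix e assume e: "e \<in> insert {x, y} (path_edges (y # p))"
    then consider "e = {x, y}" | i where "e = path_edge (y # p) i" "Suc i < length (y # p)"
      unfolding path_edges_def by blast
    then show "e \<in> path_edges (x # y # p)"
    proof cases
      case 1
      then have "e = path_edge (x # y # p) 0" by (simp add: path_edge_def)
      then show ?thesis unfolding path_edges_def by fastforce
    next
      case (2 i)
      then have "e = path_edge (x # y # p) (Suc i)" by simp
      with 2 show ?thesis unfolding path_edges_def by fastforce
    qed
  qed
qed (auto simp: path_edges_def)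

lemma alternating_iff:
  "alternating M b p \<longleftrightarrow>
     (2 \<le> length p \<longrightarrow> (path_edge p 0 \<in> M \<longleftrightarrow> b)) \<and>
     (\<forall>i. Suc (Suc i) < length p \<longrightarrow> (path_edge p i \<in> M \<longleftrightarrow> path_edge p (Suc i) \<notin> M))"
proof (induction M b p rule: alternating.induct)
  case (1 M b x y p)
  have *: "(\<forall>i. P i) \<longleftrightarrow> P 0 \<and> (\<forall>i. P (Suc i))" for P :: "nat \<Rightarrow> bool"
    by (metis not0_implies_Suc)
  show ?case
    unfolding alternating.simps 1
    by (subst (2) *) (cases p; auto simp: path_edge_def)
qed (auto simp: path_edge_def)

text \<open>The first vertex is exposed, so the first edge cannot be matched; this fixes the initial
  phase to \<open>False\<close>.\<close>

lemma augmenting_path_iff: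
  "augmenting_path E M p \<longleftrightarrow>
     length p \<ge> 2 \<and> distinct p \<and> path_edges p \<subseteq> E \<and> alternating M False p \<and>
     hd p \<notin> \<Union>M \<and> last p \<notin> \<Union>M"
proof -
  have "path_edge p 0 \<notin> M" if "length p \<ge> 2" "hd p \<notin> \<Union>M"
    using that by (cases p) (auto simp: path_edge_def)
  then show ?thesis
    unfolding augmenting_path_def alternating_iff by blast
qed

lemma path_edges_rev [simp]: "path_edges (rev p) = path_edges p"
proof -
  have *: "path_edges p \<subseteq> path_edges (rev p)" for p :: "'a list"
  proof
    fix e assume "e \<in> path_edges p"
    then obtain i where i: "e = {p ! i, p ! Suc i}" "Suc i < length p"
      unfolding path_edges_def path_edge_def by blast
    let ?j = "length p - Suc (Suc i)"
    have "rev p ! ?j = p ! Suc i" "rev p ! Suc ?j = p ! i"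
      using i(2) by (auto simp: rev_nth Suc_diff_Suc)
    then have "e = path_edge (rev p) ?j" using i by (auto simp: path_edge_def)
    moreover have "Suc ?j < length (rev p)" using i by auto
    ultimately show "e \<in> path_edges (rev p)" unfolding path_edges_def by blast
  qed
  from *[of p] *[of "rev p"] show ?thesis by simp
qed

lemma path_edge_rev:
  "Suc i < length p \<Longrightarrow> path_edge (rev p) i = path_edge p (length p - Suc (Suc i))"
  by (auto simp: path_edge_def rev_nth Suc_diff_Suc)

lemma augmenting_path_rev:
  assumes "augmenting_path E M p" shows "augmenting_path E M (rev p)"
proof -
  have "path_edge (rev p) i \<in> M \<longleftrightarrow> path_edge (rev p) (Suc i) \<notin> M" if "Suc (Suc i) < length p" for i
  proof -
    let ?j = "length p - Suc (Suc (Suc i))"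
    have "path_edge p ?j \<in> M \<longleftrightarrow> path_edge p (Suc ?j) \<notin> M"
      using assms that unfolding augmenting_path_def by auto
    moreover have "Suc ?j = length p - Suc (Suc i)" using that by simp
    ultimately show ?thesis using that by (simp add: path_edge_rev)
  qed
  moreover have "p \<noteq> []" using assms unfolding augmenting_path_def by auto
  ultimately show ?thesis
    using assms unfolding augmenting_path_def by (auto simp: hd_rev last_rev)
qed

lemma alternating_cong:
  "(\<And>e. e \<in> path_edges p \<Longrightarrow> e \<in> M \<longleftrightarrow> e \<in> M') \<Longrightarrow> alternating M b p = alternating M' b p"
  by (induction M b p rule: alternating.induct) auto

lemma path_edges_subset_set: "e \<in> path_edges p \<Longrightarrow> e \<subseteq> set p"
  by (auto simp: path_edges_def path_edge_def)

text \<open>The first and the last edge are unmatched, and every vertex in between lies on an edge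
  of each kind. An augmenting path in \<open>M \<union> N\<close> is thereby confined to the
  vertices that \<open>N\<close> covers.\<close>

lemma alternating_covered:
  assumes "alternating M False p" "length p \<ge> 2" "last p \<notin> \<Union>M"
  shows "set p \<subseteq> \<Union>(path_edges p - M)"
  using assms
proof (induction p rule: length_induct)
  case (1 p)
  then obtain x y q where p: "p = x # y # q"
    by (metis Suc_le_length_iff numeral_2_eq_2)
  show ?case
  proof (cases q)
    case Nil
    then show ?thesis using 1 p by auto
  next
    case (Cons z r)
    have "r \<noteq> []" using 1 p Cons by auto
    then have "set (z # r) \<subseteq> \<Union>(path_edges (z # r) - M)"
      using 1(1)[rule_format, of "z # r"] 1(2-) p Cons by (cases r) auto
    then have "set (z # r) \<subseteq> \<Union>(path_edges p - M)"
      unfolding p Cons by (rule order_trans) (intro Union_mono, simp, blast)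
    moreover have "{x, y} \<in> path_edges p - M" using 1(2) p by auto
    then have "{x, y} \<subseteq> \<Union>(path_edges p - M)" by blast
    ultimately show ?thesis unfolding p Cons by simp
  qed
qed

lemma augmenting_path_edges: "augmenting_path E M p \<Longrightarrow> path_edges p \<subseteq> E"
  unfolding augmenting_path_def by simp

lemma augmenting_path_covered:
  "augmenting_path E M p \<Longrightarrow> set p \<subseteq> \<Union>(path_edges p - M)"
  unfolding augmenting_path_iff by (intro alternating_covered) auto

lemma augmenting_path_covered_Un:
  assumes "augmenting_path (M \<union> N) M p" shows "set p \<subseteq> \<Union>N"
proof -
  have "path_edges p - M \<subseteq> N" using assms unfolding augmenting_path_def by auto
  then show ?thesis using augmenting_path_covered[OF assms] by (meson Union_mono subset_trans)
qed

section \<open>Berge's theorem\<close>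

lemma matchingD:
  "matching M \<Longrightarrow> e \<in> M \<Longrightarrow> f \<in> M \<Longrightarrow> x \<in> e \<Longrightarrow> x \<in> f \<Longrightarrow> e = f"
  unfolding matching_def by blast

lemma matching_edge:
  assumes "matching M" "e \<in> M" "x \<in> e" obtains y where "y \<noteq> x" "e = {x, y}"
  using assms unfolding matching_def by (metis card_2_iff insert_commute insertE singletonD)

lemma matching_mono: "matching M \<Longrightarrow> N \<subseteq> M \<Longrightarrow> matching N"
  unfolding matching_def by blast

lemma matching_mate: "matching M \<Longrightarrow> {x, y} \<in> M \<Longrightarrow> {x, z} \<in> M \<Longrightarrow> y = z"
  by (metis doubleton_eq_iff insertI1 matchingD)

lemma matching_irrefl: "matching M \<Longrightarrow> {x, y} \<in> M \<Longrightarrow> x \<noteq> y"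
  unfolding matching_def by fastforce

lemma matching_insert:
  assumes "matching M" "x \<notin> \<Union>M" "y \<notin> \<Union>M" "x \<noteq> y"
  shows "matching (insert {x, y} M)"
  using assms unfolding matching_def by auto

lemma card_Union_matching: "matching M \<Longrightarrow> finite M \<Longrightarrow> card (\<Union>M) = 2 * card M"
  by (subst card_Union_disjoint)
    (auto simp: matching_def pairwise_def disjnt_def intro: card_ge_0_finite)

text \<open>The induction for \<open>berge\<close> takes edges away from \<open>M\<close>. As long
  as these miss the path, they affect neither its alternation nor the exposure of its ends.\<close>

lemma augmenting_path_transfer:
  assumes p: "augmenting_path (M' \<union> N') M' p" and N': "path_edges p - M' \<subseteq> N"
    and M': "M' \<subseteq> M" and new: "\<And>e. e \<in> M - M' \<Longrightarrow> e \<inter> set p = {} \<and> e \<noteq> {}"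
  shows "augmenting_path (M \<union> N) M p"
proof -
  have eq: "e \<in> M' \<longleftrightarrow> e \<in> M" if "e \<in> path_edges p" for e
    using new[of e] M' path_edges_subset_set[OF that] by blast
  have "p \<noteq> []" using p unfolding augmenting_path_def by auto
  then have "hd p \<in> set p" "last p \<in> set p" by auto
  then have "hd p \<notin> \<Union>M" "last p \<notin> \<Union>M"
    using p new unfolding augmenting_path_def by (metis DiffI IntI UnionE UnionI empty_iff)+
  then show ?thesis
    using p N' M' alternating_cong[of p M' M False, OF eq] unfolding augmenting_path_iff by blast
qed

text \<open>The induction removes one edge from each matching instead of decomposing the symmetric
  difference. It starts at a vertex \<open>s\<close> that \<open>N\<close> covers and
  \<open>M\<close> does not, and follows at most three edges from there.\<close>

theorem berge:
  assumes "matching M" "matching N" "finite M" "finite N" "card M < card N"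
  shows "\<exists>p. augmenting_path (M \<union> N) M p"
  using assms
proof (induction "card N" arbitrary: M N rule: less_induct)
  case less
  have "card (\<Union>M) < card (\<Union>N)"
    using less.prems by (simp add: card_Union_matching)
  moreover have "finite (\<Union>M)"
    using less.prems unfolding matching_def by (metis card_gt_0_iff finite_Union zero_less_numeral)
  ultimately obtain s where s: "s \<in> \<Union>N" "s \<notin> \<Union>M"
    by (metis card_mono leD subsetI)
  then obtain t where t: "{s, t} \<in> N" "t \<noteq> s"
    using matching_edge[OF less.prems(2)] by (metis UnionE)
  show ?case
  proof (cases "t \<in> \<Union>M")
    case False
    have "augmenting_path (M \<union> N) M [s, t]"
      unfolding augmenting_path_iff using s t False by auto
    then show ?thesis by blast
  next
    case True
    then obtain u where u: "{t, u} \<in> M" "u \<noteq> t"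
      using matching_edge[OF less.prems(1)] by (metis UnionE)
    have us: "u \<noteq> s" using s u by auto
    let ?M = "M - {{t, u}}"
    have M: "matching ?M" "finite ?M" "card ?M = card M - 1" "card M > 0"
      using less.prems u by (auto intro: matching_mono simp: card_gt_0_iff)
    show ?thesis
    proof (cases "u \<in> \<Union>N")
      case False
      \<comment> \<open>No remaining edge of \<open>N\<close> contains \<open>t\<close> or
        \<open>u\<close>, so a path for the smaller matchings avoids both and survives the return of
        \<open>{t, u}\<close>.\<close>
      let ?N = "N - {{s, t}}"
      have N: "matching ?N" "finite ?N" "card ?N = card N - 1" "card N > 0"
        using less.prems t by (auto intro: matching_mono simp: card_gt_0_iff)
      have "card ?M < card ?N" using M N less.prems by linarith
      then obtain p where p: "augmenting_path (?M \<union> ?N) ?M p"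
        using less.hyps[of ?N ?M] M N by (meson Diff_subset N(4) card_Diff1_less less.prems(4) t(1))
      have cov: "set p \<subseteq> \<Union>?N"
        by (rule augmenting_path_covered_Un[OF p])
      have "t \<notin> \<Union>?N" using matchingD[OF less.prems(2) t(1), of _ t] by auto
      with cov False have "t \<notin> set p" "u \<notin> set p" by auto
      then have "augmenting_path (M \<union> N) M p"
        using p by (intro augmenting_path_transfer[OF p]) (auto simp: augmenting_path_def)
      then show ?thesis by blast
    next
      case True
      then obtain v where v: "{u, v} \<in> N" "v \<noteq> u"
        using matching_edge[OF less.prems(2)] by (metis UnionE)
      have vt: "v \<noteq> t"
        using matching_mate[OF less.prems(2), of t u s] t v us by (auto simp: insert_commute)
      have vs: "v \<noteq> s"
        using matching_mate[OF less.prems(2), of s u t] t v u by (auto simp: insert_commute)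
      \<comment> \<open>A shortcut: the alternating stretch \<open>s\<close>, \<open>t\<close>,
        \<open>u\<close>, \<open>v\<close> collapses to a single edge \<open>{s, v}\<close> of the
        new \<open>N\<close>, while \<open>{t, u}\<close> leaves \<open>M\<close>.\<close>
      let ?R = "N - {{s, t}, {u, v}}"
      let ?N = "insert {s, v} ?R"
      have stN0: "s \<notin> \<Union>?R" "t \<notin> \<Union>?R" "u \<notin> \<Union>?R" "v \<notin> \<Union>?R"
        using matchingD[OF less.prems(2) t(1), of _ s] matchingD[OF less.prems(2) t(1), of _ t]
          matchingD[OF less.prems(2) v(1), of _ u] matchingD[OF less.prems(2) v(1), of _ v] by blast+
      have ne: "{s, t} \<noteq> {u, v}" using us vs by (auto simp: doubleton_eq_iff)
      have "matching ?N"
        using less.prems stN0 vs by (intro matching_insert) (auto intro: matching_mono)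
      moreover have "finite ?N" using less.prems by simp
      moreover have cN: "card ?N = card N - 1" "card N \<ge> 2"
      proof -
        have "card {{s, t}, {u, v}} = 2" using ne by simp
        moreover have sub: "{{s, t}, {u, v}} \<subseteq> N" using t v by auto
        ultimately have "card ?R = card N - 2" "card N \<ge> 2"
          using card_Diff_subset[OF _ sub] card_mono[OF less.prems(4) sub] by auto
        moreover have "{s, v} \<notin> ?R" using stN0 by auto
        ultimately show "card ?N = card N - 1" "card N \<ge> 2" using less.prems by auto
      qed
      moreover have "card ?M < card ?N" using M cN less.prems by linarith
      ultimately obtain p where p: "augmenting_path (?M \<union> ?N) ?M p"
        using less.hyps[of ?N ?M] M by (metis One_nat_def diff_less less_2_cases_iff
            nat_less_le not_gr_zero zero_less_one not_less)
      have cov: "set q \<subseteq> \<Union>?N" if "augmenting_path (?M \<union> ?N) ?M q" for q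
        by (rule augmenting_path_covered_Un[OF that])
      have tu: "t \<notin> \<Union>?N" "u \<notin> \<Union>?N" using stN0 t(2) us vt v(2) by auto
      show ?thesis
      proof (cases "s \<in> set p")
        case False
        have "path_edges p - ?M \<subseteq> N"
        proof
          fix e assume e: "e \<in> path_edges p - ?M"
          then have "e \<in> ?N" using augmenting_path_edges[OF p] by blast
          moreover have "s \<notin> e" using e False path_edges_subset_set[of e p] by blast
          ultimately show "e \<in> N" by auto
        qed
        moreover have "t \<notin> set p" "u \<notin> set p" using tu cov[OF p] by auto
        ultimately have "augmenting_path (M \<union> N) M p"
          by (intro augmenting_path_transfer[OF p]) auto
        then show ?thesis by blast
      next
        case True
        \<comment> \<open>An inner vertex of the path lies on an edge of \<open>?M\<close>, but
          \<open>s\<close> is exposed; hence \<open>s\<close> is an end, and reversal makes it the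
          first vertex.\<close>
        have *: "\<exists>q. augmenting_path (?M \<union> ?N) ?M q \<and> hd q = s"
        proof (cases "hd p = s")
          case False
          obtain i where i: "i < length p" "p ! i = s" using True by (metis in_set_conv_nth)
          have "i \<noteq> 0" using False i by (metis hd_conv_nth length_0_conv not_less_zero)
          have "Suc i = length p"
          proof (rule ccontr)
            assume "Suc i \<noteq> length p"
            then have "Suc (Suc (i - 1)) < length p" "Suc i < length p" using i \<open>i \<noteq> 0\<close> by auto
            moreover have "\<forall>j. Suc (Suc j) < length p \<longrightarrow> (path_edge p j \<in> ?M \<longleftrightarrow> path_edge p (Suc j) \<notin> ?M)"
              using p unfolding augmenting_path_def by (elim conjE)
            moreover have "Suc (i - 1) = i" using \<open>i \<noteq> 0\<close> by simp
            ultimately have "path_edge p (i - 1) \<in> ?M \<or> path_edge p i \<in> ?M" by metis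
            then show False using s i \<open>i \<noteq> 0\<close> by (auto simp: path_edge_def)
          qed
          then have "last p = s" using i by (metis diff_Suc_1 last_conv_nth length_0_conv not_less_zero)
          then show ?thesis
            using augmenting_path_rev[OF p] p
            by (metis hd_rev)
        qed (use p in blast)
        then obtain q where q: "augmenting_path (?M \<union> ?N) ?M q" "hd q = s" by blast
        then obtain v' r where r: "q = s # v' # r"
          unfolding augmenting_path_def by (metis Suc_le_length_iff list.sel(1) numeral_2_eq_2)
        have "{s, v'} \<in> ?N" using q r s unfolding augmenting_path_def by auto
        moreover have "{s, v'} \<notin> ?R" using stN0 by auto
        ultimately have v': "v' = v" by (auto simp: doubleton_eq_iff)
        have tq: "t \<notin> set q" "u \<notin> set q" using tu cov[OF q(1)] by auto
        have eN: "path_edges (v # r) \<subseteq> M \<union> N"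
        proof
          fix e assume e: "e \<in> path_edges (v # r)"
          have "s \<notin> set (v # r)" using q(1) r v' unfolding augmenting_path_iff by auto
          then have "e \<noteq> {s, v}" using path_edges_subset_set[OF e] by auto
          moreover have "e \<in> ?M \<union> ?N"
            using augmenting_path_edges[OF q(1)] e r v' by auto
          ultimately show "e \<in> M \<union> N" by blast
        qed
        have alt: "alternating M True (v # r)"
        proof -
          have "alternating ?M True (v # r)" using q r v' unfolding augmenting_path_iff by simp
          moreover have "e \<in> ?M \<longleftrightarrow> e \<in> M" if "e \<in> path_edges (v # r)" for e
            using path_edges_subset_set[OF that] tq r v' by auto
          then have "alternating ?M True (v # r) = alternating M True (v # r)"
            by (rule alternating_cong)
          ultimately show ?thesis by simp
        qed
        have "{u, v} \<notin> M"
          using matching_mate[OF less.prems(1), of u v t] u vt by (auto simp: insert_commute)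
        moreover have "last (v # r) \<notin> \<Union>M"
        proof -
          have "last (v # r) \<notin> \<Union>?M" "last (v # r) \<in> set q"
            using q r v' unfolding augmenting_path_iff by auto
          moreover from this have "last (v # r) \<notin> {t, u}" using tq by (metis empty_iff insert_iff)
          ultimately show ?thesis by blast
        qed
        moreover have "distinct (s # t # u # v # r)"
          using q(1) r v' tq t(2) u(2) us unfolding augmenting_path_iff by auto
        moreover have "{s, t} \<notin> M" "s \<notin> \<Union>M" using s(2) by auto
        \<comment> \<open>The path leaves \<open>s\<close> along the shortcut, which expands to
          \<open>s\<close>, \<open>t\<close>, \<open>u\<close>, \<open>v\<close> with
          \<open>{t, u}\<close> as its matched edge.\<close>
        ultimately have "augmenting_path (M \<union> N) M (s # t # u # v # r)"
          unfolding augmenting_path_iff using t(1) u(1) v(1) alt eN by simp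
        then show ?thesis by blast
      qed
    qed
  qed
qed

section \<open>Exchange along an augmenting path\<close>

text \<open>The induction peels off an unmatched and a matched edge together. The remaining tail
  starts at a matched vertex; therefore the first vertex is not assumed to be exposed, and the
  second claim speaks only of \<open>tl p\<close>.\<close>

lemma alternating_flip:
  assumes "matching M" "finite M" "alternating M False p" "distinct p" "length p \<ge> 2" "last p \<notin> \<Union>M"
  shows "matching (path_edges p - M) \<and> (\<forall>e\<in>M. e \<inter> set (tl p) \<noteq> {} \<longrightarrow> e \<in> path_edges p) \<and>
         finite (path_edges p) \<and> card (path_edges p - M) = Suc (card (path_edges p \<inter> M))"
  using assms(3-)
proof (induction p rule: length_induct)
  case (1 p)
  then obtain x y q where p: "p = x # y # q"
    by (metis Suc_le_length_iff numeral_2_eq_2)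
  have xy: "x \<noteq> y" "{x, y} \<notin> M" using 1(2,3) p by auto
  show ?case
  proof (cases q)
    case Nil
    have "y \<notin> \<Union>M" using 1(5) p Nil by simp
    then have "\<forall>e\<in>M. y \<notin> e" by blast
    moreover have "path_edges p - M = {{x, y}}" "path_edges p \<inter> M = {}"
      using xy p Nil by auto
    moreover have "matching {{x, y}}" using xy by (simp add: matching_def)
    ultimately show ?thesis using p Nil by auto
  next
    case (Cons z r)
    have yz: "{y, z} \<in> M" using 1(2) p Cons by simp
    have "r \<noteq> []" using 1(5) p Cons yz by auto
    have zr: "alternating M False (z # r)"
      using 1(2) p Cons by (cases r) auto
    have IH: "matching (path_edges (z # r) - M)"
       "\<forall>e\<in>M. e \<inter> set r \<noteq> {} \<longrightarrow> e \<in> path_edges (z # r)" "finite (path_edges (z # r))"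
       "card (path_edges (z # r) - M) = Suc (card (path_edges (z # r) \<inter> M))"
    proof -
      have "length (z # r) < length p" "distinct (z # r)" "length (z # r) \<ge> 2" "last (z # r) \<notin> \<Union>M"
        using 1(3,5) \<open>r \<noteq> []\<close> p Cons by (auto simp: Suc_le_eq)
      from 1(1)[rule_format, OF this(1) zr this(2-)]
      show "matching (path_edges (z # r) - M)"
       "\<forall>e\<in>M. e \<inter> set r \<noteq> {} \<longrightarrow> e \<in> path_edges (z # r)" "finite (path_edges (z # r))"
       "card (path_edges (z # r) - M) = Suc (card (path_edges (z # r) \<inter> M))"
        by simp_all
    qed
    have new: "x \<notin> \<Union>(path_edges (z # r))" "y \<notin> \<Union>(path_edges (z # r))"
      using path_edges_subset_set[of _ "z # r"] 1(3) p Cons by auto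
    have d: "path_edges p - M = insert {x, y} (path_edges (z # r) - M)"
      "path_edges p \<inter> M = insert {y, z} (path_edges (z # r) \<inter> M)"
      using p Cons xy yz by auto
    have "matching (path_edges p - M)"
      unfolding d by (rule matching_insert) (use IH(1) new xy in auto)
    moreover have "\<forall>e\<in>M. e \<inter> set (tl p) \<noteq> {} \<longrightarrow> e \<in> path_edges p"
    proof (intro ballI impI)
      fix e assume e: "e \<in> M" "e \<inter> set (tl p) \<noteq> {}"
      show "e \<in> path_edges p"
      proof (cases "y \<in> e \<or> z \<in> e")
        case True
        then have "e = {y, z}" using matchingD[OF assms(1) e(1) yz] by auto
        then show ?thesis using p Cons by simp
      next
        case False
        then have "e \<inter> set r \<noteq> {}" using e p Cons by auto
        then show ?thesis using IH(2) e p Cons by auto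
      qed
    qed
    moreover have "{x, y} \<notin> path_edges (z # r) - M" "{y, z} \<notin> path_edges (z # r) \<inter> M"
      using new by auto
    then have "card (path_edges p - M) = Suc (card (path_edges p \<inter> M))"
      unfolding d using IH(3,4) by simp
    moreover have "finite (path_edges p)" using IH(3) p Cons by simp
    ultimately show ?thesis by blast
  qed
qed

lemma augmenting_path_flip:
  assumes "matching M" "finite M" "augmenting_path E M p"
  shows "matching (path_edges p - M)"
    and "e \<in> M \<Longrightarrow> e \<inter> set p \<noteq> {} \<Longrightarrow> e \<in> path_edges p"
    and "finite (path_edges p)"
    and "card (path_edges p - M) = Suc (card (path_edges p \<inter> M))"
proof -
  have *: "alternating M False p" "distinct p" "length p \<ge> 2" "last p \<notin> \<Union>M" "hd p \<notin> \<Union>M"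
    using assms(3) unfolding augmenting_path_iff by auto
  note flip = alternating_flip[OF assms(1,2) *(1-4)]
  then show "matching (path_edges p - M)" "finite (path_edges p)"
    "card (path_edges p - M) = Suc (card (path_edges p \<inter> M))" by auto
  assume e: "e \<in> M" "e \<inter> set p \<noteq> {}"
  then have "hd p \<notin> e" using *(5) by blast
  moreover have "set p = insert (hd p) (set (tl p))" using *(3) by (cases p) auto
  ultimately have "e \<inter> set (tl p) \<noteq> {}" using e(2) by auto
  then show "e \<in> path_edges p" using flip e(1) by blast
qed

lemma augmenting_path_larger:
  assumes "matching M" "finite M" "M \<subseteq> E" "augmenting_path E M p"
  shows "\<exists>N\<subseteq>E. matching N \<and> finite N \<and> card M < card N"
proof -
  let ?P = "path_edges p"
  let ?N = "(M - ?P) \<union> (?P - M)"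
  note flip = augmenting_path_flip[OF assms(1,2,4)]
  have disj: "e \<inter> f = {}" if "e \<in> M - ?P" "f \<in> ?P - M" for e f
    using flip(2)[of e] path_edges_subset_set[of f p] that by blast
  have "matching ?N"
    unfolding matching_def
  proof (intro conjI ballI impI)
    fix e assume "e \<in> ?N" then show "card e = 2"
      using assms(1) flip(1) unfolding matching_def by blast
  next
    fix e f assume ef: "e \<in> ?N" "f \<in> ?N" "e \<inter> f \<noteq> {}"
    then consider "e \<in> M" "f \<in> M" | "e \<in> ?P - M" "f \<in> ?P - M"
      using disj[of e f] disj[of f e] by blast
    then show "e = f" using assms(1) flip(1) ef(3) unfolding matching_def by cases blast+
  qed
  moreover have "card ?N = Suc (card M)"
  proof -
    have "card ?N = card (M - ?P) + card (?P - M)"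
      by (rule card_Un_disjoint) (use assms flip in auto)
    also have "\<dots> = Suc (card (M - ?P) + card (?P \<inter> M))" using flip by simp
    also have "card (M - ?P) + card (?P \<inter> M) = card ((M - ?P) \<union> (?P \<inter> M))"
      by (rule card_Un_disjoint[symmetric]) (use assms flip in auto)
    also have "(M - ?P) \<union> (?P \<inter> M) = M" by blast
    finally show ?thesis .
  qed
  moreover have "?N \<subseteq> E" using assms augmenting_path_edges[OF assms(4)] by blast
  moreover have "finite ?N" using assms flip by simp
  ultimately show ?thesis by (intro exI[of _ ?N]) auto
qed

text \<open>Turns the existence of a path into a comparison of cardinalities, which can be carried
  across a contraction in both directions.\<close>

lemma larger_matching_iff:
  assumes "matching M" "finite E" "M \<subseteq> E"
  shows "(\<exists>N\<subseteq>E. matching N \<and> card M < card N) \<longleftrightarrow> (\<exists>p. augmenting_path E M p)"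
proof
  assume "\<exists>N\<subseteq>E. matching N \<and> card M < card N"
  then obtain N where N: "N \<subseteq> E" "matching N" "card M < card N" by blast
  then have "finite M" "finite N" using assms finite_subset by blast+
  from berge[OF assms(1) N(2) this N(3)] obtain p where p: "augmenting_path (M \<union> N) M p" by blast
  have "M \<union> N \<subseteq> E" using N assms by blast
  with p have "augmenting_path E M p" unfolding augmenting_path_def by blast
  then show "\<exists>p. augmenting_path E M p" by blast
next
  assume "\<exists>p. augmenting_path E M p"
  then obtain p where "augmenting_path E M p" ..
  from augmenting_path_larger[OF assms(1) finite_subset[OF assms(3,2)] assms(3) this]
  show "\<exists>N\<subseteq>E. matching N \<and> card M < card N" by auto
qed

section \<open>Even alternating paths from an exposed root\<close>

text \<open>The exposed vertex is the last one of the list.\<close>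

inductive even_path :: "'a set set \<Rightarrow> 'a set set \<Rightarrow> 'a list \<Rightarrow> bool" for E M where
  root: "x \<notin> \<Union>M \<Longrightarrow> even_path E M [x]"
| step: "even_path E M (x # w) \<Longrightarrow> {x, y} \<in> E \<Longrightarrow> {y, z} \<in> M \<Longrightarrow>
    y \<notin> set (x # w) \<Longrightarrow> z \<notin> set (x # w) \<Longrightarrow> even_path E M (z # y # x # w)"

text \<open>What a flip inside \<open>S\<close> guarantees: edges away from \<open>S\<close> keep
  their status, and no edge of the new matching crosses the border of \<open>S\<close>.\<close>

definition agrees_outside :: "'a set \<Rightarrow> 'a set set \<Rightarrow> 'a set set \<Rightarrow> bool" where
  "agrees_outside S M M' \<longleftrightarrow>
     (\<forall>e. e \<inter> S = {} \<longrightarrow> (e \<in> M' \<longleftrightarrow> e \<in> M)) \<and> (\<forall>e\<in>M'. e \<inter> S = {} \<or> e \<subseteq> S)"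

lemma agrees_outsideD:
  assumes "agrees_outside S M M'"
  shows "e \<inter> S = {} \<Longrightarrow> e \<in> M' \<longleftrightarrow> e \<in> M" and "e \<in> M' \<Longrightarrow> e \<inter> S = {} \<or> e \<subseteq> S"
  using assms unfolding agrees_outside_def by auto

text \<open>Exchanging the matched and the unmatched edges of the path moves the exposed vertex from
  the root to the head and preserves the size.\<close>

lemma even_path_flip:
  assumes "even_path E M w" "matching M" "finite M" "M \<subseteq> E"
  shows "\<exists>M'. matching M' \<and> finite M' \<and> M' \<subseteq> E \<and> card M' = card M \<and> hd w \<notin> \<Union>M' \<and>
              agrees_outside (set w) M M'"
  using assms(1)
proof induction
  case (root x)
  have "agrees_outside {x} M M" unfolding agrees_outside_def using root by blast
  then show ?case using assms root by (intro exI[of _ M]) simp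
next
  case (step x w y z)
  then obtain M' where M': "matching M'" "finite M'" "M' \<subseteq> E" "card M' = card M" "x \<notin> \<Union>M'"
    "agrees_outside (set (x # w)) M M'" by auto
  have "{y, z} \<inter> set (x # w) = {}" using step.hyps by simp
  then have "{y, z} \<in> M'" using agrees_outsideD(1)[OF M'(6)] step.hyps(3) by metis
  moreover have "y \<noteq> z" using matching_irrefl[OF assms(2)] step.hyps(3) by metis
  ultimately have yz: "{y, z} \<in> M'" "y \<noteq> z" by auto
  let ?R = "M' - {{y, z}}"
  let ?M = "insert {x, y} ?R"
  have y: "y \<notin> \<Union>?R" "z \<notin> \<Union>?R" using matchingD[OF M'(1) yz(1)] by blast+
  have xR: "x \<notin> \<Union>?R" using M'(5) by blast
  have "matching ?M"
    using xR y step by (intro matching_insert) (auto intro: matching_mono[OF M'(1)])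
  moreover have "card ?M = card M"
  proof -
    have "{x, y} \<notin> ?R" using y by blast
    then have "card ?M = Suc (card ?R)" using M'(2) by simp
    also have "\<dots> = card M'" using M'(2) yz(1) by (metis card_Suc_Diff1)
    finally show ?thesis using M' by simp
  qed
  moreover have "?M \<subseteq> E" using M' step by auto
  moreover have "z \<notin> \<Union>?M" using y step yz by auto
  moreover have "agrees_outside (set (z # y # x # w)) M ?M"
    unfolding agrees_outside_def
  proof (intro conjI allI impI ballI)
    fix e assume e: "e \<inter> set (z # y # x # w) = {}"
    then have "e \<noteq> {x, y}" "e \<noteq> {y, z}" "e \<inter> set (x # w) = {}" by auto
    then show "e \<in> ?M \<longleftrightarrow> e \<in> M" using agrees_outsideD(1)[OF M'(6), of e] by simp
  next
    fix e assume e: "e \<in> ?M"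
    show "e \<inter> set (z # y # x # w) = {} \<or> e \<subseteq> set (z # y # x # w)"
    proof (cases "e = {x, y}")
      case False
      then have "e \<in> ?R" using e by simp
      then have "y \<notin> e" "z \<notin> e" using y by blast+
      moreover have "e \<inter> set (x # w) = {} \<or> e \<subseteq> set (x # w)"
        using agrees_outsideD(2)[OF M'(6), of e] \<open>e \<in> ?R\<close> by simp
      ultimately show ?thesis by auto
    qed simp
  qed
  ultimately show ?case using M'(2) by (intro exI[of _ ?M]) simp
qed

text \<open>No edge of \<open>M'\<close> crosses the border of \<open>S\<close>, so the root of a
  path outside \<open>S\<close> stays exposed and its matched edges persist.\<close>

lemma even_path_transfer:
  assumes "even_path E M w" "agrees_outside S M M'" "set w \<inter> S = {}"
  shows "even_path E M' w"
  using assms(1,3)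
proof induction
  case (root x)
  have "x \<notin> \<Union>M'"
  proof
    assume "x \<in> \<Union>M'"
    then obtain e where e: "e \<in> M'" "x \<in> e" by blast
    then have "e \<inter> S = {}" using agrees_outsideD(2)[OF assms(2) e(1)] root by auto
    then show False using agrees_outsideD(1)[OF assms(2), of e] e root by blast
  qed
  then show ?case by (rule even_path.root)
next
  case (step x w y z)
  have "{y, z} \<in> M'" using agrees_outsideD(1)[OF assms(2), of "{y, z}"] step by auto
  then show ?case using step by (intro even_path.step) auto
qed

lemma even_path_distinct:
  assumes "even_path E M w" "matching M" shows "distinct w"
  using assms(1) by induction (use matching_irrefl[OF assms(2)] in auto)

lemma even_path_successively:
  assumes "even_path E M w" "M \<subseteq> E" shows "successively (\<lambda>x y. {x, y} \<in> E) w"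
  using assms(1) by induction (use assms(2) in \<open>auto simp: insert_commute\<close>)

text \<open>Flipping both paths, one after the other, exposes both heads; the edge between them can
  then be added.\<close>

lemma disjoint_even_paths_larger:
  assumes "matching M" "finite M" "M \<subseteq> E" "even_path E M w1" "even_path E M w2"
    "set w1 \<inter> set w2 = {}" "{hd w1, hd w2} \<in> E"
  shows "\<exists>N\<subseteq>E. matching N \<and> card M < card N"
proof -
  obtain M1 where M1: "matching M1" "finite M1" "M1 \<subseteq> E" "card M1 = card M" "hd w1 \<notin> \<Union>M1"
    "agrees_outside (set w1) M M1"
    using even_path_flip[OF assms(4,1-3)] by blast
  have "even_path E M1 w2"
    using even_path_transfer[OF assms(5) M1(6)] assms(6) by blast
  then obtain M2 where M2: "matching M2" "finite M2" "M2 \<subseteq> E" "card M2 = card M1" "hd w2 \<notin> \<Union>M2"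
    "agrees_outside (set w2) M1 M2"
    using even_path_flip[OF _ M1(1-3)] by blast
  have ne: "w1 \<noteq> []" "w2 \<noteq> []" using assms(4,5) by (auto elim: even_path.cases)
  then have hd: "hd w1 \<in> set w1" "hd w2 \<in> set w2" by auto
  have h1: "hd w1 \<notin> \<Union>M2"
  proof
    assume "hd w1 \<in> \<Union>M2"
    then obtain e where e: "e \<in> M2" "hd w1 \<in> e" by blast
    then have "e \<inter> set w2 = {}"
      using agrees_outsideD(2)[OF M2(6) e(1)] assms(6) hd by blast
    then have "e \<in> M1" using agrees_outsideD(1)[OF M2(6), of e] e by blast
    then show False using M1(5) e by blast
  qed
  have "hd w1 \<noteq> hd w2" using hd assms(6) by auto
  then have "matching (insert {hd w1, hd w2} M2)"
    using h1 M2 by (intro matching_insert)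
  moreover have "{hd w1, hd w2} \<notin> M2" using h1 by blast
  then have "card M < card (insert {hd w1, hd w2} M2)" using M1 M2 by simp
  ultimately show ?thesis using M2(3) assms(7) by (intro exI[of _ "insert {hd w1, hd w2} M2"]) auto
qed

text \<open>A path with an even number of vertices is perfectly matched by every other edge.\<close>

lemma even_path_matching:
  assumes "successively (\<lambda>x y. {x, y} \<in> E) l" "distinct l" "even (length l)"
  shows "\<exists>N\<subseteq>E. matching N \<and> finite N \<and> \<Union>N = set l"
  using assms
proof (induction l rule: induct_list012)
  case 1
  then show ?case by (intro exI[of _ "{}"]) (auto simp: matching_def)
next
  case (3 x y l)
  have "successively (\<lambda>x y. {x, y} \<in> E) l" using 3(3) by (cases l) auto
  then obtain N where N: "N \<subseteq> E" "matching N" "finite N" "\<Union>N = set l" using 3 by auto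
  then have "matching (insert {x, y} N)" using 3 by (intro matching_insert) auto
  then show ?case using N 3 by (intro exI[of _ "insert {x, y} N"]) auto
qed simp

text \<open>Cut at \<open>c\<close>, the two remaining arcs join through the closing edge to a path
  with an even number of vertices.\<close>

lemma odd_cycle_near_perfect:
  assumes "successively (\<lambda>x y. {x, y} \<in> E) (q @ [hd q])" "distinct q" "odd (length q)" "c \<in> set q"
  shows "\<exists>N\<subseteq>E. matching N \<and> finite N \<and> \<Union>N = set q - {c}"
proof -
  obtain l1 l2 where q: "q = l1 @ c # l2" using assms(4) by (metis split_list)
  have "successively (\<lambda>x y. {x, y} \<in> E) (l2 @ l1)"
  proof (cases l1)
    case Nil
    then show ?thesis using assms(1) q by (auto simp: successively_append_iff successively_Cons)
  next
    case (Cons a l)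
    have s: "successively (\<lambda>x y. {x, y} \<in> E) l1"
      "successively (\<lambda>x y. {x, y} \<in> E) (l2 @ [a])"
    proof -
      have "q @ [hd q] = l1 @ (c # (l2 @ [a]))" using q Cons by simp
      with assms(1) have "successively (\<lambda>x y. {x, y} \<in> E) (l1 @ (c # (l2 @ [a])))" by metis
      then show "successively (\<lambda>x y. {x, y} \<in> E) l1" "successively (\<lambda>x y. {x, y} \<in> E) (l2 @ [a])"
        by (simp_all add: successively_append_iff successively_Cons)
    qed
    then show ?thesis using Cons by (auto simp: successively_append_iff)
  qed
  moreover have "distinct (l2 @ l1)" "even (length (l2 @ l1))" "set (l2 @ l1) = set q - {c}"
    using assms q by auto
  ultimately show ?thesis using even_path_matching by metis
qed

section \<open>Blossoms\<close>

lemma matching_nonempty: "matching M \<Longrightarrow> e \<in> M \<Longrightarrow> e \<noteq> {}"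
  unfolding matching_def by fastforce

text \<open>The representative \<open>b\<close> plays the contracted vertex, so no new vertex type
  is needed. The cardinality condition discards the edges that shrink to a loop.\<close>

definition contract :: "'a set \<Rightarrow> 'a \<Rightarrow> 'a set set \<Rightarrow> 'a set set" where
  "contract B b E = {(\<lambda>v. if v \<in> B then b else v) ` e | e. e \<in> E \<and> card ((\<lambda>v. if v \<in> B then b else v) ` e) = 2}"

lemma contractI:
  "e \<in> E \<Longrightarrow> e' = (\<lambda>v. if v \<in> B then b else v) ` e \<Longrightarrow> card e' = 2 \<Longrightarrow> e' \<in> contract B b E"
  unfolding contract_def by blast

text \<open>Every vertex of \<open>B\<close> other than \<open>b\<close> has its partner in
  \<open>B - {b}\<close>. A matched edge that leaves \<open>B\<close> can therefore meet it only in
  \<open>b\<close>, and the contraction fixes such an edge.\<close>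

lemma contract_eq:
  assumes M: "matching M" and b: "b \<in> B" and inside: "\<And>v. v \<in> B - {b} \<Longrightarrow> \<exists>w\<in>B - {b}. {v, w} \<in> M"
  shows "contract B b M = {e \<in> M. \<not> e \<subseteq> B}"
    and "\<Union>{e \<in> M. e \<subseteq> B} = B - {b}"
proof -
  let ?r = "\<lambda>v. if v \<in> B then b else v"
  have touch: "e \<subseteq> B - {b}" if "e \<in> M" "v \<in> e" "v \<in> B - {b}" for e v
    using inside[OF that(3)] matchingD[OF M that(1) _ that(2)] that(3) by fastforce
  have id: "?r ` e = e" if "e \<in> M" "\<not> e \<subseteq> B" for e
  proof -
    have "?r v = v" if "v \<in> e" for v
      using touch[of e v] that \<open>e \<in> M\<close> \<open>\<not> e \<subseteq> B\<close> by auto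
    then show ?thesis by (simp cong: image_cong)
  qed
  have c2: "card (?r ` e) \<noteq> 2" if "e \<subseteq> B" for e
  proof -
    have "?r ` e \<subseteq> {b}" using that by auto
    then have "card (?r ` e) \<le> 1" using card_mono[of "{b}" "?r ` e"] by simp
    then show ?thesis by simp
  qed
  have card: "card e = 2" if "e \<in> M" for e using M that unfolding matching_def by blast
  show "contract B b M = {e \<in> M. \<not> e \<subseteq> B}"
  proof (intro set_eqI iffI)
    fix e assume "e \<in> contract B b M"
    then obtain e0 where e0: "e = ?r ` e0" "e0 \<in> M" "card (?r ` e0) = 2"
      unfolding contract_def by blast
    then have "\<not> e0 \<subseteq> B" using c2 by blast
    then show "e \<in> {e \<in> M. \<not> e \<subseteq> B}" using id[of e0] e0 by simp
  next
    fix e assume "e \<in> {e \<in> M. \<not> e \<subseteq> B}"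
    then have e: "e \<in> M" "\<not> e \<subseteq> B" by auto
    then have "e = ?r ` e" using id by metis
    moreover have "card (?r ` e) = 2" using id[OF e] card[OF e(1)] by metis
    ultimately show "e \<in> contract B b M" unfolding contract_def using e(1) by blast
  qed
  show "\<Union>{e \<in> M. e \<subseteq> B} = B - {b}"
  proof (intro set_eqI iffI)
    fix v assume "v \<in> \<Union>{e \<in> M. e \<subseteq> B}"
    then obtain e where e: "e \<in> M" "e \<subseteq> B" "v \<in> e" by blast
    obtain w where w: "w \<noteq> v" "e = {v, w}" using matching_edge[OF M e(1,3)] by blast
    show "v \<in> B - {b}"
    proof (cases "v = b")
      case True
      then have "w \<in> B - {b}" using w e by auto
      then have "e \<subseteq> B - {b}" using touch[OF e(1), of w] w by auto
      then show ?thesis using e(3) by blast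
    qed (use e in auto)
  next
    fix v assume v: "v \<in> B - {b}"
    then obtain w where "w \<in> B - {b}" "{v, w} \<in> M" using inside by blast
    then show "v \<in> \<Union>{e \<in> M. e \<subseteq> B}" using v by (intro UnionI[of "{v, w}"]) auto
  qed
qed

text \<open>
  \<open>M'\<close> is \<open>M\<close> flipped along the stem of the blossom: as \<open>M'\<close> leaves \<open>b\<close> exposed, an
  \<open>M'\<close>-augmenting path that meets \<open>B\<close> can be cut off where it first enters \<open>B\<close>.
\<close>

lemma contract_blossom:
  assumes E: "finite E" "\<And>e. e \<in> E \<Longrightarrow> card e = 2"
    and M: "matching M" "M \<subseteq> E" and M': "matching M'" "M' \<subseteq> E" "card M' = card M" "b \<notin> \<Union>M'"
    and B: "finite B" "b \<in> B"
    and near: "\<And>c. c \<in> B \<Longrightarrow> \<exists>N\<subseteq>E. matching N \<and> \<Union>N = B - {c}"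
    and inside: "\<And>v. v \<in> B - {b} \<Longrightarrow> \<exists>w\<in>B - {b}. {v, w} \<in> M"
    and inside': "\<And>v. v \<in> B - {b} \<Longrightarrow> \<exists>w\<in>B - {b}. {v, w} \<in> M'"
  shows "(\<exists>N\<subseteq>E. matching N \<and> card M < card N) \<longleftrightarrow>
         (\<exists>N\<subseteq>contract B b E. matching N \<and> card (contract B b M) < card N)"
    and "matching (contract B b M)" "contract B b M \<subseteq> contract B b E"
proof -
  let ?r = "\<lambda>v. if v \<in> B then b else v"
  have cM: "contract B b M = {e \<in> M. \<not> e \<subseteq> B}"
    by (rule contract_eq(1)[OF M(1) B(2)]) (rule inside)
  have cM': "contract B b M' = {e \<in> M'. \<not> e \<subseteq> B}"
    by (rule contract_eq(1)[OF M'(1) B(2)]) (rule inside')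
  show mon: "contract B b M \<subseteq> contract B b E" using M(2) unfolding contract_def by blast
  show mM: "matching (contract B b M)" unfolding cM by (rule matching_mono[OF M(1)]) auto
  have fin: "finite N" if "N \<subseteq> E" for N using that E(1) finite_subset by blast
  have size: "2 * card N = card B - 1" if "N \<subseteq> E" "matching N" "\<Union>N = B - {c}" "c \<in> B" for N c
    using card_Union_matching[OF that(2) fin[OF that(1)]] that(3,4) B(1) by simp
  \<comment> \<open>\<open>M\<close>, \<open>M'\<close> and the near-perfect matchings of
    \<open>B\<close> all have exactly \<open>k\<close> edges inside \<open>B\<close>, so contraction
    lowers every size in question by the same amount.\<close>
  define k where "k = (card B - 1) div 2"
  have split: "card {e \<in> L. \<not> e \<subseteq> B} + k = card L"
    if L: "L \<subseteq> E" "matching L" and i: "\<And>v. v \<in> B - {b} \<Longrightarrow> \<exists>w\<in>B - {b}. {v, w} \<in> L" for L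
  proof -
    have "\<Union>{e \<in> L. e \<subseteq> B} = B - {b}" by (rule contract_eq(2)[OF L(2) B(2)]) (rule i)
    moreover have "matching {e \<in> L. e \<subseteq> B}" by (rule matching_mono[OF L(2)]) blast
    ultimately have "2 * card {e \<in> L. e \<subseteq> B} = card B - 1"
      using L(1) B(2) by (intro size[of _ b]) auto
    then have "card {e \<in> L. e \<subseteq> B} = k" unfolding k_def by simp
    moreover have "card L = card ({e \<in> L. \<not> e \<subseteq> B} \<union> {e \<in> L. e \<subseteq> B})"
      by (rule arg_cong[of _ _ card]) blast
    moreover have "\<dots> = card {e \<in> L. \<not> e \<subseteq> B} + card {e \<in> L. e \<subseteq> B}"
      by (rule card_Un_disjoint) (use fin[OF L(1)] in auto)
    ultimately show ?thesis by simp
  qed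
  have cardM: "card (contract B b M) + k = card M" unfolding cM by (rule split[OF M(2,1)]) (rule inside)
  have cardM': "card (contract B b M') + k = card M'" unfolding cM' by (rule split[OF M'(2,1)]) (rule inside')
  have finc: "finite (contract B b E)"
  proof -
    have "contract B b E \<subseteq> (\<lambda>e. ?r ` e) ` E" unfolding contract_def by blast
    then show ?thesis using E(1) finite_surj by blast
  qed
  show "(\<exists>N\<subseteq>E. matching N \<and> card M < card N) \<longleftrightarrow>
         (\<exists>N\<subseteq>contract B b E. matching N \<and> card (contract B b M) < card N)" (is "?l \<longleftrightarrow> ?r'")
  proof
    assume ?r'
    then obtain N where N: "N \<subseteq> contract B b E" "matching N" "card (contract B b M) < card N" by blast
    have finN: "finite N" using N(1) finc finite_subset by blast
    have keep: "e \<in> E \<and> e \<inter> B = {}" if "e \<in> N" "b \<notin> e" for e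
    proof -
      obtain e0 where e0: "e = ?r ` e0" "e0 \<in> E" using N(1) \<open>e \<in> N\<close> unfolding contract_def by blast
      have "e0 \<inter> B = {}" using that(2) e0(1) by auto
      then have "?r ` e0 = id ` e0" by (intro image_cong) auto
      then show ?thesis using e0 \<open>e0 \<inter> B = {}\<close> by simp
    qed
    \<comment> \<open>At most one edge of \<open>N\<close> contains \<open>b\<close>, and it stems
      from an edge \<open>{c, v}\<close> with \<open>c\<close> in \<open>B\<close>. Putting that
      edge back leaves all of \<open>B - {c}\<close> free, to be filled by a near-perfect
      matching.\<close>
    have "\<exists>L c. L \<subseteq> E \<and> matching L \<and> c \<in> B \<and> \<Union>L \<inter> B \<subseteq> {c} \<and> card L = card N"
    proof (cases "b \<in> \<Union>N")
      case False
      then have "N \<subseteq> E" "\<Union>N \<inter> B = {}" using keep by blast+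
      then show ?thesis using N B by blast
    next
      case True
      then obtain e where e: "e \<in> N" "b \<in> e" by blast
      obtain v where v: "v \<noteq> b" "e = {b, v}" using matching_edge[OF N(2) e] by blast
      obtain e0 where e0: "e = ?r ` e0" "e0 \<in> E" using N(1) e(1) unfolding contract_def by blast
      have vB: "v \<notin> B"
      proof
        assume "v \<in> B"
        have "v \<in> ?r ` e0" unfolding e0(1)[symmetric] v(2) by simp
        then obtain u where "v = ?r u" by blast
        then show False using \<open>v \<in> B\<close> v(1) by (cases "u \<in> B") auto
      qed
      obtain x y where xy: "e0 = {x, y}" "x \<noteq> y" using E(2)[OF e0(2)] by (meson card_2_iff)
      have "{?r x, ?r y} = {b, v}" using e0(1) v(2) xy(1) by auto
      then have "(?r x = b \<and> ?r y = v) \<or> (?r x = v \<and> ?r y = b)"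
        by (simp add: doubleton_eq_iff split del: if_split)
      then have "\<exists>c\<in>B. e0 = {c, v}"
        using xy v(1) vB B(2) by (auto split: if_splits)
      then obtain c where c: "c \<in> B" "e0 = {c, v}" by blast
      let ?R = "N - {e}"
      have bR: "b \<notin> \<Union>?R" "v \<notin> \<Union>?R" using matchingD[OF N(2) e(1)] v(2) by auto
      then have R: "f \<in> E \<and> f \<inter> B = {}" if "f \<in> ?R" for f using keep[of f] that by blast
      have "matching (insert {c, v} ?R)"
        using R c vB bR by (intro matching_insert matching_mono[OF N(2)]) auto
      moreover have "card (insert {c, v} ?R) = card N"
      proof -
        have "{c, v} \<notin> ?R" using R c by auto
        then show ?thesis using finN e(1) by (metis card_Suc_Diff1 card_insert_disjoint finite_Diff)
      qed
      moreover have "?R \<subseteq> E" "\<Union>?R \<inter> B = {}" using R by blast+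
      then have "insert {c, v} ?R \<subseteq> E" "\<Union>(insert {c, v} ?R) \<inter> B \<subseteq> {c}"
        using e0(2) c vB by blast+
      ultimately show ?thesis using c(1) by blast
    qed
    then obtain L c where L: "L \<subseteq> E" "matching L" "c \<in> B" "\<Union>L \<inter> B \<subseteq> {c}" "card L = card N" by blast
    obtain K where K: "K \<subseteq> E" "matching K" "\<Union>K = B - {c}" using near[OF L(3)] by blast
    have disj: "e \<inter> f = {}" if "e \<in> L" "f \<in> K" for e f
    proof -
      have "f \<subseteq> B - {c}" "e \<inter> B \<subseteq> {c}" using that K(3) L(4) by blast+
      then show ?thesis by blast
    qed
    have "matching (L \<union> K)"
      unfolding matching_def
    proof (intro conjI ballI impI)
      fix e assume "e \<in> L \<union> K" then show "card e = 2"
        using K(2) L(2) unfolding matching_def by blast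
    next
      fix e f assume ef: "e \<in> L \<union> K" "f \<in> L \<union> K" "e \<inter> f \<noteq> {}"
      then consider "e \<in> L" "f \<in> L" | "e \<in> K" "f \<in> K"
        using disj[of e f] disj[of f e] by blast
      then show "e = f" using K(2) L(2) ef(3) unfolding matching_def by cases blast+
    qed
    moreover have "card (L \<union> K) = card L + card K"
    proof (rule card_Un_disjoint)
      show "L \<inter> K = {}"
      proof (rule ccontr)
        assume "L \<inter> K \<noteq> {}"
        then obtain e where "e \<in> L" "e \<in> K" by blast
        then have "e = {}" using disj by blast
        then show False using matching_nonempty[OF L(2)] \<open>e \<in> L\<close> by blast
      qed
    qed (use fin L(1) K(1) in auto)
    moreover have "card K = k" using size[OF K L(3)] unfolding k_def by simp
    ultimately show ?l
      using L(1,5) K(1) N(3) cardM by (intro exI[of _ "L \<union> K"]) auto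
  next
    assume ?l
    then obtain N where "N \<subseteq> E" "matching N" "card M' < card N" using M'(3) by auto
    then have "\<exists>p. augmenting_path E M' p"
      using larger_matching_iff[OF M'(1) E(1) M'(2)] by blast
    \<comment> \<open>The only vertex of \<open>B\<close> that \<open>M'\<close> leaves exposed is
      \<open>b\<close>, so at most one end of the path lies in \<open>B\<close>; reversal makes it
      the last.\<close>
    moreover have "\<exists>p. augmenting_path E M' p \<and> (set p \<inter> B \<noteq> {} \<longrightarrow> hd p \<notin> B)" if p: "augmenting_path E M' p" for p
    proof (cases "hd p \<in> B")
      case True
      have ne: "length p \<ge> 2" "distinct p" "hd p \<notin> \<Union>M'" "last p \<notin> \<Union>M'"
        using p unfolding augmenting_path_def by auto
      have "v = b" if "v \<in> B" "v \<notin> \<Union>M'" for v using inside'[of v] that by blast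
      moreover have "hd p \<noteq> last p" using ne(1,2) by (cases p) auto
      ultimately have "last p \<notin> B" using True ne by metis
      then show ?thesis using augmenting_path_rev[OF p] ne(1) by (intro exI[of _ "rev p"]) (auto simp: hd_rev)
    qed (use p in blast)
    ultimately obtain p where p: "augmenting_path E M' p" "set p \<inter> B \<noteq> {} \<longrightarrow> hd p \<notin> B" by blast
    note p' = p(1)[unfolded augmenting_path_iff]
    have E': "e \<in> contract B b E" if "e \<in> E" "e \<inter> B = {}" for e
    proof -
      have "?r ` e = id ` e" using that(2) by (intro image_cong) auto
      then have "e = ?r ` e" by simp
      then show ?thesis by (rule contractI[OF that(1)]) (rule E(2)[OF that(1)])
    qed
    have out: "e \<in> contract B b M' \<longleftrightarrow> e \<in> M'" if "e \<inter> B = {}" for e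
    proof -
      have "\<not> e \<subseteq> B" if "e \<in> M'"
        using matching_nonempty[OF M'(1) that] \<open>e \<inter> B = {}\<close> by blast
      then show ?thesis unfolding cM' by blast
    qed
    \<comment> \<open>Since \<open>M'\<close> matches \<open>B - {b}\<close> within itself and
      leaves \<open>b\<close> exposed, its contraction does not touch \<open>B\<close> at
      all.\<close>
    have notM': "e \<notin> contract B b M'" if ne: "e \<inter> B \<noteq> {}" for e
    proof
      assume "e \<in> contract B b M'"
      then have e: "e \<in> M'" "\<not> e \<subseteq> B" unfolding cM' by auto
      obtain v where v: "v \<in> e" "v \<in> B" using ne by blast
      then have "v \<noteq> b" using M'(4) e by blast
      then obtain w where "w \<in> B" "{v, w} \<in> M'" using inside' v by blast
      then show False using matchingD[OF M'(1) e(1) _ v(1)] e(2) v(2) by blast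
    qed
    have bc: "b \<notin> \<Union>(contract B b M')" using notM' B(2) by blast
    have sub: "x \<notin> \<Union>(contract B b M')" if "x \<notin> \<Union>M'" for x using that unfolding cM' by blast
    have "\<exists>q. augmenting_path (contract B b E) (contract B b M') q"
    proof (cases "set p \<inter> B = {}")
      case True
      have pe: "e \<inter> B = {}" if "e \<in> path_edges p" for e
        using path_edges_subset_set[OF that] True by blast
      have "alternating (contract B b M') False p = alternating M' False p"
        by (rule alternating_cong) (use out pe in blast)
      moreover have "path_edges p \<subseteq> contract B b E" using p' E' pe by blast
      ultimately have "augmenting_path (contract B b E) (contract B b M') p"
        unfolding augmenting_path_iff using p' sub by blast
      then show ?thesis by blast
    next
      case False
      then have "\<exists>c\<in>set p. c \<in> B" by blast
      from split_list_first_prop[OF this] obtain p1 c p2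
        where s: "p = p1 @ c # p2" "c \<in> B" "\<forall>x\<in>set p1. x \<notin> B" by blast
      have "p1 \<noteq> []" using p(2) s by auto
      have key: "alternating (contract B b M') \<beta> (l @ [b]) \<and> path_edges (l @ [b]) \<subseteq> contract B b E"
        if "alternating M' \<beta> (l @ c # p2)" "path_edges (l @ c # p2) \<subseteq> E" "\<forall>x\<in>set l. x \<notin> B" for l \<beta>
        using that
      proof (induction l arbitrary: \<beta>)
        case (Cons x l)
        show ?case
        proof (cases l)
          case Nil
          have xc: "{x, c} \<in> E" "({x, c} \<in> M') = \<beta>" "x \<notin> B" using Cons.prems Nil by auto
          \<comment> \<open>If \<open>M'\<close> covers \<open>c\<close>, the partner lies in
            \<open>B\<close>, while \<open>x\<close> does not. The edge that enters \<open>B\<close>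
            is thus unmatched, as the last edge of an augmenting path has to be.\<close>
          have "{x, c} \<notin> M'"
          proof
            assume m: "{x, c} \<in> M'"
            then have "c \<noteq> b" using M'(4) by blast
            then obtain w where "w \<in> B" "{c, w} \<in> M'" using inside' s(2) by blast
            then show False using matching_mate[OF M'(1), of c w x] m xc(3) by (auto simp: insert_commute)
          qed
          then have "\<not> \<beta>" using xc(2) by simp
          moreover have "{x, b} \<notin> contract B b M'" by (rule notM') (use B(2) in blast)
          moreover have "{x, b} \<in> contract B b E"
          proof -
            have "x \<noteq> b" using xc(3) B(2) by blast
            then have "?r ` {x, c} = {x, b}" "card {x, b} = 2" using xc(3) s(2) by auto
            then show ?thesis by (intro contractI[OF xc(1)]) auto
          qed
          ultimately show ?thesis using Nil by simp
        next
          case (Cons y l')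
          have xy: "{x, y} \<in> E" "({x, y} \<in> M') = \<beta>" "{x, y} \<inter> B = {}"
            using Cons.prems Cons by auto
          have "alternating M' (\<not> \<beta>) (l @ c # p2)" "path_edges (l @ c # p2) \<subseteq> E" "\<forall>x\<in>set l. x \<notin> B"
            using Cons.prems Cons by auto
          from Cons.IH[OF this] show ?thesis using xy out[OF xy(3)] E'[OF xy(1,3)] Cons by simp
        qed
      qed simp
      have q: "alternating (contract B b M') False (p1 @ [b])" "path_edges (p1 @ [b]) \<subseteq> contract B b E"
        using key[of False p1] p' s by auto
      have "b \<notin> set p1" "distinct p1" "hd (p1 @ [b]) = hd p"
        using s p' B(2) \<open>p1 \<noteq> []\<close> by auto
      moreover have "2 \<le> length (p1 @ [b])" using \<open>p1 \<noteq> []\<close> by (cases p1) auto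
      ultimately have "augmenting_path (contract B b E) (contract B b M') (p1 @ [b])"
        unfolding augmenting_path_iff using q sub bc p' by simp
      then show ?thesis by blast
    qed
    then obtain q where q: "augmenting_path (contract B b E) (contract B b M') q" ..
    have cM'E: "contract B b M' \<subseteq> contract B b E" using M'(2) unfolding contract_def by blast
    have mM': "matching (contract B b M')" unfolding cM' by (rule matching_mono[OF M'(1)]) auto
    have "card (contract B b M') = card (contract B b M)" using cardM cardM' M'(3) by simp
    then show ?r'
      using augmenting_path_larger[OF mM' finite_subset[OF cM'E finc] cM'E q] by auto
  qed
qed

section \<open>Alternating forests\<close>

text \<open>The outer vertices of the forest are the heads of its paths, each of which leads to a root.\<close>

inductive forest :: "'a set set \<Rightarrow> 'a set set \<Rightarrow> 'a list list \<Rightarrow> bool" for E M where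
  Nil: "forest E M []"
| root: "forest E M F \<Longrightarrow> x \<notin> \<Union>M \<Longrightarrow> x \<notin> hd ` set F \<Longrightarrow> forest E M ([x] # F)"
| grow: "forest E M F \<Longrightarrow> w \<in> set F \<Longrightarrow> {hd w, y} \<in> E \<Longrightarrow> y \<notin> hd ` set F \<Longrightarrow>
    {y, z} \<in> M \<Longrightarrow> z \<notin> hd ` set F \<Longrightarrow> forest E M ((z # y # w) # F)"

text \<open>A vertex on a stored path that is not outer is matched to an outer one. Hence a matched
  edge with neither end among the heads touches no stored path.\<close>

lemma forest_vertex:
  assumes "forest E M F" "w \<in> set F" "v \<in> set w"
  shows "v \<in> hd ` set F \<or> (\<exists>z\<in>hd ` set F. {v, z} \<in> M)"
  using assms
proof (induction arbitrary: w)
  case (grow F w0 y z)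
  show ?case
  proof (cases "v \<in> {y, z}")
    case True
    then show ?thesis using grow.hyps(5) by auto
  next
    case False
    then have "v \<in> set w0 \<or> (w \<in> set F \<and> v \<in> set w)" using grow.prems by auto
    then have "v \<in> hd ` set F \<or> (\<exists>z\<in>hd ` set F. {v, z} \<in> M)"
      using grow.IH[of w0] grow.IH[of w] grow.hyps(2) by blast
    then show ?thesis by auto
  qed
qed auto

text \<open>Rule \<open>grow\<close> tests freshness only against the heads, as the program does. By
  \<open>forest_vertex\<close> and the uniqueness of mates, this already keeps \<open>y\<close> and
  \<open>z\<close> off the whole path.\<close>

lemma forest_even_path:
  assumes "forest E M F" "matching M" "w \<in> set F" shows "even_path E M w"
  using assms(1,3)
proof (induction arbitrary: w)
  case (grow F w0 y z)
  show ?case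
  proof (cases "w \<in> set F")
    case False
    then have w: "w = z # y # w0" using grow.prems by simp
    have ep: "even_path E M w0" using grow by blast
    then obtain x l where w0: "w0 = x # l" by (auto elim: even_path.cases)
    have "y \<notin> set w0" "z \<notin> set w0"
      using forest_vertex[OF grow.hyps(1,2)] grow.hyps(4-6)
      by (metis insert_commute matching_mate[OF assms(2)])+
    then show ?thesis unfolding w w0 using ep grow.hyps w0 by (intro even_path.step) auto
  qed (use grow in blast)
qed (auto intro: even_path.root)

text \<open>The shape of a tree path above the vertex where it meets another one: outer vertices,
  each followed by its partner.\<close>

fun paired :: "'a set set \<Rightarrow> 'a list \<Rightarrow> bool" where
  "paired M [] \<longleftrightarrow> True"
| "paired M [x] \<longleftrightarrow> False"
| "paired M (x # y # l) \<longleftrightarrow> {x, y} \<in> M \<and> paired M l"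

lemma paired_even: "paired M l \<Longrightarrow> even (length l)"
  by (induction M l rule: paired.induct) auto

lemma paired_mate: "paired M l \<Longrightarrow> v \<in> set l \<Longrightarrow> \<exists>w\<in>set l. {v, w} \<in> M"
  by (induction M l rule: paired.induct) (auto simp: insert_commute)

text \<open>A path arises by extending a stored path at its head, so two paths agree from their
  first common vertex on. That vertex is outer, because the common tail is itself a stored
  path.\<close>

lemma forest_meet:
  assumes "forest E M F" "matching M" "w1 \<in> set F" "w2 \<in> set F" "set w1 \<inter> set w2 \<noteq> {}"
  shows "\<exists>a1 a2 b c. w1 = a1 @ b # c \<and> w2 = a2 @ b # c \<and> set a1 \<inter> set a2 = {} \<and>
           paired M a1 \<and> paired M a2 \<and> b # c \<in> set F"
  using assms(1,3-)
proof (induction arbitrary: w1 w2)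
  case (root F x)
  have new: "x \<notin> set w" if "w \<in> set F" for w
    using forest_vertex[OF root.hyps(1) that] root.hyps(2,3) by blast
  show ?case
  proof (cases "w1 \<in> set F \<and> w2 \<in> set F")
    case True
    then show ?thesis using root.IH[of w1 w2] root.prems by (metis list.set_intros(2))
  next
    case False
    then have "w1 = [x]" "w2 = [x]" using root.prems new by auto
    then show ?thesis by (intro exI[of _ "[]"] exI[of _ x]) simp
  qed
next
  case (grow F w y z)
  have new: "y \<notin> set u" "z \<notin> set u" if "u \<in> set F" for u
    using forest_vertex[OF grow.hyps(1) that] grow.hyps(4-6)
    by (metis insert_commute matching_mate[OF assms(2)])+
  have zy: "{z, y} \<in> M" using grow.hyps(5) by (simp add: insert_commute)
  have "w \<noteq> []" using forest_even_path[OF grow.hyps(1) assms(2) grow.hyps(2)] by (auto elim: even_path.cases)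
  then obtain x l where xl: "w = x # l" by (cases w) auto
  consider "w1 \<in> set F" "w2 \<in> set F" | "w1 = z # y # w" "w2 \<in> set F"
    | "w1 \<in> set F" "w2 = z # y # w" | "w1 = z # y # w" "w2 = z # y # w"
    using grow.prems by auto
  then show ?case
  proof cases
    case 1
    then show ?thesis using grow.IH[of w1 w2] grow.prems by (metis list.set_intros(2))
  next
    case 2
    then have "set w \<inter> set w2 \<noteq> {}" using grow.prems(3) new by auto
    from grow.IH[OF grow.hyps(2) 2(2) this] obtain a1 a2 b c where
      h: "w = a1 @ b # c" "w2 = a2 @ b # c" "set a1 \<inter> set a2 = {}" "paired M a1" "paired M a2"
      "b # c \<in> set F" by blast
    have "z \<notin> set a2" "y \<notin> set a2" using new[OF 2(2)] h(2) by auto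
    then show ?thesis
      using h 2 zy by (intro exI[of _ "z # y # a1"] exI[of _ a2] exI[of _ b] exI[of _ c]) auto
  next
    case 3
    then have "set w1 \<inter> set w \<noteq> {}" using grow.prems(3) new by auto
    from grow.IH[OF 3(1) grow.hyps(2) this] obtain a1 a2 b c where
      h: "w1 = a1 @ b # c" "w = a2 @ b # c" "set a1 \<inter> set a2 = {}" "paired M a1" "paired M a2"
      "b # c \<in> set F" by blast
    have "z \<notin> set a1" "y \<notin> set a1" using new[OF 3(1)] h(1) by auto
    then show ?thesis
      using h 3 zy by (intro exI[of _ a1] exI[of _ "z # y # a2"] exI[of _ b] exI[of _ c]) auto
  next
    case 4
    then show ?thesis by (intro exI[of _ "[]"] exI[of _ z] exI[of _ "y # w"]) simp
  qed
qed simp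

text \<open>Walk along the path two edges at a time: every unmatched edge starts at an outer vertex,
  so by \<open>free\<close> it ends at one that is not outer. The last vertex, however, is exposed
  and hence outer.\<close>

lemma forest_stable:
  assumes F: "forest E M F" and "matching M" "M \<subseteq> E"
    and exposed: "\<And>x. x \<in> \<Union>E \<Longrightarrow> x \<notin> \<Union>M \<Longrightarrow> x \<in> hd ` set F"
    and closed: "\<And>x y z. x \<in> hd ` set F \<Longrightarrow> {x, y} \<in> E \<Longrightarrow> y \<notin> hd ` set F \<Longrightarrow> {y, z} \<in> M \<Longrightarrow>
      z \<in> hd ` set F"
    and free: "\<And>x y. x \<in> hd ` set F \<Longrightarrow> {x, y} \<in> E \<Longrightarrow> y \<notin> hd ` set F"
  shows "\<not> augmenting_path E M p"
proof
  assume p: "augmenting_path E M p"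
  have False if "alternating M False p" "path_edges p \<subseteq> E" "length p \<ge> 2" "hd p \<in> hd ` set F" "last p \<notin> \<Union>M" for p
    using that
  proof (induction p rule: induct_list012)
    case (3 x y q)
    have xy: "{x, y} \<in> E" "x \<in> hd ` set F" using 3(4,6) by auto
    then have y: "y \<notin> hd ` set F" using free by blast
    show False
    proof (cases q)
      case Nil
      then have "y \<notin> \<Union>M" "y \<in> \<Union>E" using 3(7) xy by auto
      then show False using exposed y by blast
    next
      case (Cons z r)
      then have "{y, z} \<in> M" using 3(3) by simp
      then have z: "z \<in> hd ` set F" using closed xy y by blast
      have "r \<noteq> []" using 3(7) Cons \<open>{y, z} \<in> M\<close> by auto
      then have "length q \<ge> 2" "alternating M False q" "path_edges q \<subseteq> E" "hd q \<in> hd ` set F" "last q \<notin> \<Union>M"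
        using 3(3,4,7) z Cons by (cases r; auto)+
      then show False using 3(1) by blast
    qed
  qed auto
  moreover have "hd p \<in> hd ` set F"
  proof (rule exposed)
    have "hd p \<in> set p" using p unfolding augmenting_path_def by (cases p) auto
    then show "hd p \<in> \<Union>E"
      using augmenting_path_covered[OF p] augmenting_path_edges[OF p] by blast
  qed (use p in \<open>simp add: augmenting_path_def\<close>)
  ultimately show False using p unfolding augmenting_path_iff by blast
qed

text \<open>The parts of the two paths above \<open>b\<close> and the edge between the heads form
  the odd cycle; \<open>b # c\<close> is its stem. The last claim, a matched edge inside the cycle,
  is what makes repeated contraction terminate.\<close>

lemma forest_blossom:
  assumes F: "forest E M F" and E: "finite E" "\<And>e. e \<in> E \<Longrightarrow> card e = 2" and M: "matching M" "M \<subseteq> E"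
    and w: "w1 \<in> set F" "w2 \<in> set F" "{hd w1, hd w2} \<in> E"
    and split: "w1 = a1 @ b # c" "w2 = a2 @ b # c" "set a1 \<inter> set a2 = {}" "paired M a1" "paired M a2"
      "b # c \<in> set F"
    and B: "B = set a1 \<union> set a2 \<union> {b}"
  shows "(\<exists>N\<subseteq>E. matching N \<and> card M < card N) \<longleftrightarrow>
         (\<exists>N\<subseteq>contract B b E. matching N \<and> card (contract B b M) < card N)"
    and "matching (contract B b M)" "contract B b M \<subseteq> contract B b E" "\<exists>e\<in>M. e \<subseteq> B"
proof -
  note ep = forest_even_path[OF F M(1)]
  have finM: "finite M" using M(2) E(1) finite_subset by blast
  have hd: "hd w1 \<noteq> hd w2" using E(2)[OF w(3)] by auto
  have dist: "distinct w1" "distinct w2" using even_path_distinct[OF ep M(1)] w by auto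
  have suc: "successively (\<lambda>x y. {x, y} \<in> E) w1" "successively (\<lambda>x y. {x, y} \<in> E) w2"
    using even_path_successively[OF ep M(2)] w by auto
  \<comment> \<open>Flipping the stem exposes the base \<open>b\<close> and leaves the matched edges
    on the rest of the cycle alone.\<close>
  obtain M' where M': "matching M'" "finite M'" "M' \<subseteq> E" "card M' = card M" "b \<notin> \<Union>M'"
    "agrees_outside (set (b # c)) M M'"
    using even_path_flip[OF ep[OF split(6)] M(1) finM M(2)] by auto
  have pair: "\<exists>w\<in>B - {b}. {v, w} \<in> M" if "v \<in> B - {b}" for v
  proof -
    have "v \<in> set a1 \<or> v \<in> set a2" using that B by auto
    then obtain w where "{v, w} \<in> M" "w \<in> set a1 \<or> w \<in> set a2"
      using paired_mate[OF split(4)] paired_mate[OF split(5)] by blast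
    moreover have "b \<notin> set a1" "b \<notin> set a2" using dist split(1,2) by auto
    ultimately show ?thesis using B by blast
  qed
  have out: "v \<notin> set (b # c)" if "v \<in> B - {b}" for v using that dist split(1,2) B by auto
  have pair': "\<exists>w\<in>B - {b}. {v, w} \<in> M'" if "v \<in> B - {b}" for v
  proof -
    obtain w where w: "w \<in> B - {b}" "{v, w} \<in> M" using pair[OF \<open>v \<in> B - {b}\<close>] by blast
    then have "{v, w} \<inter> set (b # c) = {}" using out that by auto
    then have "{v, w} \<in> M'" using agrees_outsideD(1)[OF M'(6)] w(2) by metis
    then show ?thesis using w(1) by blast
  qed
  have near: "\<exists>N\<subseteq>E. matching N \<and> \<Union>N = B - {v}" if v: "v \<in> B" for v
  proof -
    \<comment> \<open>The cycle read from \<open>b\<close> up to \<open>hd w1\<close>, across the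
      joining edge to \<open>hd w2\<close>, and down again towards \<open>b\<close>.\<close>
    let ?q = "b # rev a1 @ a2"
    have q: "distinct ?q" "set ?q = B" using dist split(1-3) B by auto
    have odd: "odd (length ?q)" using paired_even[OF split(4)] paired_even[OF split(5)] by simp
    have sym: "successively (\<lambda>x y. {x, y} \<in> E) (rev l)" if "successively (\<lambda>x y. {x, y} \<in> E) l" for l
      using that by (simp add: insert_commute)
    have "w1 = (a1 @ [b]) @ c" "w2 = (a2 @ [b]) @ c" using split(1,2) by auto
    then have s: "successively (\<lambda>x y. {x, y} \<in> E) (a1 @ [b])" "successively (\<lambda>x y. {x, y} \<in> E) (a2 @ [b])"
      using suc by (metis successively_append_iff)+
    have "hd (a1 @ [b]) = hd w1" "hd (a2 @ [b]) = hd w2" using split(1,2) by (cases a1; cases a2; simp)+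
    then have "{last (rev (a1 @ [b])), hd (a2 @ [b])} \<in> E" using w(3) unfolding last_rev by simp
    then have "successively (\<lambda>x y. {x, y} \<in> E) (rev (a1 @ [b]) @ (a2 @ [b]))"
      using sym[OF s(1)] s(2) by (subst successively_append_iff) auto
    then have "successively (\<lambda>x y. {x, y} \<in> E) (?q @ [hd ?q])" by simp
    from odd_cycle_near_perfect[OF this q(1) odd, of v] v q(2) show ?thesis by auto
  qed
  have B': "finite B" "b \<in> B" using B by auto
  note main = contract_blossom[OF E M M'(1,3,4,5) B' near pair pair']
  show "(\<exists>N\<subseteq>E. matching N \<and> card M < card N) \<longleftrightarrow>
         (\<exists>N\<subseteq>contract B b E. matching N \<and> card (contract B b M) < card N)" by (rule main(1)) 
  show "matching (contract B b M)" "contract B b M \<subseteq> contract B b E" by (rule main(2,3); assumption)+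
  \<comment> \<open>Otherwise both heads would be \<open>b\<close> and the joining edge a
    loop.\<close>
  have "a1 \<noteq> [] \<or> a2 \<noteq> []" using hd split(1,2) by auto
  then have "\<exists>v. v \<in> B - {b}" using B dist split(1,2) by (cases a1; cases a2) auto
  then obtain v w where "v \<in> B - {b}" "w \<in> B - {b}" "{v, w} \<in> M" using pair by blast
  then show "\<exists>e\<in>M. e \<subseteq> B" by (intro bexI[of _ "{v, w}"]) auto
qed

section \<open>Potential of the update steps\<close>

locale hereditary_collection =
  fixes V :: "'v set" and U :: "'v \<Rightarrow> 'e set"
  assumes hereditary: "hereditary_23_collection V U"
begin

abbreviation G :: "'v wgraph" where "G \<equiv> intersection_graph V U"

lemma finite_V: "finite V"
  using hereditary unfolding hereditary_23_collection_def by blast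

lemma card_U: "v \<in> V \<Longrightarrow> card (U v) = 2 \<or> card (U v) = 3"
  using hereditary unfolding hereditary_23_collection_def by blast

lemma finite_U: "v \<in> V \<Longrightarrow> finite (U v)"
  using card_U by (metis card.infinite zero_neq_numeral)

lemma U_nonempty: "v \<in> V \<Longrightarrow> U v \<noteq> {}"
  using card_U by fastforce

text \<open>The subset condition on triples enters the argument only in this form; a pair is its own
  subpair.\<close>

lemma subpair:
  assumes "v \<in> V" "x \<in> U v" "y \<in> U v" "x \<noteq> y"
  shows "\<exists>w\<in>V. U w = {x, y}"
  using card_U[OF assms(1)]
proof
  assume "card (U v) = 2"
  then have "U v = {x, y}" using assms by (auto simp: card_2_iff)
  then show ?thesis using assms by blast
next
  assume c: "card (U v) = 3"
  then have "\<exists>z. U v = {z, x, y}" using assms by (auto simp: card_3_iff)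
  then show ?thesis
    using c assms(1) hereditary unfolding hereditary_23_collection_def by metis
qed

lemma G_simps [simp]: "verts G = V" "weight G v = card (U v) - 1"
  by (simp_all add: intersection_graph_def)

lemma adjacent_iff: "adjacent G x y \<longleftrightarrow> x \<in> V \<and> y \<in> V \<and> x \<noteq> y \<and> U x \<inter> U y \<noteq> {}"
  using finite_U by (auto simp: adjacent_def intersection_graph_def card_gt_0_iff)

definition disjoint_family where
  "disjoint_family S \<longleftrightarrow> (\<forall>x\<in>S. \<forall>y\<in>S. U x \<inter> U y \<noteq> {} \<longrightarrow> x = y)"

lemma independent_iff: "independent_set G S \<longleftrightarrow> S \<subseteq> V \<and> disjoint_family S"
  by (auto simp: independent_set_def adjacent_iff disjoint_family_def)

lemma disjoint_familyD:
  "disjoint_family S \<Longrightarrow> u \<in> S \<Longrightarrow> v \<in> S \<Longrightarrow> x \<in> U u \<Longrightarrow> x \<in> U v \<Longrightarrow> u = v"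
  unfolding disjoint_family_def by blast

definition Phi :: "'v set \<Rightarrow> nat" where "Phi S = (\<Sum>v\<in>S. (card (U v))\<^sup>2)"

lemma sq_weight_plus_eq: "S \<subseteq> V \<Longrightarrow> sq_weight_plus G S = Phi S"
proof -
  assume S: "S \<subseteq> V"
  have "card (U v) - 1 + 1 = card (U v)" if "v \<in> S" for v
    using card_U[OF subsetD[OF S that]] by auto
  then show ?thesis unfolding sq_weight_plus_def Phi_def by (intro sum.cong) auto
qed

lemma Phi_le: "S \<subseteq> V \<Longrightarrow> Phi S \<le> 9 * card V"
proof -
  assume S: "S \<subseteq> V"
  have "Phi S \<le> (\<Sum>v\<in>S. 9)"
    unfolding Phi_def
  proof (rule sum_mono)
    fix v assume "v \<in> S"
    then have "card (U v) = 2 \<or> card (U v) = 3" using card_U S by blast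
    then show "(card (U v))\<^sup>2 \<le> 9" by auto
  qed
  also have "\<dots> \<le> 9 * card V" using card_mono[OF finite_V S] by simp
  finally show ?thesis .
qed

text \<open>Both update steps replace \<open>A\<close> by a set of this form.\<close>

definition push :: "'v set \<Rightarrow> 'v set \<Rightarrow> 'v set" where
  "push T A = T \<union> {a \<in> A. \<forall>t\<in>T. U a \<inter> U t = {}}"

definition hit :: "'v set \<Rightarrow> 'v set \<Rightarrow> 'v set" where
  "hit T A = {a \<in> A. \<exists>t\<in>T. U a \<inter> U t \<noteq> {}}"

lemma push_subset: "T \<subseteq> V \<Longrightarrow> A \<subseteq> V \<Longrightarrow> push T A \<subseteq> V"
  unfolding push_def by blast

lemma disjoint_family_push:
  "disjoint_family T \<Longrightarrow> disjoint_family A \<Longrightarrow> disjoint_family (push T A)"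
  unfolding disjoint_family_def push_def by blast

text \<open>The balance of an exchange, stated additively because subtraction of natural numbers
  truncates. A member of \<open>T\<close> that already lies in \<open>A\<close> counts on both
  sides.\<close>

lemma Phi_push:
  assumes "T \<subseteq> V" "A \<subseteq> V" shows "Phi (push T A) + Phi (hit T A) = Phi T + Phi A"
proof -
  let ?D = "{a \<in> A. \<forall>t\<in>T. U a \<inter> U t = {}}"
  have fin: "finite T" "finite A" using assms finite_V finite_subset by blast+
  have "T \<inter> ?D = {}" using assms U_nonempty by blast
  then have "Phi (push T A) = Phi T + Phi ?D"
    unfolding push_def Phi_def using fin by (intro sum.union_disjoint) auto
  moreover have "Phi A = Phi (hit T A \<union> ?D)"
    unfolding hit_def by (rule arg_cong[of _ _ Phi]) blast
  moreover have "\<dots> = Phi (hit T A) + Phi ?D"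
    unfolding hit_def Phi_def using fin by (intro sum.union_disjoint) auto
  ultimately show ?thesis by simp
qed

text \<open>A talon that already belongs to \<open>A\<close> meets itself, so the filter in
  \<open>push\<close> drops it, and it returns through the union with \<open>T\<close>. For all
  other members of \<open>A\<close>, meeting a talon and being adjacent to one are the same.\<close>

lemma swap_claw_eq:
  assumes "T \<subseteq> V" "disjoint_family T" "A \<subseteq> V" shows "swap_claw G A T = push T A"
proof -
  have n: "v \<in> nbhd G T \<longleftrightarrow> v \<in> V \<and> (\<exists>u\<in>T. u \<noteq> v \<and> U u \<inter> U v \<noteq> {})" for v
    using assms(1) by (auto simp: nbhd_def adjacent_iff)
  have "v \<in> swap_claw G A T \<longleftrightarrow> v \<in> push T A" for v
  proof (cases "v \<in> T")
    case True
    then have "v \<notin> nbhd G T" using assms(2) unfolding n disjoint_family_def by blast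
    then show ?thesis using True by (simp add: swap_claw_def push_def)
  next
    case False
    then have "v \<in> A \<Longrightarrow> v \<in> nbhd G T \<longleftrightarrow> \<not> (\<forall>t\<in>T. U v \<inter> U t = {})"
      using assms(3) unfolding n by (metis Int_commute subsetD)
    then show ?thesis using False by (auto simp: swap_claw_def push_def)
  qed
  then show ?thesis by blast
qed

lemma claw_independent: "claw G T \<Longrightarrow> T \<subseteq> V \<and> disjoint_family T"
  unfolding claw_def d_claw_def by (auto simp: independent_iff)

lemma claw_singleton: "t \<in> V \<Longrightarrow> claw G {t}"
  unfolding claw_def d_claw_def independent_iff by (intro exI[of _ 1]) (simp add: disjoint_family_def)

lemma claw_center:
  assumes "T \<subseteq> V" "disjoint_family T" "T \<noteq> {}" "c \<in> V" "\<And>t. t \<in> T \<Longrightarrow> t \<noteq> c \<and> U t \<inter> U c \<noteq> {}"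
  shows "claw G T"
proof -
  have "finite T" using assms(1) finite_V finite_subset by blast
  then have "card T \<ge> 1" using assms(3) by (simp add: card_gt_0_iff Suc_leI)
  moreover have "\<forall>t\<in>T. adjacent G c t" using assms by (auto simp: adjacent_iff)
  ultimately show ?thesis
    unfolding claw_def d_claw_def independent_iff
    using assms(1,2,4) \<open>finite T\<close> by (intro exI[of _ "card T"]) auto
qed

lemma improving_claw_iff:
  assumes "A \<subseteq> V"
  shows "improving_claw G A T \<longleftrightarrow> claw G T \<and> Phi A < Phi (push T A)"
proof (cases "claw G T")
  case True
  then have T: "T \<subseteq> V" "disjoint_family T" using claw_independent by blast+
  show ?thesis
    unfolding improving_claw_def swap_claw_eq[OF T assms] sq_weight_plus_eq[OF assms]
      sq_weight_plus_eq[OF push_subset[OF T(1) assms]] ..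
qed (simp add: improving_claw_def)

lemma claw_step_iff:
  assumes "A \<subseteq> V"
  shows "claw_step V U A A' \<longleftrightarrow> (\<exists>T. claw G T \<and> Phi A < Phi (push T A) \<and> A' = push T A)"
proof -
  have "swap_claw G A T = push T A" if "claw G T" for T
    using claw_independent[OF that] swap_claw_eq assms by blast
  then show ?thesis unfolding claw_step_def improving_claw_iff[OF assms] by auto
qed

text \<open>Local optimality as the charging argument uses it: each forbidden configuration is
  refuted by a claw worth more than what it hits.\<close>

lemma no_claw_step:
  assumes "A \<subseteq> V" "\<nexists>B. claw_step V U A B" "claw G T"
  shows "Phi T \<le> Phi (hit T A)"
proof -
  have "\<not> Phi A < Phi (push T A)" using assms(2,3) claw_step_iff[OF assms(1)] by blast
  then show ?thesis using Phi_push[of T A] claw_independent[OF assms(3)] assms(1) by linarith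
qed

section \<open>The graph \<open>H\<close> and augmentations\<close>

lemma covered_by_triples_eq:
  assumes "A \<subseteq> V"
  shows "covered_by_triples V U A = \<Union>(U ` {v \<in> A. card (U v) = 3})"
proof -
  have "card (U v) - 1 = 2 \<longleftrightarrow> card (U v) = 3" if "v \<in> A" for v
    using card_U[of v] assms that by auto
  then show ?thesis unfolding covered_by_triples_def G_simps by blast
qed

lemma H_edges_eq: 
  assumes "A \<subseteq> V"
  shows "H_edges V U A = U ` {v \<in> V. card (U v) = 2 \<and> U v \<inter> covered_by_triples V U A = {}}"
proof -
  have H: "H_verts V U A = \<Union>(U ` {v \<in> V. card (U v) = 2 \<and> U v \<inter> covered_by_triples V U A = {}})"
  proof -
    have "card (U v) - 1 = 1 \<longleftrightarrow> card (U v) = 2" if "v \<in> V" for v using card_U[OF that] by auto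
    then show ?thesis unfolding H_verts_def by (auto simp: G_simps)
  qed
  show ?thesis
  proof (intro set_eqI iffI)
    fix e assume "e \<in> H_edges V U A"
    then obtain x y v where e: "e = {x, y}" "x \<noteq> y" "e \<subseteq> H_verts V U A" "v \<in> V" "U v = e"
      unfolding H_edges_def by auto
    moreover have "H_verts V U A \<inter> covered_by_triples V U A = {}" unfolding H by blast
    ultimately show "e \<in> U ` {v \<in> V. card (U v) = 2 \<and> U v \<inter> covered_by_triples V U A = {}}"
      by (intro image_eqI[of _ _ v]) auto
  next
    fix e assume "e \<in> U ` {v \<in> V. card (U v) = 2 \<and> U v \<inter> covered_by_triples V U A = {}}"
    then obtain v where v: "e = U v" "v \<in> V" "card (U v) = 2" "U v \<inter> covered_by_triples V U A = {}"
      by blast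
    then have "e \<subseteq> H_verts V U A" unfolding H by blast
    moreover obtain x y where "U v = {x, y}" "x \<noteq> y" using v(3) by (meson card_2_iff)
    ultimately show "e \<in> H_edges V U A" unfolding H_edges_def using v by blast
  qed
qed

lemma triple_pair_disjoint:
  assumes "A \<subseteq> V" "disjoint_family A" "v \<in> A" "card (U v) = 2"
  shows "U v \<inter> covered_by_triples V U A = {}"
proof (rule ccontr)
  assume "U v \<inter> covered_by_triples V U A \<noteq> {}"
  then obtain x u where "x \<in> U v" "x \<in> U u" "u \<in> A" "card (U u) = 3"
    unfolding covered_by_triples_eq[OF assms(1)] by blast
  then have "u = v" using assms(2,3) by (auto intro: disjoint_familyD)
  then show False using assms(4) \<open>card (U u) = 3\<close> by simp
qed

lemma H_matching_eq:
  assumes "A \<subseteq> V" "disjoint_family A"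
  shows "H_matching V U A = U ` {v \<in> A. card (U v) = 2}"
proof -
  have "e \<in> H_matching V U A \<longleftrightarrow> e \<in> U ` {v \<in> A. card (U v) = 2}" for e
    using assms(1) triple_pair_disjoint[OF assms] unfolding H_matching_def H_edges_eq[OF assms(1)] by auto
  then show ?thesis by blast
qed

lemma matching_H_matching:
  assumes "A \<subseteq> V" "disjoint_family A"
  shows "matching (H_matching V U A)" "H_matching V U A \<subseteq> H_edges V U A"
    "finite (H_edges V U A)" "finite (H_matching V U A)"
proof -
  show "matching (H_matching V U A)"
    unfolding H_matching_eq[OF assms] matching_def using assms(2) unfolding disjoint_family_def by auto
  show "H_matching V U A \<subseteq> H_edges V U A" unfolding H_matching_def by blast
  show "finite (H_edges V U A)" unfolding H_edges_eq[OF assms(1)] using finite_V by simp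
  then show "finite (H_matching V U A)" unfolding H_matching_def by simp
qed

lemma H_edge_disjoint_triple:
  assumes "A \<subseteq> V" "e \<in> H_edges V U A" "v \<in> A" "card (U v) = 3"
  shows "U v \<inter> e = {}"
  using assms(2-4) unfolding H_edges_eq[OF assms(1)] covered_by_triples_eq[OF assms(1)] by auto

text \<open>The new pairs hit exactly the matched edges of the path: a triple of \<open>A\<close> is
  disjoint from every edge of \<open>H\<close>, and a matched edge that meets the path belongs to
  it. Each pair is worth 4 and one more is added than removed.\<close>

lemma augmentation_eq:
  assumes A: "A \<subseteq> V" "disjoint_family A"
    and p: "augmenting_path (H_edges V U A) (H_matching V U A) p"
    and K: "K \<subseteq> V" "inj_on U K" "U ` K = path_edges p - H_matching V U A"
  shows "(A - {v \<in> A. U v \<in> path_edges p \<inter> H_matching V U A}) \<union> K = push K A"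
    and "disjoint_family K" and "Phi A < Phi (push K A)"
proof -
  let ?M = "H_matching V U A"
  let ?h = "{v \<in> A. U v \<in> path_edges p \<inter> ?M}"
  note M = matching_H_matching[OF A]
  note flip = augmenting_path_flip[OF M(1,4) p]
  have verts: "\<Union>(U ` K) = set p"
    using augmenting_path_covered[OF p] path_edges_subset_set[of _ p] unfolding K(3) by blast
  have h: "hit K A = ?h"
  proof (intro set_eqI iffI)
    fix v assume "v \<in> hit K A"
    then have v: "v \<in> A" "U v \<inter> set p \<noteq> {}" unfolding hit_def verts[symmetric] by auto
    then obtain e where e: "e \<in> path_edges p" "U v \<inter> e \<noteq> {}"
      using augmenting_path_covered[OF p] by blast
    have "e \<in> H_edges V U A" using augmenting_path_edges[OF p] e(1) by blast
    then have "card (U v) = 2"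
      using H_edge_disjoint_triple[OF A(1) _ v(1)] e(2) card_U[of v] v(1) A(1) by blast
    then have "U v \<in> ?M" unfolding H_matching_eq[OF A] using v(1) by blast
    then show "v \<in> ?h" using flip(2) v by blast
  next
    fix v assume "v \<in> ?h"
    then have v: "v \<in> A" "U v \<in> path_edges p" by auto
    then have "U v \<subseteq> \<Union>(U ` K)" using path_edges_subset_set[of _ p] unfolding verts by blast
    moreover have "U v \<noteq> {}" using v(1) A(1) U_nonempty by blast
    ultimately show "v \<in> hit K A" using v(1) unfolding hit_def by blast
  qed
  show "(A - ?h) \<union> K = push K A" unfolding h[symmetric] hit_def push_def by blast
  show "disjoint_family K"
    unfolding disjoint_family_def
  proof (intro ballI impI)
    fix x y assume xy: "x \<in> K" "y \<in> K" "U x \<inter> U y \<noteq> {}"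
    then have "U x \<in> path_edges p - ?M" "U y \<in> path_edges p - ?M" using K(3) by blast+
    then have "U x = U y" using flip(1) xy(3) unfolding matching_def by blast
    then show "x = y" using K(2) xy(1,2) by (simp add: inj_on_eq_iff)
  qed
  have c2: "card (U v) = 2" if "v \<in> K" for v
    using flip(1) K(3) that unfolding matching_def by blast
  have "Phi K = (\<Sum>v\<in>K. 4)" unfolding Phi_def by (rule sum.cong) (simp_all add: c2)
  then have "Phi K = 4 * card (path_edges p - ?M)" using card_image[OF K(2)] K(3) by simp
  moreover have "Phi ?h = 4 * card (path_edges p \<inter> ?M)"
  proof -
    have "card (U v) = 2" if "v \<in> ?h" for v using that M(1) unfolding matching_def by blast
    then have "Phi ?h = (\<Sum>v\<in>?h. 4)" unfolding Phi_def by (intro sum.cong) auto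
    also have "\<dots> = 4 * card (U ` ?h)"
    proof -
      have "inj_on U ?h"
      proof (rule inj_onI)
        fix x y assume xy: "x \<in> ?h" "y \<in> ?h" "U x = U y"
        then have "U x \<inter> U y \<noteq> {}" using U_nonempty A(1) by blast
        then show "x = y" using A(2) xy unfolding disjoint_family_def by blast
      qed
      then show ?thesis by (simp add: card_image)
    qed
    also have "U ` ?h = path_edges p \<inter> ?M"
    proof
      show "path_edges p \<inter> ?M \<subseteq> U ` ?h"
      proof
        fix e assume e: "e \<in> path_edges p \<inter> ?M"
        then obtain v where "v \<in> A" "e = U v" unfolding H_matching_eq[OF A] by blast
        then show "e \<in> U ` ?h" using e by blast
      qed
    qed blast
    finally show ?thesis .
  qed
  ultimately show "Phi A < Phi (push K A)"
    using Phi_push[OF K(1) A(1)] flip(4) unfolding h by simp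
qed

lemma augment_stepD:
  assumes A: "A \<subseteq> V" "disjoint_family A" and step: "augment_step V U A A'"
  shows "A' \<subseteq> V \<and> disjoint_family A' \<and> Phi A < Phi A'"
proof -
  let ?M = "H_matching V U A"
  obtain p f where p: "augmenting_path (H_edges V U A) ?M p"
    and f: "\<forall>e \<in> path_edges p - ?M. f e \<in> V \<and> U (f e) = e"
    and A': "A' = (A - {v \<in> A. U v \<in> path_edges p \<inter> ?M}) \<union> f ` (path_edges p - ?M)"
    using step unfolding augment_step_def Let_def by blast
  have K: "f ` (path_edges p - ?M) \<subseteq> V" "inj_on U (f ` (path_edges p - ?M))"
    "U ` f ` (path_edges p - ?M) = path_edges p - ?M"
    using f by (auto simp: inj_on_def image_iff)
  note aug = augmentation_eq[OF A p K]
  show ?thesis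
    unfolding A' aug(1) using push_subset[OF K(1) A(1)] disjoint_family_push[OF aug(2) A(2)] aug(3) by blast
qed

text \<open>The program produces a set of vertices rather than a choice function; the inverse of
  \<open>U\<close> on \<open>K\<close> serves as the latter.\<close>

lemma augment_stepI:
  assumes A: "A \<subseteq> V" "disjoint_family A"
    and p: "augmenting_path (H_edges V U A) (H_matching V U A) p"
    and K: "K \<subseteq> V" "inj_on U K" "U ` K = path_edges p - H_matching V U A"
  shows "augment_step V U A (push K A)"
proof -
  let ?M = "H_matching V U A"
  let ?f = "the_inv_into K U"
  have f: "?f (U v) = v" if "v \<in> K" for v using the_inv_into_f_f[OF K(2) that] .
  have 1: "\<forall>e \<in> path_edges p - ?M. ?f e \<in> V \<and> U (?f e) = e"
    using f K(1) unfolding K(3)[symmetric] by auto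
  have "?f ` (path_edges p - ?M) = K"
    using f unfolding K(3)[symmetric] image_image by simp
  then have 2: "push K A = (A - {v \<in> A. U v \<in> path_edges p \<inter> ?M}) \<union> ?f ` (path_edges p - ?M)"
    using augmentation_eq(1)[OF A p K] by simp
  show ?thesis unfolding augment_step_def Let_def using p 1 2 by blast
qed

lemma augment_step_exists:
  assumes A: "A \<subseteq> V" "disjoint_family A"
    and p: "augmenting_path (H_edges V U A) (H_matching V U A) p"
  shows "\<exists>B. augment_step V U A B"
proof -
  have "\<forall>e \<in> path_edges p - H_matching V U A. \<exists>v. v \<in> V \<and> U v = e"
    using augmenting_path_edges[OF p] unfolding H_edges_eq[OF A(1)] by blast
  then obtain f where "\<forall>e \<in> path_edges p - H_matching V U A. f e \<in> V \<and> U (f e) = e" by metis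
  then show ?thesis unfolding augment_step_def Let_def using p by blast
qed

section \<open>Length of runs and optimality of returned sets\<close>

lemma alg_stepD:
  assumes "A \<subseteq> V" "disjoint_family A" "alg_step V U A A'"
  shows "A' \<subseteq> V \<and> disjoint_family A' \<and> Phi A < Phi A'"
proof (cases "claw_step V U A A'")
  case True
  then obtain T where T: "claw G T" "Phi A < Phi (push T A)" "A' = push T A"
    using claw_step_iff[OF assms(1)] by blast
  then show ?thesis
    using claw_independent[OF T(1)] assms push_subset disjoint_family_push by blast
next
  case False
  then show ?thesis using assms augment_stepD unfolding alg_step_def by blast
qed

lemma partial_run_invariant:
  assumes "partial_run V U As" "i < length As"
  shows "As ! i \<subseteq> V \<and> disjoint_family (As ! i) \<and> i \<le> Phi (As ! i)"
  using assms(2)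
proof (induction i)
  case 0
  have "As ! 0 = {}" using assms(1) unfolding partial_run_def by (metis hd_conv_nth)
  then show ?case by (simp add: disjoint_family_def)
next
  case (Suc i)
  then have "alg_step V U (As ! i) (As ! Suc i)" using assms(1) unfolding partial_run_def by blast
  then show ?case using Suc alg_stepD[of "As ! i" "As ! Suc i"] by fastforce
qed

text \<open>The extra one counts the empty set with which the run starts.\<close>

lemma partial_run_length:
  assumes "partial_run V U As" shows "length As \<le> 9 * card V + 1"
proof -
  have ne: "As \<noteq> []" using assms unfolding partial_run_def by blast
  then have "length As - 1 < length As" by simp
  from partial_run_invariant[OF assms this] show ?thesis
    using Phi_le[of "As ! (length As - 1)"] by linarith
qed

lemma returns_optimal:
  assumes "returns V U A"
  shows "A \<subseteq> V" "disjoint_family A" "\<nexists>B. claw_step V U A B"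
    "\<nexists>p. augmenting_path (H_edges V U A) (H_matching V U A) p"
proof -
  obtain As where As: "partial_run V U As" "\<nexists>B. alg_step V U A B" "last As = A"
    using assms unfolding returns_def complete_run_def by blast
  have "As \<noteq> []" using As(1) unfolding partial_run_def by blast
  then have "A = As ! (length As - 1)" "length As - 1 < length As" using As(3) by (auto simp: last_conv_nth)
  then show A: "A \<subseteq> V" "disjoint_family A" using partial_run_invariant[OF As(1)] by auto
  show claw: "\<nexists>B. claw_step V U A B" using As(2) unfolding alg_step_def by blast
  then have "\<nexists>B. augment_step V U A B" using As(2) unfolding alg_step_def by blast
  then show "\<nexists>p. augmenting_path (H_edges V U A) (H_matching V U A) p"
    using augment_step_exists[OF A] by blast
qed

end

section \<open>The charging argument\<close>

locale local_optimum = hereditary_collection V U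
  for V :: "'v set" and U :: "'v \<Rightarrow> 'e set" +
  fixes A S :: "'v set"
  assumes A: "A \<subseteq> V" "disjoint_family A"
    and no_claw: "\<nexists>B. claw_step V U A B"
    and no_aug: "\<nexists>p. augmenting_path (H_edges V U A) (H_matching V U A) p"
    and S: "S \<subseteq> V" "disjoint_family S"
begin

abbreviation M where "M \<equiv> H_matching V U A"
abbreviation X where "X \<equiv> covered_by_triples V U A"

definition Q where "Q = \<Union>M"

text \<open>The other element of the pair of \<open>A\<close> that contains \<open>x\<close>;
  meaningful only for \<open>x\<close> in \<open>Q\<close>.\<close>

definition mate where "mate x = (THE y. {x, y} \<in> M)"

text \<open>The elements of a member are counted by their cover: \<open>t\<close> by triples of
  \<open>A\<close>, \<open>p\<close> by pairs of \<open>A\<close>, \<open>z\<close> by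
  nothing.\<close>

definition t where "t u = card (U u \<inter> X)"
definition p where "p u = card (U u \<inter> Q)"
definition z where "z u = card (U u - X - Q)"

lemma fin: "finite A" "finite S"
  using A(1) S(1) finite_V finite_subset by blast+

lemma X_eq: "X = \<Union>(U ` {v \<in> A. card (U v) = 3})"
  by (rule covered_by_triples_eq[OF A(1)])

lemma M_eq: "M = U ` {v \<in> A. card (U v) = 2}"
  by (rule H_matching_eq[OF A])

lemma matching_M: "matching M"
  by (rule matching_H_matching(1)[OF A])

lemma Q_eq: "Q = \<Union>(U ` {v \<in> A. card (U v) = 2})"
  unfolding Q_def M_eq ..

lemma cov: "X \<union> Q = \<Union>(U ` A)"
proof -
  have "{v \<in> A. card (U v) = 3} \<union> {v \<in> A. card (U v) = 2} = A" using A(1) card_U by blast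
  then show ?thesis unfolding X_eq Q_eq by blast
qed

lemma XQ: "X \<inter> Q = {}"
  unfolding Q_eq using triple_pair_disjoint[OF A] by blast

lemma mate:
  assumes "x \<in> Q"
  shows "{x, mate x} \<in> M" "mate x \<in> Q" "mate x \<noteq> x" "mate (mate x) = x"
proof -
  have mateI: "mate a = b" if "{a, b} \<in> M" for a b
    unfolding mate_def using that matching_mate[OF matching_M] by (intro the_equality) auto
  obtain e where "e \<in> M" "x \<in> e" using assms unfolding Q_def by blast
  then obtain y where y: "y \<noteq> x" "{x, y} \<in> M" using matching_edge[OF matching_M] by metis
  then have m: "mate x = y" "mate y = x" using mateI[of x y] mateI[of y x] by (auto simp: insert_commute)
  then show "{x, mate x} \<in> M" "mate x \<noteq> x" "mate (mate x) = x" using y by auto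
  show "mate x \<in> Q" unfolding Q_def using y m by blast
qed

lemma tpz: "u \<in> V \<Longrightarrow> t u + p u + z u = card (U u)"
proof -
  assume u: "u \<in> V"
  have "U u = (U u \<inter> X) \<union> (U u \<inter> Q) \<union> (U u - X - Q)" by blast
  then have "card (U u) = card ((U u \<inter> X) \<union> (U u \<inter> Q) \<union> (U u - X - Q))" by (rule arg_cong)
  also have "\<dots> = card ((U u \<inter> X) \<union> (U u \<inter> Q)) + card (U u - X - Q)"
    by (rule card_Un_disjoint) (use finite_U[OF u] in auto)
  also have "card ((U u \<inter> X) \<union> (U u \<inter> Q)) = card (U u \<inter> X) + card (U u \<inter> Q)"
    by (rule card_Un_disjoint) (use finite_U[OF u] XQ in auto)
  finally show ?thesis unfolding t_def p_def z_def by simp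
qed

section \<open>Configurations excluded by improving claws\<close>

text \<open>Two uncovered elements would by heredity form a pair that hits nothing, which improves
  as a claw with a single talon.\<close>

lemma z_le_1: assumes "u \<in> V" shows "z u \<le> 1"
proof (rule ccontr)
  assume "\<not> z u \<le> 1"
  then have "card (U u - X - Q) \<ge> 2" unfolding z_def by simp
  then obtain T where T: "T \<subseteq> U u - X - Q" "card T = 2"
    by (meson obtain_subset_with_card_n)
  then obtain x y where xy: "x \<noteq> y" "{x, y} \<subseteq> U u - X - Q" by (auto simp: card_2_iff)
  then obtain w where w: "w \<in> V" "U w = {x, y}" using subpair[OF assms, of x y] by auto
  have "U a \<inter> {x, y} = {}" if "a \<in> A" for a using xy(2) cov that by blast
  then have "hit {w} A = {}" unfolding hit_def w(2)[symmetric] by auto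
  then have "Phi {w} \<le> 0"
    using no_claw_step[OF A(1) no_claw claw_singleton[OF w(1)]] by (simp add: Phi_def)
  then show False using xy(1) w(2) by (simp add: Phi_def)
qed

lemma zE: assumes "z u > 0" obtains x where "x \<in> U u" "x \<notin> \<Union>(U ` A)"
proof -
  have "U u - X - Q \<noteq> {}" using assms unfolding z_def by (metis card.empty less_irrefl)
  then show ?thesis using that cov by blast
qed

text \<open>The claw \<open>{u}\<close> is worth 9 and hits only pairs, worth 4 each, so it hits at
  least three of them. Having three elements, \<open>u\<close> meets each of these pairs exactly
  once.\<close>

lemma triple_without_X:
  assumes u: "u \<in> V" "card (U u) = 3" "t u = 0"
  shows "p u = 3" and "x \<in> U u \<Longrightarrow> x \<in> Q \<Longrightarrow> mate x \<notin> U u"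
proof -
  let ?h = "hit {u} A"
  have X: "U u \<inter> X = {}" using u finite_U[OF u(1)] unfolding t_def by simp
  have h2: "card (U a) = 2" if "a \<in> ?h" for a
    using that X card_U[of a] A(1) unfolding hit_def X_eq by blast
  have finh: "finite ?h" using fin(1) unfolding hit_def by simp
  have "Phi {u} \<le> Phi ?h"
    by (rule no_claw_step[OF A(1) no_claw claw_singleton[OF u(1)]])
  moreover have "Phi ?h = (\<Sum>v\<in>?h. 4)" unfolding Phi_def by (rule sum.cong) (simp_all add: h2)
  ultimately have h3: "card ?h \<ge> 3" using u(2) by (simp add: Phi_def)
  have "card (U u \<inter> Q) = card (\<Union>a\<in>?h. U a \<inter> U u)"
  proof (rule arg_cong[of _ _ card])
    have "U u \<inter> Q = U u \<inter> \<Union>(U ` A)" using X cov by blast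
    then show "U u \<inter> Q = (\<Union>a\<in>?h. U a \<inter> U u)" unfolding hit_def by blast
  qed
  also have "\<dots> = (\<Sum>a\<in>?h. card (U a \<inter> U u))"
  proof (rule card_UN_disjoint[OF finh])
    show "\<forall>a\<in>?h. finite (U a \<inter> U u)" using finite_U[OF u(1)] by blast
    have "a = b" if "a \<in> A" "b \<in> A" "y \<in> U a" "y \<in> U b" for a b y
      by (rule disjoint_familyD[OF A(2) that])
    then show "\<forall>a\<in>?h. \<forall>b\<in>?h. a \<noteq> b \<longrightarrow> (U a \<inter> U u) \<inter> (U b \<inter> U u) = {}"
      unfolding hit_def by blast
  qed
  finally have sum: "p u = (\<Sum>a\<in>?h. card (U a \<inter> U u))" unfolding p_def .
  have one: "card (U a \<inter> U u) \<ge> 1" if "a \<in> ?h" for a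
    using that finite_U[OF u(1)] unfolding hit_def by (auto simp: Suc_le_eq card_gt_0_iff)
  have "(\<Sum>a\<in>?h. 1) \<le> p u" unfolding sum by (rule sum_mono) (rule one)
  then have "card ?h \<le> p u" by simp
  moreover have "p u \<le> 3" using tpz[OF u(1)] u(2) by simp
  ultimately show p3: "p u = 3" using h3 by simp
  assume x: "x \<in> U u" "x \<in> Q"
  show "mate x \<notin> U u"
  proof
    assume m: "mate x \<in> U u"
    obtain a where a: "a \<in> A" "U a = {x, mate x}" using mate(1)[OF x(2)] unfolding M_eq by auto
    then have ah: "a \<in> ?h" using x unfolding hit_def by auto
    have "card (U a \<inter> U u) = 2" using a(2) x(1) m mate(3)[OF x(2)] by simp
    moreover have "p u = card (U a \<inter> U u) + (\<Sum>a\<in>?h - {a}. card (U a \<inter> U u))"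
      unfolding sum by (rule sum.remove[OF finh ah])
    moreover have "(\<Sum>a\<in>?h - {a}. 1) \<le> (\<Sum>a\<in>?h - {a}. card (U a \<inter> U u))"
      by (rule sum_mono) (use one in blast)
    moreover have "card (?h - {a}) \<ge> 2" using h3 ah finh by simp
    ultimately show False using p3 by simp
  qed
qed

text \<open>Talons that meet \<open>A\<close> only inside \<open>v\<close> remove nothing but
  \<open>v\<close>. Their uncovered elements make them different from \<open>v\<close>, which can
  thus serve as the center.\<close>

lemma center_bound:
  assumes T: "T \<subseteq> V" "disjoint_family T" "T \<noteq> {}" and v: "v \<in> A"
    and hits: "\<And>u. u \<in> T \<Longrightarrow> U u \<inter> U v \<noteq> {} \<and> \<not> U u \<subseteq> \<Union>(U ` A) \<and> U u \<inter> \<Union>(U ` A) \<subseteq> U v"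
  shows "Phi T \<le> (card (U v))\<^sup>2"
proof -
  have "claw G T"
  proof (rule claw_center[OF T])
    show "v \<in> V" using v A(1) by blast
    fix u assume "u \<in> T"
    from hits[OF this] v show "u \<noteq> v \<and> U u \<inter> U v \<noteq> {}" by blast
  qed
  then have "Phi T \<le> Phi (hit T A)" by (rule no_claw_step[OF A(1) no_claw])
  also have "hit T A \<subseteq> {v}"
  proof
    fix a assume "a \<in> hit T A"
    then obtain u x where u: "a \<in> A" "u \<in> T" "x \<in> U a" "x \<in> U u" unfolding hit_def by blast
    then have "x \<in> U v" using hits[OF u(2)] by blast
    then have "a = v" using disjoint_familyD[OF A(2) u(1) v u(3)] by blast
    then show "a \<in> {v}" by simp
  qed
  then have "Phi (hit T A) \<le> Phi {v}" unfolding Phi_def by (intro sum_mono2) auto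
  finally show ?thesis by (simp add: Phi_def)
qed

text \<open>Shrinks a member of \<open>S\<close> to a pair with one uncovered element, so that as a
  talon it hits only the member of \<open>A\<close> at \<open>a\<close>.\<close>

lemma free_subpair:
  assumes "u \<in> S" "z u > 0" "a \<in> U u" "a \<in> U v" "v \<in> A"
  obtains w y where "w \<in> V" "U w = {a, y}" "y \<in> U u" "y \<notin> \<Union>(U ` A)" "a \<noteq> y"
proof -
  obtain y where y: "y \<in> U u" "y \<notin> \<Union>(U ` A)" using zE[OF assms(2)] .
  then have "a \<noteq> y" using assms(4,5) by blast
  moreover obtain w where "w \<in> V" "U w = {a, y}"
    using subpair[of u a y] assms(1,3) S(1) y(1) calculation by blast
  ultimately show ?thesis using that y by blast
qed

text \<open>Two elements of \<open>v\<close> and an uncovered one make up all of \<open>u\<close>,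
  worth 9. Together with a subpair of \<open>u'\<close>, worth 4, it forms a claw around
  \<open>v\<close> of value 13 against 9.\<close>

lemma triple_not_double_hit:
  assumes v: "v \<in> A" "card (U v) = 3" and u: "u \<in> S" "z u > 0" and u': "u' \<in> S" "z u' > 0"
    and abc: "a \<in> U v" "b \<in> U v" "c \<in> U v" "a \<noteq> b" "a \<noteq> c" "b \<noteq> c" "a \<in> U u" "b \<in> U u" "c \<in> U u'"
  shows False
proof -
  obtain y where y: "y \<in> U u" "y \<notin> \<Union>(U ` A)" using zE[OF u(2)] .
  have uV: "u \<in> V" using u S(1) by blast
  have "y \<notin> U v" using y(2) v(1) by blast
  then have ne: "y \<noteq> a" "y \<noteq> b" using abc by auto
  have sub: "{a, b, y} \<subseteq> U u" using abc y by simp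
  have c3: "card {a, b, y} = 3" using ne abc(4) by simp
  then have "card (U u) = 3" using card_mono[OF finite_U[OF uV] sub] card_U[OF uV] by linarith
  then have Uu: "U u = {a, b, y}" using card_subset_eq[OF finite_U[OF uV] sub] c3 by simp
  then have "u \<noteq> u'" using abc y v(1) by auto
  obtain w y' where w: "w \<in> V" "U w = {c, y'}" "y' \<in> U u'" "y' \<notin> \<Union>(U ` A)" "c \<noteq> y'"
    using free_subpair[OF u' abc(9,3) v(1)] .
  have disj: "U u \<inter> U u' = {}" using \<open>u \<noteq> u'\<close> S(2) u(1) u'(1) unfolding disjoint_family_def by blast
  have disj': "U u \<inter> U w = {}" using disj w abc by auto
  have "Phi {u, w} \<le> (card (U v))\<^sup>2"
  proof (rule center_bound)
    show "{u, w} \<subseteq> V" using uV w by simp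
    show "disjoint_family {u, w}" using disj' unfolding disjoint_family_def by auto
    fix s assume "s \<in> {u, w}"
    then consider "U s = {a, b, y}" | "U s = {c, y'}" using Uu w by auto
    then show "U s \<inter> U v \<noteq> {} \<and> \<not> U s \<subseteq> \<Union>(U ` A) \<and> U s \<inter> \<Union>(U ` A) \<subseteq> U v"
      by cases (use y w abc v(1) in auto)
  qed (use v in auto)
  moreover have "u \<noteq> w" using disj' Uu by auto
  then have "Phi {u, w} = (card (U u))\<^sup>2 + (card (U w))\<^sup>2" by (simp add: Phi_def)
  then have "Phi {u, w} = 13" using Uu c3 w(2,5) by (simp add: power2_eq_square)
  ultimately show False using v(2) by simp
qed

text \<open>By \<open>triple_not_double_hit\<close> the three members would be different. Each gives
  a subpair worth 4, and three of them make 12 against 9.\<close>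

lemma triple_not_all_hit:
  assumes v: "v \<in> A" "card (U v) = 3"
  shows "\<exists>x\<in>U v. \<not> (\<exists>u\<in>S. x \<in> U u \<and> z u > 0)"
proof (rule ccontr)
  assume "\<not> ?thesis"
  then have all: "\<exists>u\<in>S. x \<in> U u \<and> z u > 0" if "x \<in> U v" for x using that by blast
  obtain a b c where abc: "U v = {a, b, c}" "a \<noteq> b" "a \<noteq> c" "b \<noteq> c"
    using v(2) by (auto simp: card_3_iff)
  have "a \<in> U v" "b \<in> U v" "c \<in> U v" using abc by auto
  from all[OF this(1)] all[OF this(2)] all[OF this(3)] obtain ua ub uc where
    u: "ua \<in> S" "a \<in> U ua" "z ua > 0" "ub \<in> S" "b \<in> U ub" "z ub > 0"
    "uc \<in> S" "c \<in> U uc" "z uc > 0" by blast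
  have "ua \<noteq> ub"
    using triple_not_double_hit[OF v u(1,3) u(7,9), of a b c] u abc by blast
  moreover have "ua \<noteq> uc"
    using triple_not_double_hit[OF v u(1,3) u(4,6), of a c b] u abc by blast
  moreover have "ub \<noteq> uc"
    using triple_not_double_hit[OF v u(4,6) u(1,3), of b c a] u abc by blast
  ultimately have disj: "U ua \<inter> U ub = {}" "U ua \<inter> U uc = {}" "U ub \<inter> U uc = {}"
    using S(2) u unfolding disjoint_family_def by blast+
  have in_v: "a \<in> U v" "b \<in> U v" "c \<in> U v" using abc by auto
  obtain wa ya where wa: "wa \<in> V" "U wa = {a, ya}" "ya \<in> U ua" "ya \<notin> \<Union>(U ` A)" "a \<noteq> ya"
    using free_subpair[OF u(1,3,2) in_v(1) v(1)] .
  obtain wb yb where wb: "wb \<in> V" "U wb = {b, yb}" "yb \<in> U ub" "yb \<notin> \<Union>(U ` A)" "b \<noteq> yb"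
    using free_subpair[OF u(4,6,5) in_v(2) v(1)] .
  obtain wc yc where wc: "wc \<in> V" "U wc = {c, yc}" "yc \<in> U uc" "yc \<notin> \<Union>(U ` A)" "c \<noteq> yc"
    using free_subpair[OF u(7,9,8) in_v(3) v(1)] .
  have disj': "U wa \<inter> U wb = {}" "U wa \<inter> U wc = {}" "U wb \<inter> U wc = {}"
    using disj wa wb wc u by auto
  then have ne: "wa \<noteq> wb" "wa \<noteq> wc" "wb \<noteq> wc" using wa(2) wb(2) by auto
  have "Phi {wa, wb, wc} \<le> (card (U v))\<^sup>2"
  proof (rule center_bound)
    show "{wa, wb, wc} \<subseteq> V" using wa wb wc by simp
    show "disjoint_family {wa, wb, wc}" using disj' unfolding disjoint_family_def by auto
    fix s assume "s \<in> {wa, wb, wc}"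
    then obtain x y where "U s = {x, y}" "x \<in> U v" "y \<notin> \<Union>(U ` A)"
      using wa wb wc abc(1) by auto
    then show "U s \<inter> U v \<noteq> {} \<and> \<not> U s \<subseteq> \<Union>(U ` A) \<and> U s \<inter> \<Union>(U ` A) \<subseteq> U v"
      by auto
  qed (use v in auto)
  moreover have "Phi {wa, wb, wc} = 12"
    using ne wa(2,5) wb(2,5) wc(2,5) by (simp add: Phi_def power2_eq_square)
  ultimately show False using v(2) by simp
qed

section \<open>Charges and surpluses\<close>

text \<open>
  The charging scheme: in units of a tenth of the weight, an element of \<open>X\<close> pays 8, or 10
  if its member of \<open>S\<close> has an uncovered element, and an element of \<open>Q\<close> pays 7. An element of
  \<open>Q\<close> that lies in no member of \<open>S\<close> pays to the member of \<open>S\<close> that contains its mate.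
\<close>

definition c :: "'e \<Rightarrow> int" where
  "c x = (if \<exists>u\<in>S. x \<in> U u \<and> z u > 0 then 10 else 8)"

definition h where "h u = card {x \<in> U u \<inter> Q. mate x \<notin> \<Union>(U ` S)}"

text \<open>The surplus of \<open>u\<close>: what it receives minus ten times its weight. Integers
  are used because it can be negative.\<close>

definition g :: "'v \<Rightarrow> int" where
  "g u = (\<Sum>x\<in>U u \<inter> X. c x) + 7 * int (p u) + 7 * int (h u) - 10 * (int (card (U u)) - 1)"

text \<open>By \<open>triple_not_all_hit\<close> some element of each triple of \<open>A\<close> is
  charged 8, which leaves at most 10 + 10 + 8, that is 14 per unit of weight.\<close>

lemma sum_c_le: "(\<Sum>u\<in>S. \<Sum>x\<in>U u \<inter> X. c x) \<le> 28 * int (card {v \<in> A. card (U v) = 3})"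
proof -
  let ?A3 = "{v \<in> A. card (U v) = 3}"
  have finX: "finite X" unfolding X_eq using fin(1) finite_U A(1) by auto
  have "(\<Sum>u\<in>S. \<Sum>x\<in>U u \<inter> X. c x) = (\<Sum>x\<in>(\<Union>u\<in>S. U u \<inter> X). c x)"
  proof (rule sum.UNION_disjoint[symmetric])
    show "\<forall>i\<in>S. \<forall>j\<in>S. i \<noteq> j \<longrightarrow> (U i \<inter> X) \<inter> (U j \<inter> X) = {}"
      using S(2) unfolding disjoint_family_def by blast
  qed (use fin finX in auto)
  also have "\<dots> \<le> (\<Sum>x\<in>X. c x)"
    by (rule sum_mono2) (use finX in \<open>auto simp: c_def\<close>)
  also have "\<dots> = (\<Sum>v\<in>?A3. \<Sum>x\<in>U v. c x)"
    unfolding X_eq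
  proof (rule sum.UNION_disjoint)
    show "\<forall>i\<in>?A3. \<forall>j\<in>?A3. i \<noteq> j \<longrightarrow> U i \<inter> U j = {}"
      using A(2) unfolding disjoint_family_def by blast
    show "\<forall>i\<in>?A3. finite (U i)" using finite_U A(1) by blast
  qed (use fin in auto)
  also have "\<dots> \<le> (\<Sum>v\<in>?A3. 28)"
  proof (rule sum_mono)
    fix v assume "v \<in> ?A3"
    then have v: "v \<in> A" "card (U v) = 3" by auto
    obtain x where x: "x \<in> U v" "c x = 8" using triple_not_all_hit[OF v] unfolding c_def by metis
    have fv: "finite (U v)" using v A(1) finite_U by blast
    have "(\<Sum>x\<in>U v. c x) = c x + (\<Sum>x\<in>U v - {x}. c x)" by (rule sum.remove[OF fv x(1)])
    also have "(\<Sum>x\<in>U v - {x}. c x) \<le> (\<Sum>x\<in>U v - {x}. 10)" by (rule sum_mono) (simp add: c_def)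
    also have "\<dots> = 20" using v(2) x(1) fv by simp
    finally show "(\<Sum>x\<in>U v. c x) \<le> 28" using x(2) by simp
  qed
  finally show ?thesis by simp
qed

text \<open>No element of \<open>Q\<close> pays twice: it pays for the member that contains it or,
  if there is none, for the member that contains its mate.\<close>

lemma sum_ph_le: "(\<Sum>u\<in>S. p u + h u) \<le> 2 * card {v \<in> A. card (U v) = 2}"
proof -
  let ?N = "\<lambda>u. {x \<in> U u \<inter> Q. mate x \<notin> \<Union>(U ` S)}"
  \<comment> \<open>The elements of \<open>Q\<close> whose payment goes to \<open>u\<close>. Their
    number is \<open>p u + h u\<close> because \<open>mate\<close> is injective on
    \<open>Q\<close>.\<close>
  let ?W = "\<lambda>u. (U u \<inter> Q) \<union> mate ` ?N u"
  have finQ: "finite Q" unfolding Q_eq using fin(1) finite_U A(1) by auto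
  have inj: "inj_on mate Q" using mate(4) by (metis inj_onI)
  have "p u + h u = card (?W u)" if "u \<in> S" for u
  proof -
    have "card (mate ` ?N u) = h u"
      unfolding h_def by (rule card_image) (rule inj_on_subset[OF inj], blast)
    moreover have "card (?W u) = card (U u \<inter> Q) + card (mate ` ?N u)"
      by (rule card_Un_disjoint) (use finQ that in auto)
    ultimately show ?thesis unfolding p_def by simp
  qed
  then have "(\<Sum>u\<in>S. p u + h u) = (\<Sum>u\<in>S. card (?W u))" by simp
  also have "\<dots> = card (\<Union>u\<in>S. ?W u)"
  proof (rule card_UN_disjoint[symmetric])
    show "\<forall>i\<in>S. finite (?W i)" using finQ by simp
    show "\<forall>i\<in>S. \<forall>j\<in>S. i \<noteq> j \<longrightarrow> ?W i \<inter> ?W j = {}"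
    proof (intro ballI impI)
      fix i j assume ij: "i \<in> S" "j \<in> S" "i \<noteq> j"
      have d: "U i \<inter> U j = {}" using S(2) ij unfolding disjoint_family_def by blast
      have "mate ` ?N i \<inter> mate ` ?N j = {}"
      proof -
        have "x \<in> U j" if "x \<in> ?N i" "y \<in> ?N j" "mate x = mate y" for x y
          using that inj by (auto simp: inj_on_eq_iff)
        then show ?thesis using d by blast
      qed
      then show "?W i \<inter> ?W j = {}" using d ij by blast
    qed
  qed (rule fin)
  also have "\<dots> \<le> card Q" by (rule card_mono[OF finQ]) (use mate(2) in auto)
  also have "\<dots> \<le> (\<Sum>v\<in>{v \<in> A. card (U v) = 2}. card (U v))"
    unfolding Q_eq by (rule card_UN_le) (use fin in simp)
  also have "\<dots> = 2 * card {v \<in> A. card (U v) = 2}" by simp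
  finally show ?thesis .
qed

text \<open>A fully covered triple has at least \<open>3 * 7 - 20 = 1\<close> and a pair
  \<open>2 * 7 - 10 = 4\<close>; each element of \<open>X\<close> pays at least one more than 7.
  Next to an uncovered element those of \<open>X\<close> pay exactly 10, so only elements of
  \<open>Q\<close> fall short, by 3 each.\<close>

lemma g_ge:
  assumes "u \<in> S"
  shows "z u = 0 \<Longrightarrow> card (U u) = 3 \<Longrightarrow> g u \<ge> 1 + int (t u) + 7 * int (h u)"
    and "z u = 0 \<Longrightarrow> card (U u) = 2 \<Longrightarrow> g u \<ge> 4 + int (t u) + 7 * int (h u)"
    and "z u > 0 \<Longrightarrow> g u = 7 * int (h u) - 3 * int (p u) \<and> p u \<le> 1"
proof -
  have uV: "u \<in> V" using assms S(1) by blast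
  note tpz = tpz[OF uV]
  have "(\<Sum>x\<in>U u \<inter> X. 8) \<le> (\<Sum>x\<in>U u \<inter> X. c x)" by (rule sum_mono) (simp add: c_def)
  then have ge: "8 * int (t u) \<le> (\<Sum>x\<in>U u \<inter> X. c x)" unfolding t_def by simp
  show "g u \<ge> 1 + int (t u) + 7 * int (h u)" if "z u = 0" "card (U u) = 3"
    unfolding g_def using ge tpz that by simp
  show "g u \<ge> 4 + int (t u) + 7 * int (h u)" if "z u = 0" "card (U u) = 2"
    unfolding g_def using ge tpz that by simp
  show "g u = 7 * int (h u) - 3 * int (p u) \<and> p u \<le> 1" if zu: "z u > 0"
  proof
    have z1: "z u = 1" using zu z_le_1[OF uV] by simp
    have "(\<Sum>x\<in>U u \<inter> X. c x) = (\<Sum>x\<in>U u \<inter> X. 10)"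
      by (rule sum.cong) (use zu assms in \<open>auto simp: c_def\<close>)
    then have "(\<Sum>x\<in>U u \<inter> X. c x) = 10 * int (t u)" unfolding t_def by simp
    then show "g u = 7 * int (h u) - 3 * int (p u)" unfolding g_def using tpz z1 by simp
    \<comment> \<open>A triple with an uncovered element meets \<open>X\<close>, for otherwise all
      three of its elements would lie in \<open>Q\<close>.\<close>
    show "p u \<le> 1"
      using triple_without_X(1)[OF uV] card_U[OF uV] tpz z1 by (cases "t u = 0") auto
  qed
qed

section \<open>Members with a deficit and their components\<close>

text \<open>By \<open>g_ge\<close> no other member of \<open>S\<close> can have a negative
  surplus.\<close>

definition bad where "bad u \<longleftrightarrow> u \<in> S \<and> z u > 0 \<and> p u > 0"

lemma g_pos:
  assumes "u \<in> S" "z u = 0" shows "g u \<ge> 1 + int (t u) + 7 * int (h u)"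
proof -
  have "u \<in> V" using assms(1) S(1) by blast
  from card_U[OF this] g_ge(1,2)[OF assms] show ?thesis by linarith
qed

lemma g_nonneg:
  assumes "u \<in> S" "\<not> bad u" shows "g u \<ge> 0"
proof (cases "z u = 0")
  case True
  from g_pos[OF assms(1) this] show ?thesis by linarith
next
  case False
  then show ?thesis using g_ge(3)[OF assms(1)] assms unfolding bad_def by simp
qed

definition R where
  "R u u' \<longleftrightarrow> u \<in> S \<and> u' \<in> S \<and> u \<noteq> u' \<and> (\<exists>x\<in>U u \<inter> Q. mate x \<in> U u')"

lemma R_sym: "R u u' \<Longrightarrow> R u' u"
  unfolding R_def using mate by (metis IntD1 IntD2 IntI)

text \<open>These pairs, supplied by heredity, become the unmatched edges of augmenting
  paths.\<close>

lemma subpair_H: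
  assumes "u \<in> S" "x \<in> U u" "y \<in> U u" "x \<noteq> y" "x \<notin> X" "y \<notin> X"
  shows "{x, y} \<in> H_edges V U A"
proof -
  obtain w where "w \<in> V" "U w = {x, y}" using subpair[of u x y] assms S(1) by blast
  then show ?thesis unfolding H_edges_eq[OF A(1)] using assms by (intro image_eqI[of _ _ w]) auto
qed

text \<open>Inside each member the path runs from the element \<open>y\<close> where it enters to
  some \<open>x\<close> in \<open>Q\<close>, and it crosses to the next member along the pair of
  \<open>A\<close> at \<open>x\<close>. In the last member, which is bad, it stops at an uncovered
  element. The condition on the mate of \<open>y\<close> keeps \<open>x\<close> apart from
  \<open>y\<close>; in the last member, \<open>y \<in> Q\<close> keeps \<open>y\<close> apart from
  the end.\<close>

lemma augmenting_chain:
  assumes "rtrancl_path R u us u'" "distinct (u # us)" "bad u'" "u \<in> S"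
    "y \<in> U u" "y \<notin> X" "y \<in> Q \<Longrightarrow> mate y \<notin> \<Union>(U ` set us) \<and> mate y \<notin> U u"
    "us = [] \<Longrightarrow> y \<in> Q"
  shows "\<exists>l. length l \<ge> 2 \<and> distinct l \<and> path_edges l \<subseteq> H_edges V U A \<and> alternating M False l \<and>
             hd l = y \<and> last l \<notin> \<Union>M \<and> set l \<subseteq> \<Union>(U ` set (u # us))"
  using assms
proof (induction arbitrary: y)
  case (base u)
  obtain o' where o: "o' \<in> U u" "o' \<notin> \<Union>(U ` A)" using zE base.prems(2) unfolding bad_def by blast
  have oX: "o' \<notin> X" "o' \<notin> Q" using o cov by blast+
  have y: "y \<in> Q" using base.prems by simp
  then have "y \<noteq> o'" using oX by blast
  have "{y, o'} \<notin> M" using oX(2) unfolding Q_def by blast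
  then show ?case
    using subpair_H[OF base.prems(3,4) o(1) \<open>y \<noteq> o'\<close> base.prems(5) oX(1)] \<open>y \<noteq> o'\<close> oX o base.prems
    by (intro exI[of _ "[y, o']"]) (auto simp: Q_def)
next
  case (step u u1 us u')
  have R: "u \<in> S" "u1 \<in> S" "u \<noteq> u1" using step.hyps(1) unfolding R_def by auto
  obtain x where x: "x \<in> U u" "x \<in> Q" "mate x \<in> U u1" using step.hyps(1) unfolding R_def by blast
  have disj: "U u \<inter> U v = {}" if "v \<in> set (u1 # us)" "v \<in> S" for v
    using S(2) R(1) that step.prems(1) unfolding disjoint_family_def by auto
  have inS: "v \<in> S" if "v \<in> set us" for v
  proof -
    have "rtrancl_path R u1 us u'" by (rule step.hyps(2))
    then have "\<forall>v\<in>set us. v \<in> S" by induction (auto simp: R_def)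
    then show ?thesis using that by blast
  qed
  have "mate x \<in> Q" using mate(2)[OF x(2)] .
  have xy: "x \<noteq> y" using step.prems(6) x by auto
  have mX: "mate x \<notin> X" "x \<notin> X" using \<open>mate x \<in> Q\<close> x(2) XQ by blast+
  have "\<exists>l. length l \<ge> 2 \<and> distinct l \<and> path_edges l \<subseteq> H_edges V U A \<and> alternating M False l \<and>
             hd l = mate x \<and> last l \<notin> \<Union>M \<and> set l \<subseteq> \<Union>(U ` set (u1 # us))"
  proof (rule step.IH)
    show "distinct (u1 # us)" using step.prems(1) by simp
    have "x \<notin> U v" if "v \<in> set (u1 # us)" for v
      using disj[OF that] x(1) that R(2) inS by auto
    then show "mate (mate x) \<notin> \<Union>(U ` set us) \<and> mate (mate x) \<notin> U u1"
      unfolding mate(4)[OF x(2)] by auto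
  qed (use step.prems R x mX \<open>mate x \<in> Q\<close> in auto)
  then obtain l where l: "length l \<ge> 2" "distinct l" "path_edges l \<subseteq> H_edges V U A" "alternating M False l"
    "hd l = mate x" "last l \<notin> \<Union>M" "set l \<subseteq> \<Union>(U ` set (u1 # us))" by blast
  then obtain m l' where l': "l = mate x # m # l'"
    by (metis Suc_le_length_iff list.sel(1) numeral_2_eq_2)
  have new: "v \<notin> set l" if "v \<in> U u" for v
  proof
    assume "v \<in> set l"
    then obtain w where w: "w \<in> set (u1 # us)" "v \<in> U w" using l(7) by blast
    then have "w \<in> S" using R(2) inS by auto
    then show False using disj[OF w(1)] w(2) that by blast
  qed
  have "{y, x} \<notin> M"
  proof
    assume "{y, x} \<in> M"
    then have "{x, y} \<in> M" by (simp add: insert_commute)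
    then have "y = mate x" using matching_mate[OF matching_M mate(1)[OF x(2)]] by metis
    then show False using disj[of u1] R(2) x(3) step.prems(4) by auto
  qed
  moreover have "{x, mate x} \<in> M" using mate(1)[OF x(2)] .
  moreover have "{y, x} \<in> H_edges V U A"
    using subpair_H[OF R(1) step.prems(4) x(1)] xy step.prems(5) mX by auto
  moreover have "{x, mate x} \<in> H_edges V U A"
    using mate(1)[OF x(2)] matching_H_matching(2)[OF A] by blast
  ultimately show ?case
    using l new[OF step.prems(4)] new[OF x(1)] xy x(1) step.prems(4) unfolding l'
    by (intro exI[of _ "y # x # mate x # m # l'"]) auto
qed

text \<open>A simple chain of links between two bad members yields a path that begins and ends at
  uncovered elements, hence an augmenting one.\<close>

lemma bad_unique:
  assumes "bad u" "bad u'" "R\<^sup>*\<^sup>* u u'" shows "u = u'"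
proof (rule ccontr)
  assume ne: "u \<noteq> u'"
  obtain us0 where "rtrancl_path R u us0 u'" using assms(3) by (auto simp: rtranclp_eq_rtrancl_path)
  then obtain us where us: "rtrancl_path R u us u'" "distinct (u # us)"
    using rtrancl_path_distinct by metis
  have "us \<noteq> []" using us(1) ne by (auto elim: rtrancl_path.cases)
  have "z u > 0" "u \<in> S" using assms(1) unfolding bad_def by auto
  obtain o' where o: "o' \<in> U u" "o' \<notin> \<Union>(U ` A)" using zE[OF \<open>z u > 0\<close>] .
  then have oX: "o' \<notin> X" "o' \<notin> Q" using cov by blast+
  obtain l where l: "length l \<ge> 2" "distinct l" "path_edges l \<subseteq> H_edges V U A" "alternating M False l"
    "hd l = o'" "last l \<notin> \<Union>M"
    using augmenting_chain[OF us assms(2) \<open>u \<in> S\<close> o(1) oX(1)] oX(2) \<open>us \<noteq> []\<close> by auto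
  then have "augmenting_path (H_edges V U A) M l"
    unfolding augmenting_path_iff using oX(2) unfolding Q_def by blast
  then show False using no_aug by blast
qed

lemma hE: assumes "u \<in> S" "x \<in> U u" "x \<in> Q" "mate x \<notin> \<Union>(U ` S)" shows "h u \<ge> 1"
proof -
  have "finite {x \<in> U u \<inter> Q. mate x \<notin> \<Union>(U ` S)}" using finite_U assms(1) S(1) by auto
  then show ?thesis unfolding h_def using assms by (auto simp: Suc_le_eq card_gt_0_iff)
qed

text \<open>
  A bad vertex has a deficit of 3; the surplus that pays for it is found within three steps
  from it in its component.
\<close>

lemma bad_component:
  assumes bad: "bad u"
  defines "K \<equiv> {v \<in> S. R\<^sup>*\<^sup>* u v}"
  shows "(\<Sum>v\<in>K. g v) \<ge> 0"
proof -
  have finK: "finite K" unfolding K_def using fin(2) by simp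
  have u: "u \<in> S" "z u > 0" "p u > 0" using bad unfolding bad_def by auto
  have uK: "u \<in> K" unfolding K_def using u by simp
  have nonneg: "g v \<ge> 0" if "v \<in> K - {u}" for v
  proof -
    have "\<not> bad v" using bad_unique[OF bad, of v] that unfolding K_def by auto
    then show ?thesis using g_nonneg that unfolding K_def by blast
  qed
  have gu: "g u = 7 * int (h u) - 3" "p u = 1"
    using g_ge(3)[OF u(1,2)] u(3) by auto
  \<comment> \<open>The deficit of \<open>u\<close> is at most 3 and nothing else in its component
    is negative, so any other members with total surplus 3 settle the claim.\<close>
  have enough: ?thesis if "D \<subseteq> K - {u}" "(\<Sum>v\<in>D. g v) \<ge> 3" for D
  proof -
    have "(\<Sum>v\<in>D. g v) \<le> (\<Sum>v\<in>K - {u}. g v)"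
      by (rule sum_mono2) (use finK that(1) nonneg in auto)
    then have "(\<Sum>v\<in>K - {u}. g v) \<ge> 3" using that(2) by linarith
    then show ?thesis using sum.remove[OF finK uK, of g] gu(1) by linarith
  qed
  obtain x where x: "U u \<inter> Q = {x}" using gu(2) unfolding p_def by (auto simp: card_1_singleton_iff)
  then have xu: "x \<in> U u" "x \<in> Q" by auto
  \<comment> \<open>A member that meets \<open>Q\<close> and has an uncovered element is bad, and
    \<open>u\<close> is the only bad one in its component.\<close>
  have z0: "z v = 0" if "v \<in> K - {u}" "y \<in> U v" "y \<in> Q" for v y
  proof -
    have v: "v \<in> S" "R\<^sup>*\<^sup>* u v" "u \<noteq> v" using that(1) unfolding K_def by auto
    have "p v > 0" using that finite_U v(1) S(1) unfolding p_def by (auto simp: card_gt_0_iff)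
    moreover have "\<not> bad v" using bad_unique[OF bad _ v(2)] v(3) by blast
    ultimately show ?thesis using v(1) unfolding bad_def by simp
  qed
  have uniq: "v = w" if "v \<in> S" "w \<in> S" "a \<in> U v" "a \<in> U w" for v w a
    by (rule disjoint_familyD[OF S(2) that])
  have other: "\<exists>w. w \<in> K \<and> mate y \<in> U w \<and> w \<noteq> v"
    if v: "v \<in> K" "y \<in> U v" "y \<in> Q" "mate y \<notin> U v" "mate y \<in> \<Union>(U ` S)" for v y
  proof -
    obtain w where w: "w \<in> S" "mate y \<in> U w" using v(5) by blast
    have "R v w" unfolding R_def using v w unfolding K_def by auto
    then have "R\<^sup>*\<^sup>* u w" using v(1) unfolding K_def by (auto intro: rtranclp.rtrancl_into_rtrancl)
    then show ?thesis using w v(4) unfolding K_def by blast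
  qed
  have KS: "v \<in> S" if "v \<in> K" for v using that unfolding K_def by simp
  have KV: "v \<in> V" if "v \<in> K" for v using that S(1) unfolding K_def by blast
  have unhit: "g v \<ge> 8" if "v \<in> K - {u}" "y \<in> U v" "y \<in> Q" "mate y \<notin> \<Union>(U ` S)" for v y
    using g_pos[OF _ z0[OF that(1-3)]] hE[OF _ that(2-4)] that(1) KS by fastforce
  have pos: "g v \<ge> 1 + int (t v)" if "v \<in> K - {u}" "y \<in> U v" "y \<in> Q" for v y
    using g_pos[OF _ z0[OF that]] that(1) KS by fastforce
  show ?thesis
  proof (cases "mate x \<in> \<Union>(U ` S)")
    case False
    \<comment> \<open>The mate of \<open>x\<close> lies in no member of \<open>S\<close>, so it pays
      its 7 to \<open>u\<close> itself.\<close>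
    then have "h u \<ge> 1" using hE[OF u(1) xu] by simp
    then have "g u \<ge> 0" using gu by simp
    then show ?thesis using nonneg by (intro sum_nonneg) blast
  next
    case True
    define y where "y = mate x"
    have y: "y \<in> Q" "mate y = x" "y \<noteq> x" using mate[OF xu(2)] unfolding y_def by auto
    have yu: "y \<notin> U u" using x y by auto
    obtain u1 where u1: "u1 \<in> K" "y \<in> U u1" "u1 \<noteq> u"
      using other[OF uK xu _ True] yu unfolding y_def by blast
    have K1: "u1 \<in> K - {u}" using u1 by simp
    note z1 = z0[OF K1 u1(2) y(1)]
    note tpz1 = tpz[OF KV[OF u1(1)]]
    \<comment> \<open>A pair has surplus at least 4 and a triple with two elements in
      \<open>X\<close> at least 1 + 2. Only the third case requires a look beyond
      \<open>u1\<close>.\<close>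
    consider "card (U u1) = 2" | "card (U u1) = 3" "t u1 \<ge> 2" | "card (U u1) = 3" "t u1 \<le> 1"
      using card_U[OF KV[OF u1(1)]] by linarith
    then show ?thesis
    proof cases
      case 1
      have "g u1 \<ge> 4" using g_ge(2)[OF KS[OF u1(1)] z1 1] by linarith
      then show ?thesis using K1 by (intro enough[of "{u1}"]) auto
    next
      case 2
      have "g u1 \<ge> 3" using g_ge(1)[OF KS[OF u1(1)] z1 2(1)] 2(2) by linarith
      then show ?thesis using K1 by (intro enough[of "{u1}"]) auto
    next
      case 3
      have finQ1: "finite (U u1 \<inter> Q)" using finite_U KV u1(1) by blast
      have "card (U u1 \<inter> Q) \<ge> 2" using tpz1 z1 3 unfolding p_def by linarith
      then have "card (U u1 \<inter> Q - {y}) \<ge> 1" using u1 y finQ1 by simp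
      then have "U u1 \<inter> Q - {y} \<noteq> {}" by (metis card.empty not_one_le_zero)
      then obtain x2 where x2: "x2 \<in> U u1" "x2 \<in> Q" "x2 \<noteq> y" by blast
      have x_notin: "a \<in> K - {u} \<Longrightarrow> x \<notin> U a" for a using uniq[of a u x] KS u(1) xu(1) by blast
      \<comment> \<open>The pair at \<open>a\<close> leaves \<open>u1\<close>: this is
        \<open>triple_without_X\<close> if \<open>u1\<close> misses \<open>X\<close>; otherwise
        \<open>y\<close> and \<open>a\<close> are its only elements in \<open>Q\<close>, and the
        mate of \<open>y\<close> is \<open>x\<close>. It does not lead back to \<open>u\<close>
        either, as \<open>x\<close> is the only element of \<open>u\<close> in
        \<open>Q\<close>.\<close>
      have mate_out1: "mate a \<notin> U u1 \<and> mate a \<notin> U u" if a: "a \<in> U u1" "a \<in> Q" "a \<noteq> y" for a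
      proof
        show "mate a \<notin> U u"
        proof
          assume "mate a \<in> U u"
          then have "mate a = x" using x mate(2)[OF a(2)] by blast
          then have "a = y" using mate(4)[OF a(2)] unfolding y_def by simp
          then show False using a(3) by simp
        qed
        show "mate a \<notin> U u1"
        proof (cases "t u1 = 0")
          case True
          then show ?thesis using triple_without_X(2)[OF KV[OF u1(1)] 3(1)] a by blast
        next
          case False
          then have "card (U u1 \<inter> Q) = 2" using tpz1 z1 3 unfolding p_def by linarith
          moreover have "{y, a} \<subseteq> U u1 \<inter> Q" "card {y, a} = 2" using a y u1 by auto
          ultimately have "U u1 \<inter> Q = {y, a}" using card_subset_eq[OF finQ1] by metis
          moreover have "mate a \<noteq> y" using mate(4)[OF a(2)] y(2) x_notin[OF K1] a(1) by auto
          moreover have "mate a \<noteq> a" "mate a \<in> Q" using mate[OF a(2)] by auto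
          ultimately show ?thesis by blast
        qed
      qed
      show ?thesis
      proof (cases "mate x2 \<in> \<Union>(U ` S)")
        case False
        then show ?thesis using unhit[OF K1 x2(1,2)] K1 by (intro enough[of "{u1}"]) auto
      next
        case True
        obtain u2 where u2: "u2 \<in> K" "mate x2 \<in> U u2" "u2 \<noteq> u1"
          using other[OF u1(1) x2(1,2) _ True] mate_out1[OF x2] by blast
        have K2: "u2 \<in> K - {u}" using u2 mate_out1[OF x2] by auto
        note m2 = mate(2)[OF x2(2)]
        note z2 = z0[OF K2 u2(2) m2]
        have g2: "g u2 \<ge> 1 + int (t u2)" by (rule pos[OF K2 u2(2) m2])
        have g1: "g u1 \<ge> 1 + int (t u1)" by (rule pos[OF K1 u1(2) y(1)])
        show ?thesis
        proof (cases "t u1 = 0")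
          case False
          \<comment> \<open>The element in \<open>X\<close> raises the surplus of \<open>u1\<close>
            to 2, and \<open>u2\<close> adds 1.\<close>
          then show ?thesis using g1 g2 K1 K2 u2(3) by (intro enough[of "{u1, u2}"]) auto
        next
          \<comment> \<open>Here \<open>u1\<close> lies inside \<open>Q\<close> and may have surplus
            only 1; its third element \<open>x3\<close> opens a further direction.\<close>
          case t1: True
          then have p1: "card (U u1 \<inter> Q) = 3" using tpz1 z1 3 unfolding p_def by linarith
          then have "card (U u1 \<inter> Q - {y, x2}) \<ge> 1" using u1 y x2 finQ1 by (simp add: card_Diff_subset)
          then have "U u1 \<inter> Q - {y, x2} \<noteq> {}" by (metis card.empty not_one_le_zero)
          then obtain x3 where x3: "x3 \<in> U u1" "x3 \<in> Q" "x3 \<noteq> y" "x3 \<noteq> x2" by blast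
          show ?thesis
          proof (cases "mate x3 \<in> \<Union>(U ` S)")
            case False
            then show ?thesis using unhit[OF K1 x3(1,2)] K1 by (intro enough[of "{u1}"]) auto
          next
            case True
            obtain u3 where u3: "u3 \<in> K" "mate x3 \<in> U u3" "u3 \<noteq> u1"
              using other[OF u1(1) x3(1,2) _ True] mate_out1[OF x3(1-3)] by blast
            have K3: "u3 \<in> K - {u}" using u3 mate_out1[OF x3(1-3)] by auto
            note m3 = mate(2)[OF x3(2)]
            have g3: "g u3 \<ge> 1 + int (t u3)" by (rule pos[OF K3 u3(2) m3])
            show ?thesis
            proof (cases "u3 = u2")
              case False
              then show ?thesis using g1 g2 g3 K1 K2 K3 u2(3) u3(3)
                by (intro enough[of "{u1, u2, u3}"]) auto
            next
              \<comment> \<open>Both pairs lead to the same member, so a third unit of surplus has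
                to be found at \<open>u2\<close> or one step beyond it.\<close>
              case u32: True
              have m23: "mate x2 \<noteq> mate x3" using mate(4)[OF x2(2)] mate(4)[OF x3(2)] x3(4) by metis
              note tpz2 = tpz[OF KV[OF u2(1)]]
              consider "card (U u2) = 2" | "t u2 \<ge> 1" | "card (U u2) = 3" "t u2 = 0"
                using card_U[OF KV[OF u2(1)]] by linarith
              then show ?thesis
              proof cases
                case 1
                have "g u2 \<ge> 4" using g_ge(2)[OF KS[OF u2(1)] z2 1] by linarith
                then show ?thesis using K2 by (intro enough[of "{u2}"]) auto
              next
                case 2
                then show ?thesis using g1 g2 K1 K2 u2(3) by (intro enough[of "{u1, u2}"]) auto
              next
                \<comment> \<open>The triple \<open>u2\<close> lies inside \<open>Q\<close> and two
                  of its elements have their mates in \<open>u1\<close>. The mate of the third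
                  either pays 7 to \<open>u2\<close> or lies in a member different from
                  \<open>u\<close>, \<open>u1\<close> and \<open>u2\<close>.\<close>
                case c2: 3
                have finQ2: "finite (U u2 \<inter> Q)" using finite_U KV u2(1) by blast
                have "card (U u2 \<inter> Q) = 3" using tpz2 z2 c2 unfolding p_def by linarith
                then have "card (U u2 \<inter> Q - {mate x2, mate x3}) \<ge> 1"
                  using u2 u3 u32 m2 m3 m23 finQ2 by (simp add: card_Diff_subset)
                then have "U u2 \<inter> Q - {mate x2, mate x3} \<noteq> {}" by (metis card.empty not_one_le_zero)
                then obtain x4 where x4: "x4 \<in> U u2" "x4 \<in> Q" "x4 \<noteq> mate x2" "x4 \<noteq> mate x3" by blast
                show ?thesis
                proof (cases "mate x4 \<in> \<Union>(U ` S)")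
                  case False
                  then show ?thesis using unhit[OF K2 x4(1,2)] K2 by (intro enough[of "{u2}"]) auto
                next
                  case True
                  have n2: "mate x4 \<notin> U u2"
                    using triple_without_X(2)[OF KV[OF u2(1)] c2] x4 by blast
                  have yx23: "U u1 \<inter> Q = {y, x2, x3}"
                  proof -
                    have "{y, x2, x3} \<subseteq> U u1 \<inter> Q" using u1 y x2 x3 by auto
                    moreover have "card {y, x2, x3} = 3" using x2(3) x3(3,4) by simp
                    ultimately show ?thesis using card_subset_eq[OF finQ1] p1 by metis
                  qed
                  note mm4 = mate(4)[OF x4(2)]
                  have "mate x4 \<noteq> y" using mm4 y(2) x_notin[OF K2] x4(1) by auto
                  then have n1: "mate x4 \<notin> U u1"
                  proof -
                    have "mate x4 \<noteq> x2" "mate x4 \<noteq> x3" using mm4 x4(3,4) by auto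
                    then have "mate x4 \<notin> U u1 \<inter> Q" using \<open>mate x4 \<noteq> y\<close> unfolding yx23 by simp
                    then show ?thesis using mate(2)[OF x4(2)] by blast
                  qed
                  have nu: "mate x4 \<notin> U u"
                  proof
                    assume "mate x4 \<in> U u"
                    then have "mate x4 = x" using x mate(2)[OF x4(2)] by blast
                    then have "x4 = y" using mm4 unfolding y_def by simp
                    then show False using uniq[OF KS KS, OF u1(1) u2(1) u1(2)] x4(1) u2(3) by blast
                  qed
                  obtain u4 where u4: "u4 \<in> K" "mate x4 \<in> U u4" "u4 \<noteq> u2"
                    using other[OF u2(1) x4(1,2) n2 True] by blast
                  have K4: "u4 \<in> K - {u}" using u4 nu by auto
                  have "u4 \<noteq> u1" using u4 n1 by auto
                  moreover have "g u4 \<ge> 1 + int (t u4)" by (rule pos[OF K4 u4(2) mate(2)[OF x4(2)]])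
                  ultimately show ?thesis using g1 g2 K1 K2 K4 u2(3) u4(3)
                    by (intro enough[of "{u1, u2, u4}"]) auto
                qed
              qed
            qed
          qed
        qed
      qed
    qed
  qed
qed

text \<open>Linking is symmetric, so the components partition \<open>S\<close>; each contains a bad
  member and falls under \<open>bad_component\<close>, or has no negative term.\<close>

lemma sum_g_nonneg: "(\<Sum>u\<in>S. g u) \<ge> 0"
proof -
  define cl where "cl u = {v \<in> S. R\<^sup>*\<^sup>* u v}" for u
  have sym: "R\<^sup>*\<^sup>* v u" if "R\<^sup>*\<^sup>* u v" for u v
    using that by induction (auto intro: converse_rtranclp_into_rtranclp R_sym)
  have cl_eq: "cl u = cl v" if "R\<^sup>*\<^sup>* u v" for u v
    unfolding cl_def using that sym by (auto intro: rtranclp_trans)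
  have "S = \<Union>(cl ` S)" unfolding cl_def by auto
  then have "(\<Sum>u\<in>S. g u) = (\<Sum>u\<in>\<Union>(cl ` S). g u)" by simp
  also have "\<dots> = (\<Sum>C\<in>cl ` S. \<Sum>u\<in>C. g u)"
  proof (subst sum.Union_disjoint)
    show "\<forall>C\<in>cl ` S. finite C" unfolding cl_def using fin(2) by auto
    show "\<forall>C\<in>cl ` S. \<forall>D\<in>cl ` S. C \<noteq> D \<longrightarrow> C \<inter> D = {}"
    proof (intro ballI impI)
      fix C D assume "C \<in> cl ` S" "D \<in> cl ` S" "C \<noteq> D"
      then obtain a b where ab: "C = cl a" "D = cl b" "cl a \<noteq> cl b" by blast
      have False if "R\<^sup>*\<^sup>* a v" "R\<^sup>*\<^sup>* b v" for v
        using cl_eq[OF that(1)] cl_eq[OF that(2)] ab(3) by simp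
      then show "C \<inter> D = {}" unfolding ab cl_def by blast
    qed
  qed simp
  also have "\<dots> \<ge> 0"
  proof (rule sum_nonneg)
    fix C assume "C \<in> cl ` S"
    then obtain a where a: "a \<in> S" "C = cl a" by blast
    show "(\<Sum>u\<in>C. g u) \<ge> 0"
    proof (cases "\<exists>u\<in>C. bad u")
      case True
      then obtain u where u: "u \<in> C" "bad u" by blast
      then have "C = cl u" using cl_eq[of a u] a unfolding cl_def by blast
      then show ?thesis using bad_component[OF u(2)] unfolding cl_def by simp
    next
      case False
      then show ?thesis using g_nonneg a(2) unfolding cl_def by (intro sum_nonneg) blast
    qed
  qed
  finally show ?thesis .
qed

text \<open>In tenths, \<open>A\<close> pays at most 28 per triple of weight 2 and 14 per pair of
  weight 1, in total 14 times its weight.\<close>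

theorem approximation: "5 * total_weight G S \<le> 7 * total_weight G A"
proof -
  let ?a2 = "card {v \<in> A. card (U v) = 2}" and ?a3 = "card {v \<in> A. card (U v) = 3}"
  have wS: "int (total_weight G S) = (\<Sum>u\<in>S. int (card (U u)) - 1)"
  proof -
    have "int (card (U u) - 1) = int (card (U u)) - 1" if "u \<in> S" for u
      using card_U[OF subsetD[OF S(1) that]] by auto
    then show ?thesis unfolding total_weight_def G_simps of_nat_sum by (intro sum.cong) auto
  qed
  have wA: "total_weight G A = ?a2 + 2 * ?a3"
  proof -
    have "A = {v \<in> A. card (U v) = 2} \<union> {v \<in> A. card (U v) = 3}" using A(1) card_U by blast
    then have "total_weight G A =
        total_weight G ({v \<in> A. card (U v) = 2} \<union> {v \<in> A. card (U v) = 3})" by simp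
    also have "\<dots> = total_weight G {v \<in> A. card (U v) = 2} + total_weight G {v \<in> A. card (U v) = 3}"
      unfolding total_weight_def by (rule sum.union_disjoint) (use fin(1) in auto)
    also have "\<dots> = ?a2 + 2 * ?a3" unfolding total_weight_def by simp
    finally show ?thesis .
  qed
  have "(\<Sum>u\<in>S. g u) = (\<Sum>u\<in>S. \<Sum>x\<in>U u \<inter> X. c x) + 7 * int (\<Sum>u\<in>S. p u + h u)
      - 10 * (\<Sum>u\<in>S. int (card (U u)) - 1)"
    unfolding g_def by (simp add: sum.distrib sum_subtractf sum_distrib_left algebra_simps)
  also have "\<dots> \<le> 28 * int ?a3 + 7 * int (2 * ?a2) - 10 * int (total_weight G S)"
  proof -
    have "int (\<Sum>u\<in>S. p u + h u) \<le> int (2 * ?a2)" using sum_ph_le by (rule of_nat_mono)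
    then show ?thesis unfolding wS using sum_c_le by linarith
  qed
  finally have "10 * int (total_weight G S) \<le> 28 * int ?a3 + 14 * int ?a2"
    using sum_g_nonneg by simp
  then have "int (10 * total_weight G S) \<le> int (28 * ?a3 + 14 * ?a2)" by simp
  then have "10 * total_weight G S \<le> 28 * ?a3 + 14 * ?a2" unfolding of_nat_le_iff .
  then show ?thesis unfolding wA by simp
qed

end

section \<open>Symbolic evaluation\<close>

inductive_simps eval_simps:
  "eval P env (Var i) x n" "eval P env NilE x n" "eval P env (ConsE a b) x n"
  "eval P env (CarE a) x n" "eval P env (CdrE a) x n" "eval P env (ConspE a) x n"
  "eval P env (EqE a b) x n" "eval P env (IfE a b d) x n" "eval P env (CallE f as) x n"
  "evals P env [] xs n" "evals P env (a # as) xs n"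

text \<open>A weakest precondition that includes the cost. Its equations let the simplifier execute
  an expression, and the existential form yields termination at the same time.\<close>

definition wp :: "program \<Rightarrow> 'a sexp list \<Rightarrow> expr \<Rightarrow> ('a sexp \<Rightarrow> nat \<Rightarrow> bool) \<Rightarrow> bool" where
  "wp P env e Q \<longleftrightarrow> (\<exists>x n. eval P env e x n \<and> Q x n)"

definition wps :: "program \<Rightarrow> 'a sexp list \<Rightarrow> expr list \<Rightarrow> ('a sexp list \<Rightarrow> nat \<Rightarrow> bool) \<Rightarrow> bool" where
  "wps P env es Q \<longleftrightarrow> (\<exists>xs n. evals P env es xs n \<and> Q xs n)"

text \<open>Symbolic execution stops at a call, where a specification of the called function takes
  over; unfolding recursive bodies would not end.\<close>

definition call :: "program \<Rightarrow> nat \<Rightarrow> 'a sexp list \<Rightarrow> ('a sexp \<Rightarrow> nat \<Rightarrow> bool) \<Rightarrow> bool" where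
  "call P f xs Q \<longleftrightarrow> f < length P \<and> wp P xs (P ! f) Q"

lemma wp_Var: "wp P env (Var i) Q \<longleftrightarrow> i < length env \<and> Q (env ! i) (Suc 0)"
  unfolding wp_def eval_simps by blast

lemma wp_NilE: "wp P env NilE Q \<longleftrightarrow> Q SNil (Suc 0)"
  unfolding wp_def eval_simps by blast

lemma wp_ConsE:
  "wp P env (ConsE a b) Q \<longleftrightarrow> wp P env a (\<lambda>x m. wp P env b (\<lambda>y n. Q (SCons x y) (Suc (m + n))))"
  unfolding wp_def eval_simps by blast

lemma wp_CarE: "wp P env (CarE a) Q \<longleftrightarrow> wp P env a (\<lambda>x n. Q (scar x) (Suc n))"
  unfolding wp_def eval_simps by blast

lemma wp_CdrE: "wp P env (CdrE a) Q \<longleftrightarrow> wp P env a (\<lambda>x n. Q (scdr x) (Suc n))"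
  unfolding wp_def eval_simps by blast

lemma wp_ConspE: "wp P env (ConspE a) Q \<longleftrightarrow> wp P env a (\<lambda>x n. Q (sbool (is_cons x)) (Suc n))"
  unfolding wp_def eval_simps by blast

lemma wp_EqE:
  "wp P env (EqE a b) Q \<longleftrightarrow>
     wp P env a (\<lambda>x m. wp P env b (\<lambda>y n. Q (sbool (\<not> is_cons x \<and> \<not> is_cons y \<and> x = y)) (Suc (m + n))))"
  unfolding wp_def eval_simps by blast

lemma wp_IfE:
  "wp P env (IfE d a b) Q \<longleftrightarrow>
     wp P env d (\<lambda>x m. if x = SNil then wp P env b (\<lambda>y n. Q y (Suc (m + n)))
                       else wp P env a (\<lambda>y n. Q y (Suc (m + n))))" (is "?l \<longleftrightarrow> ?r")
proof
  assume ?l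
  then obtain y n where y: "eval P env (IfE d a b) y n" "Q y n" unfolding wp_def by blast
  from y(1)[unfolded eval_simps] consider
      z s m where "n = Suc (s + m)" "eval P env d z s" "z \<noteq> SNil" "eval P env a y m"
    | s m where "n = Suc (s + m)" "eval P env d SNil s" "eval P env b y m" by blast
  then show ?r
  proof cases
    case (1 z s m)
    then have "wp P env a (\<lambda>y n. Q y (Suc (s + n)))" unfolding wp_def using y(2) by blast
    then show ?r unfolding wp_def[of P env d] using 1 by (intro exI[of _ z] exI[of _ s]) simp
  next
    case (2 s m)
    then have "wp P env b (\<lambda>y n. Q y (Suc (s + n)))" unfolding wp_def using y(2) by blast
    then show ?r unfolding wp_def[of P env d] using 2 by (intro exI[of _ SNil] exI[of _ s]) simp
  qed
next
  assume ?r
  then obtain z s where z: "eval P env d z s"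
    "if z = SNil then wp P env b (\<lambda>y n. Q y (Suc (s + n))) else wp P env a (\<lambda>y n. Q y (Suc (s + n)))"
    unfolding wp_def[of P env d] by blast
  show ?l
  proof (cases "z = SNil")
    case True
    then obtain y n where y: "eval P env b y n" "Q y (Suc (s + n))" using z(2) unfolding wp_def by auto
    have "eval P env (IfE d a b) y (Suc (s + n))"
      unfolding eval_simps using z(1) y(1) True by blast
    then show ?thesis unfolding wp_def using y(2) by blast
  next
    case False
    then obtain y n where y: "eval P env a y n" "Q y (Suc (s + n))" using z(2) unfolding wp_def by auto
    have "eval P env (IfE d a b) y (Suc (s + n))"
      unfolding eval_simps using z(1) y(1) False by blast
    then show ?thesis unfolding wp_def using y(2) by blast
  qed
qed

lemma wp_CallE:
  "wp P env (CallE f es) Q \<longleftrightarrow> wps P env es (\<lambda>xs m. call P f xs (\<lambda>y n. Q y (Suc (m + n))))"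
  unfolding wp_def wps_def call_def eval_simps by blast

lemma wps_Nil: "wps P env [] R \<longleftrightarrow> R [] 0"
  unfolding wps_def eval_simps by blast

lemma wps_Cons:
  "wps P env (e # es) R \<longleftrightarrow> wp P env e (\<lambda>x m. wps P env es (\<lambda>xs n. R (x # xs) (m + n)))"
  unfolding wp_def wps_def eval_simps by blast

lemmas wp_simps = wp_Var wp_NilE wp_ConsE wp_CarE wp_CdrE wp_ConspE wp_EqE wp_IfE wp_CallE
  wps_Nil wps_Cons

lemma sbool_simps [simp]: "sbool True = SCons SNil SNil" "sbool False = SNil" "sbool b = SNil \<longleftrightarrow> \<not> b"
  by (simp_all add: sbool_def)

section \<open>The program\<close>

abbreviation tt :: expr where "tt \<equiv> ConsE NilE NilE"

text \<open>An entry is a vertex followed by its elements, so its third tail is nonempty exactly if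
  there are three of them.\<close>

abbreviation triple :: "expr \<Rightarrow> expr" where "triple v \<equiv> ConspE (CdrE (CdrE (CdrE v)))"

abbreviation (input) "STRIP \<equiv> 1 :: nat"
abbreviation (input) "MEM \<equiv> 2 :: nat"
abbreviation (input) "APP \<equiv> 3 :: nat"
abbreviation (input) "DISJ \<equiv> 4 :: nat"
abbreviation (input) "ALLDISJ \<equiv> 5 :: nat"
abbreviation (input) "FILT \<equiv> 6 :: nat"
abbreviation (input) "PUSH \<equiv> 7 :: nat"
abbreviation (input) "EXT1 \<equiv> 8 :: nat"
abbreviation (input) "EXT \<equiv> 9 :: nat"
abbreviation (input) "ADJALL \<equiv> 10 :: nat"
abbreviation (input) "CENTER \<equiv> 11 :: nat"
abbreviation (input) "PHI \<equiv> 12 :: nat"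
abbreviation (input) "LESS \<equiv> 13 :: nat"
abbreviation (input) "GOOD \<equiv> 14 :: nat"
abbreviation (input) "FIND \<equiv> 15 :: nat"
abbreviation (input) "IDS \<equiv> 16 :: nat"
abbreviation (input) "TRIPS \<equiv> 17 :: nat"
abbreviation (input) "PAIRS \<equiv> 18 :: nat"
abbreviation (input) "EDGES \<equiv> 19 :: nat"
abbreviation (input) "ASSOC \<equiv> 20 :: nat"
abbreviation (input) "GROW \<equiv> 21 :: nat"
abbreviation (input) "GROWLOOP \<equiv> 22 :: nat"
abbreviation (input) "GROWLOOP2 \<equiv> 23 :: nat"
abbreviation (input) "CONF \<equiv> 24 :: nat"
abbreviation (input) "FIRST \<equiv> 25 :: nat"
abbreviation (input) "DIFF \<equiv> 26 :: nat"
abbreviation (input) "REN \<equiv> 27 :: nat"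
abbreviation (input) "RENC \<equiv> 28 :: nat"
abbreviation (input) "SUB \<equiv> 29 :: nat"
abbreviation (input) "DECIDE \<equiv> 30 :: nat"
abbreviation (input) "DECIDE2 \<equiv> 31 :: nat"
abbreviation (input) "DECIDE3 \<equiv> 32 :: nat"
abbreviation (input) "DECIDE4 \<equiv> 33 :: nat"
abbreviation (input) "REDUCE \<equiv> 34 :: nat"
abbreviation (input) "AUG \<equiv> 35 :: nat"
abbreviation (input) "AUG2 \<equiv> 36 :: nat"
abbreviation (input) "STEP \<equiv> 37 :: nat"
abbreviation (input) "STEP2 \<equiv> 38 :: nat"
abbreviation (input) "LOOP \<equiv> 39 :: nat"
abbreviation (input) "LOOP2 \<equiv> 40 :: nat"
abbreviation (input) "CANDS \<equiv> 41 :: nat"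

text \<open>Here \<open>tt\<close> is read as the one-element list that contains the empty list: the
  history consisting of the empty set.\<close>

definition "main_body = CallE STRIP [CallE LOOP [Var 0, tt]]"
definition "strip_body =
  IfE (ConspE (Var 0)) (ConsE (CallE IDS [CarE (Var 0)]) (CallE STRIP [CdrE (Var 0)])) NilE"
definition "mem_body =
  IfE (ConspE (Var 1)) (IfE (EqE (Var 0) (CarE (Var 1))) tt (CallE MEM [Var 0, CdrE (Var 1)])) NilE"
definition "app_body =
  IfE (ConspE (Var 0)) (ConsE (CarE (Var 0)) (CallE APP [CdrE (Var 0), Var 1])) (Var 1)"
definition "disj_body =
  IfE (ConspE (Var 0)) (IfE (CallE MEM [CarE (Var 0), Var 1]) NilE (CallE DISJ [CdrE (Var 0), Var 1])) tt"
definition "alldisj_body =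
  IfE (ConspE (Var 1))
    (IfE (CallE DISJ [CdrE (Var 0), CdrE (CarE (Var 1))]) (CallE ALLDISJ [Var 0, CdrE (Var 1)]) NilE) tt"
definition "filt_body =
  IfE (ConspE (Var 0))
    (IfE (CallE ALLDISJ [CarE (Var 0), Var 1])
      (ConsE (CarE (Var 0)) (CallE FILT [CdrE (Var 0), Var 1]))
      (CallE FILT [CdrE (Var 0), Var 1])) NilE"
definition "push_body = CallE APP [Var 0, CallE FILT [Var 1, Var 0]]"
definition "ext1_body =
  IfE (ConspE (Var 1))
    (IfE (CallE ALLDISJ [Var 0, CarE (Var 1)])
      (ConsE (ConsE (Var 0) (CarE (Var 1))) (CallE EXT1 [Var 0, CdrE (Var 1)]))
      (CallE EXT1 [Var 0, CdrE (Var 1)])) NilE"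
definition "ext_body =
  IfE (ConspE (Var 0))
    (CallE APP [CallE EXT1 [CarE (Var 0), Var 1], CallE EXT [CdrE (Var 0), Var 1]]) NilE"
definition "adjall_body =
  IfE (ConspE (Var 1))
    (IfE (EqE (CarE (Var 0)) (CarE (CarE (Var 1)))) NilE
      (IfE (CallE DISJ [CdrE (Var 0), CdrE (CarE (Var 1))]) NilE (CallE ADJALL [Var 0, CdrE (Var 1)]))) tt"
definition "center_body =
  IfE (ConspE (Var 0)) (IfE (CallE ADJALL [CarE (Var 0), Var 1]) tt (CallE CENTER [CdrE (Var 0), Var 1])) NilE"
text \<open>Numbers are unary, as lists of empty trees; 9 and 4 are the squares of the sizes of a
  triple and a pair.\<close>

definition "phi_body =
  IfE (ConspE (Var 0))
    (IfE (triple (CarE (Var 0)))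
      ((ConsE NilE ^^ 9) (CallE PHI [CdrE (Var 0)]))
      ((ConsE NilE ^^ 4) (CallE PHI [CdrE (Var 0)]))) NilE"
definition "less_body =
  IfE (ConspE (Var 1)) (IfE (ConspE (Var 0)) (CallE LESS [CdrE (Var 0), CdrE (Var 1)]) tt) NilE"
definition "good_body =
  IfE (IfE (ConspE (CdrE (Var 2))) (CallE CENTER [Var 0, Var 2]) tt)
    (CallE LESS [CallE PHI [Var 1], CallE PHI [CallE PUSH [Var 2, Var 1]]]) NilE"
definition "find_body =
  IfE (ConspE (Var 2))
    (IfE (CallE GOOD [Var 0, Var 1, CarE (Var 2)]) (CarE (Var 2)) (CallE FIND [Var 0, Var 1, CdrE (Var 2)])) NilE"
definition "ids_body =
  IfE (ConspE (Var 0)) (ConsE (CarE (CarE (Var 0))) (CallE IDS [CdrE (Var 0)])) NilE"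
definition "trips_body =
  IfE (ConspE (Var 0))
    (IfE (triple (CarE (Var 0))) (ConsE (CarE (Var 0)) (CallE TRIPS [CdrE (Var 0)])) (CallE TRIPS [CdrE (Var 0)])) NilE"
definition "pairs_body =
  IfE (ConspE (Var 0))
    (IfE (triple (CarE (Var 0))) (CallE PAIRS [CdrE (Var 0), Var 1])
      (IfE (CallE ALLDISJ [CarE (Var 0), Var 1])
        (ConsE (CarE (Var 0)) (CallE PAIRS [CdrE (Var 0), Var 1]))
        (CallE PAIRS [CdrE (Var 0), Var 1]))) NilE"
definition "edges_body =
  (let x = CarE (CdrE (CarE (Var 0))); y = CarE (CdrE (CdrE (CarE (Var 0))))
   in IfE (ConspE (Var 0)) (ConsE (ConsE x y) (ConsE (ConsE y x) (CallE EDGES [CdrE (Var 0), Var 1]))) (Var 1))"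
text \<open>Serves two kinds of tables: the matching, as pairs keyed by their first component, and
  the forest, as paths keyed by their heads.\<close>

definition "assoc_body =
  IfE (ConspE (Var 1))
    (IfE (EqE (Var 0) (CarE (CarE (Var 1)))) (CarE (Var 1)) (CallE ASSOC [Var 0, CdrE (Var 1)])) NilE"
definition "grow_body =
  (let x = CarE (CarE (Var 0)); y = CdrE (CarE (Var 0)); next = CallE GROW [CdrE (Var 0), Var 1, Var 2];
       z = CdrE (CallE ASSOC [y, Var 1])
   in IfE (ConspE (Var 0))
        (IfE (CallE ASSOC [x, Var 2])
          (IfE (CallE ASSOC [y, Var 2]) next
            (IfE (CallE ASSOC [y, Var 1])
              (IfE (CallE ASSOC [z, Var 2]) next (ConsE z (ConsE y (CallE ASSOC [x, Var 2]))))
              next))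
          (IfE (CallE ASSOC [x, Var 1]) next (ConsE x NilE))) NilE)"
text \<open>There is no local binding, so a value that is used repeatedly is passed to an auxiliary
  function; this explains the functions numbered 2 to 4.\<close>

definition "growloop_body =
  CallE GROWLOOP2 [Var 0, Var 1, Var 2, CallE GROW [Var 0, Var 1, Var 2]]"
definition "growloop2_body =
  IfE (Var 3) (CallE GROWLOOP [Var 0, Var 1, ConsE (Var 3) (Var 2)]) (Var 2)"
definition "conf_body =
  (let x = CarE (CarE (Var 0)); y = CdrE (CarE (Var 0)); next = CallE CONF [CdrE (Var 0), Var 1]
   in IfE (ConspE (Var 0))
        (IfE (CallE ASSOC [x, Var 1])
          (IfE (CallE ASSOC [y, Var 1]) (ConsE (CallE ASSOC [x, Var 1]) (CallE ASSOC [y, Var 1])) next)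
          next) NilE)"
definition "first_body =
  IfE (ConspE (Var 0))
    (IfE (CallE MEM [CarE (Var 0), Var 1]) (CarE (Var 0)) (CallE FIRST [CdrE (Var 0), Var 1])) NilE"
definition "diff_body =
  IfE (ConspE (Var 0))
    (IfE (CallE MEM [CarE (Var 0), Var 1]) (CallE DIFF [CdrE (Var 0), Var 1])
      (ConsE (CarE (Var 0)) (CallE DIFF [CdrE (Var 0), Var 1]))) NilE"
definition "ren_body =
  IfE (ConspE (Var 0))
    (CallE RENC [CallE SUB [CarE (CarE (Var 0)), Var 1, Var 2], CallE SUB [CdrE (CarE (Var 0)), Var 1, Var 2],
      CallE REN [CdrE (Var 0), Var 1, Var 2]]) NilE"
definition "renc_body = IfE (EqE (Var 0) (Var 1)) (Var 2) (ConsE (ConsE (Var 0) (Var 1)) (Var 2))"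
definition "sub_body = IfE (CallE MEM [Var 0, Var 1]) (Var 2) (Var 0)"
definition "decide_body =
  CallE DECIDE2 [Var 0, Var 1, CallE CONF [Var 0, CallE GROWLOOP [Var 0, Var 1, NilE]]]"
definition "decide2_body =
  IfE (Var 2)
    (CallE DECIDE3 [Var 0, Var 1, CarE (Var 2), CdrE (Var 2), CallE FIRST [CarE (Var 2), CdrE (Var 2)]]) NilE"
text \<open>\<open>Var 4\<close> is the first common vertex of the two paths. If it is missing, the
  paths are disjoint and the answer is yes; otherwise the two differences form the cycle without its
  base.\<close>

definition "decide3_body =
  IfE (Var 4)
    (CallE DECIDE4 [Var 0, Var 1, CallE APP [CallE DIFF [Var 2, Var 3], CallE DIFF [Var 3, Var 2]], Var 4]) tt"
definition "decide4_body =
  CallE DECIDE [CallE REN [Var 0, Var 2, Var 3], CallE REN [Var 1, Var 2, Var 3]]"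
definition "reduce_body =
  IfE (ConspE (Var 0))
    (IfE (CallE DECIDE [CallE EDGES [CallE APP [CdrE (Var 0), Var 1], Var 2], Var 2])
      (CallE REDUCE [CdrE (Var 0), Var 1, Var 2])
      (CallE REDUCE [CdrE (Var 0), ConsE (CarE (Var 0)) (Var 1), Var 2])) (Var 1)"
definition "aug_body =
  CallE AUG2 [CallE PAIRS [Var 0, CallE TRIPS [Var 1]],
    CallE EDGES [CallE PAIRS [Var 1, CallE TRIPS [Var 1]], NilE]]"
definition "aug2_body =
  IfE (CallE DECIDE [CallE EDGES [Var 0, Var 1], Var 1]) (CallE REDUCE [Var 0, NilE, Var 1]) NilE"
definition "step_body = CallE STEP2 [Var 0, Var 1, CallE FIND [Var 0, Var 1, CallE CANDS [Var 0]]]"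
definition "step2_body = IfE (Var 2) (Var 2) (CallE AUG [Var 0, Var 1])"
definition "loop_body = CallE LOOP2 [Var 0, Var 1, CallE STEP [Var 0, CarE (Var 1)]]"
definition "loop2_body =
  IfE (Var 2) (CallE LOOP [Var 0, ConsE (CallE PUSH [Var 2, CarE (Var 1)]) (Var 1)]) (Var 1)"
text \<open>Here \<open>tt\<close> is the list of lists whose only entry is the empty claw. The
  \<open>let\<close> abbreviates syntax only: the lists are recomputed, with six evaluations of
  \<open>EXT\<close> in total.\<close>

definition "cands_body =
  (let l1 = CallE EXT [Var 0, tt]; l2 = CallE EXT [Var 0, l1]
   in CallE APP [l1, CallE APP [l2, CallE EXT [Var 0, l2]]])"

definition prog :: program where
  "prog =
    [main_body, strip_body, mem_body, app_body, disj_body, alldisj_body, filt_body, push_body,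
     ext1_body, ext_body, adjall_body, center_body, phi_body, less_body, good_body, find_body,
     ids_body, trips_body, pairs_body, edges_body, assoc_body, grow_body, growloop_body,
     growloop2_body, conf_body, first_body, diff_body, ren_body, renc_body, sub_body,
     decide_body, decide2_body, decide3_body, decide4_body, reduce_body, aug_body, aug2_body,
     step_body, step2_body, loop_body, loop2_body, cands_body]"

text \<open>Index 1 occurs also as \<open>Suc 0\<close>, the form into which the simplifier rewrites
  it.\<close>

lemma call_prog:
  "call prog 0 xs Q \<longleftrightarrow> wp prog xs main_body Q"
  "call prog STRIP xs Q \<longleftrightarrow> wp prog xs strip_body Q"
  "call prog (Suc 0) xs Q \<longleftrightarrow> wp prog xs strip_body Q"
  "call prog MEM xs Q \<longleftrightarrow> wp prog xs mem_body Q"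
  "call prog APP xs Q \<longleftrightarrow> wp prog xs app_body Q"
  "call prog DISJ xs Q \<longleftrightarrow> wp prog xs disj_body Q"
  "call prog ALLDISJ xs Q \<longleftrightarrow> wp prog xs alldisj_body Q"
  "call prog FILT xs Q \<longleftrightarrow> wp prog xs filt_body Q"
  "call prog PUSH xs Q \<longleftrightarrow> wp prog xs push_body Q"
  "call prog EXT1 xs Q \<longleftrightarrow> wp prog xs ext1_body Q"
  "call prog EXT xs Q \<longleftrightarrow> wp prog xs ext_body Q"
  "call prog ADJALL xs Q \<longleftrightarrow> wp prog xs adjall_body Q"
  "call prog CENTER xs Q \<longleftrightarrow> wp prog xs center_body Q"
  "call prog PHI xs Q \<longleftrightarrow> wp prog xs phi_body Q"
  "call prog LESS xs Q \<longleftrightarrow> wp prog xs less_body Q"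
  "call prog GOOD xs Q \<longleftrightarrow> wp prog xs good_body Q"
  "call prog FIND xs Q \<longleftrightarrow> wp prog xs find_body Q"
  "call prog IDS xs Q \<longleftrightarrow> wp prog xs ids_body Q"
  "call prog TRIPS xs Q \<longleftrightarrow> wp prog xs trips_body Q"
  "call prog PAIRS xs Q \<longleftrightarrow> wp prog xs pairs_body Q"
  "call prog EDGES xs Q \<longleftrightarrow> wp prog xs edges_body Q"
  "call prog ASSOC xs Q \<longleftrightarrow> wp prog xs assoc_body Q"
  "call prog GROW xs Q \<longleftrightarrow> wp prog xs grow_body Q"
  "call prog GROWLOOP xs Q \<longleftrightarrow> wp prog xs growloop_body Q"
  "call prog GROWLOOP2 xs Q \<longleftrightarrow> wp prog xs growloop2_body Q"
  "call prog CONF xs Q \<longleftrightarrow> wp prog xs conf_body Q"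
  "call prog FIRST xs Q \<longleftrightarrow> wp prog xs first_body Q"
  "call prog DIFF xs Q \<longleftrightarrow> wp prog xs diff_body Q"
  "call prog REN xs Q \<longleftrightarrow> wp prog xs ren_body Q"
  "call prog RENC xs Q \<longleftrightarrow> wp prog xs renc_body Q"
  "call prog SUB xs Q \<longleftrightarrow> wp prog xs sub_body Q"
  "call prog DECIDE xs Q \<longleftrightarrow> wp prog xs decide_body Q"
  "call prog DECIDE2 xs Q \<longleftrightarrow> wp prog xs decide2_body Q"
  "call prog DECIDE3 xs Q \<longleftrightarrow> wp prog xs decide3_body Q"
  "call prog DECIDE4 xs Q \<longleftrightarrow> wp prog xs decide4_body Q"
  "call prog REDUCE xs Q \<longleftrightarrow> wp prog xs reduce_body Q"
  "call prog AUG xs Q \<longleftrightarrow> wp prog xs aug_body Q"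
  "call prog AUG2 xs Q \<longleftrightarrow> wp prog xs aug2_body Q"
  "call prog STEP xs Q \<longleftrightarrow> wp prog xs step_body Q"
  "call prog STEP2 xs Q \<longleftrightarrow> wp prog xs step2_body Q"
  "call prog LOOP xs Q \<longleftrightarrow> wp prog xs loop_body Q"
  "call prog LOOP2 xs Q \<longleftrightarrow> wp prog xs loop2_body Q"
  "call prog CANDS xs Q \<longleftrightarrow> wp prog xs cands_body Q"
  unfolding call_def by (simp_all add: prog_def)

abbreviation el :: "'e \<Rightarrow> ('v + 'e) sexp" where "el x \<equiv> SAtom (Inr x)"

abbreviation atoms :: "'e list \<Rightarrow> ('v + 'e) sexp" where "atoms xs \<equiv> slist (map el xs)"

lemma slist_eq_SNil [simp]: "slist xs = SNil \<longleftrightarrow> xs = []" "SNil = slist xs \<longleftrightarrow> xs = []"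
  by (cases xs; simp)+

lemma is_cons_slist [simp]: "is_cons (slist xs) \<longleftrightarrow> xs \<noteq> []"
  by (cases xs) auto

text \<open>
  The specifications quantify over the postcondition \<open>Q\<close>, so that they chain as introduction
  rules while a body is evaluated symbolically.
\<close>

lemma call_mem:
  "(\<And>r n. r = sbool (a \<in> set ys) \<Longrightarrow> n \<le> 20 * (length ys + 1) \<Longrightarrow> Q r n) \<Longrightarrow>
   call prog MEM [el a, atoms ys] Q"
proof (induction ys arbitrary: Q)
  case Nil
  show ?case by (subst call_prog) (auto simp: mem_body_def wp_simps intro!: Nil)
next
  case (Cons y ys)
  show ?case
    by (subst call_prog) (auto simp: mem_body_def wp_simps intro!: Cons.prems Cons.IH)
qed

text \<open>Here and below, the numerals in cost bounds merely dominate the constant overhead of one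
  round; only polynomial growth matters.\<close>

lemma call_app:
  "(\<And>r n. r = slist (xs @ ys) \<Longrightarrow> n \<le> 20 * (length xs + 1) \<Longrightarrow> Q r n) \<Longrightarrow>
   call prog APP [slist xs, slist ys] Q"
proof (induction xs arbitrary: Q)
  case Nil
  show ?case by (subst call_prog) (auto simp: app_body_def wp_simps intro!: Nil)
next
  case (Cons x xs)
  show ?case
    by (subst call_prog) (auto simp: app_body_def wp_simps intro!: Cons.prems Cons.IH)
qed

lemma call_disj:
  "(\<And>r n. r = sbool (set xs \<inter> set ys = {}) \<Longrightarrow> n \<le> (length xs + 1) * (20 * length ys + 50) \<Longrightarrow> Q r n) \<Longrightarrow>
   call prog DISJ [atoms xs, atoms ys] Q"
proof (induction xs arbitrary: Q)
  case Nil
  show ?case by (subst call_prog) (auto simp: disj_body_def wp_simps intro!: Nil)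
next
  case (Cons x xs)
  show ?case
    by (subst call_prog) (auto simp: disj_body_def wp_simps intro!: Cons.prems Cons.IH call_mem)
qed

section \<open>Search for claws\<close>

locale encoded_collection = hereditary_collection V U
  for V :: "'v set" and U :: "'v \<Rightarrow> 'e set" +
  fixes ul :: "'v \<Rightarrow> 'e list"
  assumes ul: "v \<in> V \<Longrightarrow> distinct (ul v) \<and> set (ul v) = U v"
begin

definition ent :: "'v \<Rightarrow> ('v + 'e) sexp" where "ent v = SCons (SAtom (Inl v)) (atoms (ul v))"

abbreviation ents :: "'v list \<Rightarrow> ('v + 'e) sexp" where "ents vs \<equiv> slist (map ent vs)"

lemma ent_simps [simp]: "is_cons (ent v)" "scar (ent v) = SAtom (Inl v)" "scdr (ent v) = atoms (ul v)"
  "ent v \<noteq> SNil"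
  by (simp_all add: ent_def)

lemma length_ul: "v \<in> V \<Longrightarrow> length (ul v) = card (U v)"
  using ul distinct_card by metis

lemma length_ul_le: "v \<in> V \<Longrightarrow> length (ul v) \<le> 3"
  using length_ul card_U by fastforce

lemma is_cons_cddr [simp]: "v \<in> V \<Longrightarrow> is_cons (scdr (scdr (atoms (ul v)))) \<longleftrightarrow> card (U v) = 3"
proof -
  assume v: "v \<in> V"
  have *: "is_cons (scdr (scdr (atoms xs))) \<longleftrightarrow> length xs > 2" for xs :: "'e list"
  proof (cases xs)
    case (Cons a ys)
    then show ?thesis by (cases ys; cases "tl ys") auto
  qed simp
  show ?thesis using card_U[OF v] unfolding *[of "ul v"] length_ul[OF v] by (elim disjE) simp_all
qed

lemma call_disj_U:
  fixes Q :: "('v + 'e) sexp \<Rightarrow> nat \<Rightarrow> bool"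
  assumes "u \<in> V" "v \<in> V"
    and "\<And>r n. r = sbool (U u \<inter> U v = {}) \<Longrightarrow> n \<le> 440 \<Longrightarrow> Q r n"
  shows "call prog DISJ [atoms (ul u), atoms (ul v)] Q"
proof (rule call_disj)
  fix r :: "('v + 'e) sexp" and n
  assume r: "r = sbool (set (ul u) \<inter> set (ul v) = {})"
    and n: "n \<le> (length (ul u) + 1) * (20 * length (ul v) + 50)"
  \<comment> \<open>Both lists have at most three elements, which gives
    \<open>(3 + 1) * (20 * 3 + 50)\<close>.\<close>
  have "(length (ul u) + 1) * (20 * length (ul v) + 50) \<le> 4 * 110"
    by (rule mult_le_mono) (use length_ul_le assms(1,2) in fastforce)+
  then show "Q r n" using assms(3) r n ul assms(1,2) by simp
qed

lemma call_alldisj: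
  "v \<in> V \<Longrightarrow> set T \<subseteq> V \<Longrightarrow>
   (\<And>r n. r = sbool (\<forall>s\<in>set T. U v \<inter> U s = {}) \<Longrightarrow> n \<le> 500 * (length T + 1) \<Longrightarrow> Q r n) \<Longrightarrow>
   call prog ALLDISJ [ent v, ents T] Q"
proof (induction T arbitrary: Q)
  case Nil
  show ?case by (subst call_prog) (auto simp: alldisj_body_def wp_simps intro!: Nil)
next
  case (Cons t T)
  show ?case using Cons.prems(1,2)
    by (subst call_prog) (auto simp: alldisj_body_def wp_simps intro!: Cons.prems(3) Cons.IH call_disj_U)
qed

lemma call_filt:
  "set A \<subseteq> V \<Longrightarrow> set T \<subseteq> V \<Longrightarrow> 500 * (length T + 1) \<le> c \<Longrightarrow>
   (\<And>r n. r = ents (filter (\<lambda>v. \<forall>s\<in>set T. U v \<inter> U s = {}) A) \<Longrightarrow> n \<le> (length A + 1) * (c + 50) \<Longrightarrow> Q r n) \<Longrightarrow>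
   call prog FILT [ents A, ents T] Q"
proof (induction A arbitrary: Q)
  case Nil
  show ?case by (subst call_prog) (auto simp: filt_body_def wp_simps intro!: Nil)
next
  case (Cons v A)
  show ?case using Cons.prems(1-3)
    by (subst call_prog) (auto simp: filt_body_def wp_simps intro!: Cons.prems(4) Cons.IH call_alldisj)
qed

text \<open>A model on lists of the program function. Each nontrivial function gets one, which
  separates its cost and encoding from the mathematics.\<close>

definition pushl :: "'v list \<Rightarrow> 'v list \<Rightarrow> 'v list" where
  "pushl T A = T @ filter (\<lambda>v. \<forall>s\<in>set T. U v \<inter> U s = {}) A"

lemma set_pushl: "set (pushl T A) = push (set T) (set A)"
  by (auto simp: pushl_def push_def)

lemma set_pushl_subset: "set T \<subseteq> V \<Longrightarrow> set A \<subseteq> V \<Longrightarrow> set (pushl T A) \<subseteq> V"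
  by (auto simp: pushl_def)

lemma call_push:
  assumes "set A \<subseteq> V" "set T \<subseteq> V" "500 * (length T + 1) \<le> c"
    and "\<And>r n. r = ents (pushl T A) \<Longrightarrow> n \<le> (length A + 1) * (c + 50) + c + 50 \<Longrightarrow> Q r n"
  shows "call prog PUSH [ents T, ents A] Q"
  using assms(1-3)
  by (subst call_prog)
    (auto simp: push_body_def wp_simps pushl_def intro!: assms(4) call_app call_filt[where c = c])

definition ext1l :: "'v \<Rightarrow> 'v list list \<Rightarrow> 'v list list" where
  "ext1l v Ts = map ((#) v) (filter (\<lambda>T. \<forall>s\<in>set T. U v \<inter> U s = {}) Ts)"

lemma call_ext1:
  "v \<in> V \<Longrightarrow> (\<And>T. T \<in> set Ts \<Longrightarrow> set T \<subseteq> V \<and> length T \<le> 3) \<Longrightarrow>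
   (\<And>r n. r = slist (map ents (ext1l v Ts)) \<Longrightarrow> n \<le> 2100 * (length Ts + 1) \<Longrightarrow> Q r n) \<Longrightarrow>
   call prog EXT1 [ent v, slist (map ents Ts)] Q"
proof (induction Ts arbitrary: Q)
  case Nil
  show ?case by (subst call_prog) (auto simp: ext1_body_def ext1l_def wp_simps intro!: Nil)
next
  case (Cons T Ts)
  have T: "set T \<subseteq> V" "length T \<le> 3" using Cons.prems(2)[of T] by auto
  have IH: "call prog EXT1 [ent v, slist (map ents Ts)] Q"
    if "\<And>r n. r = slist (map ents (ext1l v Ts)) \<Longrightarrow> n \<le> 2100 * (length Ts + 1) \<Longrightarrow> Q r n" for Q
    using Cons.prems that by (intro Cons.IH) auto
  show ?case using Cons.prems(1) T
    by (subst call_prog)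
      (auto simp: ext1_body_def ext1l_def wp_simps intro!: Cons.prems(3) IH call_alldisj)
qed

definition extl :: "'v list \<Rightarrow> 'v list list \<Rightarrow> 'v list list" where
  "extl vs Ts = concat (map (\<lambda>v. ext1l v Ts) vs)"

lemma length_ext1l: "length (ext1l v Ts) \<le> length Ts"
  by (simp add: ext1l_def)

lemma call_ext:
  "set vs \<subseteq> V \<Longrightarrow> (\<And>T. T \<in> set Ts \<Longrightarrow> set T \<subseteq> V \<and> length T \<le> 3) \<Longrightarrow> 2200 * (length Ts + 1) \<le> c \<Longrightarrow>
   (\<And>r n. r = slist (map ents (extl vs Ts)) \<Longrightarrow> n \<le> (length vs + 1) * (c + 50) \<Longrightarrow> Q r n) \<Longrightarrow>
   call prog EXT [ents vs, slist (map ents Ts)] Q"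
proof (induction vs arbitrary: Q)
  case Nil
  show ?case by (subst call_prog) (auto simp: ext_body_def extl_def wp_simps intro!: Nil)
next
  case (Cons v vs)
  have IH: "call prog EXT [ents vs, slist (map ents Ts)] Q"
    if "\<And>r n. r = slist (map ents (extl vs Ts)) \<Longrightarrow> n \<le> (length vs + 1) * (c + 50) \<Longrightarrow> Q r n" for Q
    using Cons.prems that by (intro Cons.IH) auto
  have v: "v \<in> V" using Cons.prems(1) by simp
  note l = length_ext1l[of v Ts]
  show ?case
    by (subst call_prog)
      (use v Cons.prems(2,3) l in
        \<open>auto simp: ext_body_def wp_simps intro!: Cons.prems(4) IH call_ext1 call_app\<close>,
        simp_all add: extl_def)
qed

lemma set_extl:
  "L \<in> set (extl vs Ts) \<longleftrightarrow> (\<exists>v T. L = v # T \<and> v \<in> set vs \<and> T \<in> set Ts \<and> (\<forall>s\<in>set T. U v \<inter> U s = {}))"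
  by (auto simp: extl_def ext1l_def)

lemma length_extl: "length (extl vs Ts) \<le> length vs * length Ts"
proof (induction vs)
  case (Cons v vs)
  then show ?case using length_ext1l[of v Ts] by (simp add: extl_def)
qed (simp add: extl_def)

text \<open>A set occurs in every order of its elements, which costs only a constant factor. That
  three talons suffice is shown in \<open>claw_in_candsl\<close>.\<close>

definition candsl :: "'v list \<Rightarrow> 'v list list" where
  "candsl vs = extl vs [[]] @ extl vs (extl vs [[]]) @ extl vs (extl vs (extl vs [[]]))"

lemma call_cands:
  assumes vs: "set vs \<subseteq> V" and c: "2200 * (length vs * length vs + length vs + 2) \<le> c"
    and Q: "\<And>r n. r = slist (map ents (candsl vs)) \<Longrightarrow> n \<le> 20 * ((length vs + 1) * (c + 50) + c + 50) \<Longrightarrow> Q r n"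
  shows "call prog CANDS [ents vs] Q"
proof -
  let ?l1 = "extl vs [[]]" and ?l2 = "extl vs (extl vs [[]])" and ?n = "length vs"
  have len: "length ?l1 \<le> ?n" "length ?l2 \<le> ?n * ?n"
    using length_extl[of vs "[[]]"] length_extl[of vs ?l1] by (auto intro: order_trans)
  have 0: "call prog EXT [ents vs, SCons SNil SNil] Q"
    if "\<And>r n. r = slist (map ents ?l1) \<Longrightarrow> n \<le> (?n + 1) * (c + 50) \<Longrightarrow> Q r n" for Q
    using call_ext[of vs "[[]]" c Q] vs c that by simp
  have 1: "call prog EXT [ents vs, slist (map ents ?l1)] Q"
    if "\<And>r n. r = slist (map ents ?l2) \<Longrightarrow> n \<le> (?n + 1) * (c + 50) \<Longrightarrow> Q r n" for Q
  proof (rule call_ext[OF vs _ _ that])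
    show "2200 * (length ?l1 + 1) \<le> c" using c len by simp
  qed (use vs in \<open>auto simp: set_extl\<close>)
  have 2: "call prog EXT [ents vs, slist (map ents ?l2)] Q"
    if "\<And>r n. r = slist (map ents (extl vs ?l2)) \<Longrightarrow> n \<le> (?n + 1) * (c + 50) \<Longrightarrow> Q r n" for Q
  proof (rule call_ext[OF vs _ _ that])
    show "2200 * (length ?l2 + 1) \<le> c" using c len by simp
  qed (use vs in \<open>auto simp: set_extl\<close>)
  \<comment> \<open>A name for the product keeps the cost arithmetic linear.\<close>
  define d where "d = (?n + 1) * (c + 50)"
  have cc: "20 * (length ?l1 + 1) \<le> c" "20 * (length ?l2 + 1) \<le> c" using c len by simp_all
  show ?thesis
    by (subst call_prog)
      (use cc in \<open>auto simp: cands_body_def Let_def wp_simps candsl_def simp flip: d_def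
        intro!: Q[folded d_def] 0[folded d_def] 1[folded d_def] 2[folded d_def] call_app\<close>)
qed

lemma call_adjall:
  "v \<in> V \<Longrightarrow> set T \<subseteq> V \<Longrightarrow>
   (\<And>r n. r = sbool (\<forall>t\<in>set T. t \<noteq> v \<and> U t \<inter> U v \<noteq> {}) \<Longrightarrow> n \<le> 500 * (length T + 1) \<Longrightarrow> Q r n) \<Longrightarrow>
   call prog ADJALL [ent v, ents T] Q"
proof (induction T arbitrary: Q)
  case Nil
  show ?case by (subst call_prog) (auto simp: adjall_body_def wp_simps intro!: Nil)
next
  case (Cons t T)
  show ?case using Cons.prems(1,2)
    by (subst call_prog)
      (auto simp: adjall_body_def wp_simps Int_commute intro!: Cons.prems(3) Cons.IH call_disj_U)
qed

lemma call_center: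
  "set vs \<subseteq> V \<Longrightarrow> set T \<subseteq> V \<Longrightarrow> length T \<le> 3 \<Longrightarrow>
   (\<And>r n. r = sbool (\<exists>v\<in>set vs. \<forall>t\<in>set T. t \<noteq> v \<and> U t \<inter> U v \<noteq> {}) \<Longrightarrow> n \<le> 2100 * (length vs + 1) \<Longrightarrow> Q r n) \<Longrightarrow>
   call prog CENTER [ents vs, ents T] Q"
proof (induction vs arbitrary: Q)
  case Nil
  show ?case by (subst call_prog) (auto simp: center_body_def wp_simps intro!: Nil)
next
  case (Cons v vs)
  have IH: "call prog CENTER [ents vs, ents T] Q"
    if "\<And>r n. r = sbool (\<exists>v\<in>set vs. \<forall>t\<in>set T. t \<noteq> v \<and> U t \<inter> U v \<noteq> {}) \<Longrightarrow> n \<le> 2100 * (length vs + 1) \<Longrightarrow> Q r n" for Q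
    by (rule Cons.IH) (use Cons.prems(1-3) that in simp_all)
  have v: "v \<in> V" "set T \<subseteq> V" "length T \<le> 3" using Cons.prems(1-3) by auto
  show ?case
  proof (cases "\<forall>t\<in>set T. t \<noteq> v \<and> U t \<inter> U v \<noteq> {}")
    case True
    then have "(\<exists>v\<in>set (v # vs). \<forall>t\<in>set T. t \<noteq> v \<and> U t \<inter> U v \<noteq> {}) \<longleftrightarrow> True" by auto
    note prem = Cons.prems(4)[unfolded this]
    show ?thesis
      by (subst call_prog, simp add: center_body_def wp_simps, rule call_adjall[OF v(1,2)])
        (use v(3) True in \<open>auto intro!: prem\<close>)
  next
    case False
    then have "(\<exists>v\<in>set (v # vs). \<forall>t\<in>set T. t \<noteq> v \<and> U t \<inter> U v \<noteq> {}) \<longleftrightarrow>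
        (\<exists>v\<in>set vs. \<forall>t\<in>set T. t \<noteq> v \<and> U t \<inter> U v \<noteq> {})" by auto
    note prem = Cons.prems(4)[unfolded this]
    show ?thesis
      by (subst call_prog, simp add: center_body_def wp_simps, rule call_adjall[OF v(1,2)])
        (use v(3) False in \<open>auto intro!: IH prem\<close>)
  qed
qed

definition phil :: "'v list \<Rightarrow> nat" where "phil A = sum_list (map (\<lambda>v. (card (U v))\<^sup>2) A)"

lemma phil_eq: "distinct A \<Longrightarrow> phil A = Phi (set A)"
  unfolding phil_def Phi_def by (simp add: sum_list_distinct_conv_sum_set)

lemma phil_le: "set A \<subseteq> V \<Longrightarrow> phil A \<le> 9 * length A"
proof (induction A)
  case (Cons v A)
  have "card (U v) = 2 \<or> card (U v) = 3" using Cons.prems card_U by simp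
  then have "(card (U v))\<^sup>2 \<le> 9" by auto
  then show ?case using Cons by (simp add: phil_def)
qed (simp add: phil_def)

lemma call_phi:
  "set A \<subseteq> V \<Longrightarrow>
   (\<And>r n. r = slist (replicate (phil A) SNil) \<Longrightarrow> n \<le> 50 * (length A + 1) \<Longrightarrow> Q r n) \<Longrightarrow>
   call prog PHI [ents A] Q"
proof (induction A arbitrary: Q)
  case Nil
  show ?case by (subst call_prog) (auto simp: phi_body_def phil_def wp_simps intro!: Nil)
next
  case (Cons v A)
  have v: "v \<in> V" "set A \<subseteq> V" using Cons.prems by auto
  have expand: "(f ^^ 9) x = f (f (f (f (f (f (f (f (f x))))))))" "(f ^^ 4) x = f (f (f (f x)))" for f x
    by (simp_all add: eval_nat_numeral)
  have r: "slist (replicate (9 + k) x) = (SCons x ^^ 9) (slist (replicate k x))"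
    "slist (replicate (4 + k) x) = (SCons x ^^ 4) (slist (replicate k x))" for k x
    by (simp_all add: eval_nat_numeral)
  show ?case
  proof (cases "card (U v) = 3")
    case True
    then have "phil (v # A) = 9 + phil A" by (simp add: phil_def)
    note prem = Cons.prems(2)[unfolded this r, unfolded expand]
    show ?thesis using v True
      by (subst call_prog) (auto simp: phi_body_def wp_simps expand intro!: prem Cons.IH)
  next
    case False
    then have "card (U v) = 2" using card_U v by blast
    then have "phil (v # A) = 4 + phil A" by (simp add: phil_def)
    note prem = Cons.prems(2)[unfolded this r, unfolded expand]
    show ?thesis using v False
      by (subst call_prog) (auto simp: phi_body_def wp_simps expand intro!: prem Cons.IH)
  qed
qed

lemma call_less:
  "(\<And>r n. r = sbool (a < b) \<Longrightarrow> n \<le> 20 * (b + 1) \<Longrightarrow> Q r n) \<Longrightarrow>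
   call prog LESS [slist (replicate a SNil), slist (replicate b SNil)] Q"
proof (induction b arbitrary: a Q)
  case 0
  show ?case by (subst call_prog) (auto simp: less_body_def wp_simps intro!: 0)
next
  case (Suc b)
  show ?case
  proof (cases a)
    case 0
    show ?thesis using 0 by (subst call_prog) (auto simp: less_body_def wp_simps intro!: Suc.prems)
  next
    case (Suc a')
    then show ?thesis
      by (subst call_prog) (auto simp: less_body_def wp_simps intro!: Suc.prems Suc.IH)
  qed
qed

definition goodl :: "'v list \<Rightarrow> 'v list \<Rightarrow> 'v list \<Rightarrow> bool" where
  "goodl vs A T \<longleftrightarrow>
     (length T = 1 \<or> (\<exists>v\<in>set vs. \<forall>t\<in>set T. t \<noteq> v \<and> U t \<inter> U v \<noteq> {})) \<and> phil A < phil (pushl T A)"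

lemma call_good:
  assumes vs: "set vs \<subseteq> V" and A: "set A \<subseteq> V" "length A \<le> length vs"
    and T: "set T \<subseteq> V" "length T \<le> 3" "T \<noteq> []"
    and Q: "\<And>r n. r = sbool (goodl vs A T) \<Longrightarrow> n \<le> 10000 * (length vs + 1) \<Longrightarrow> Q r n"
  shows "call prog GOOD [ents vs, ents A, ents T] Q"
proof -
  have "length (pushl T A) \<le> length T + length A" by (simp add: pushl_def)
  then have l: "length (pushl T A) \<le> 3 + length vs" using T A by linarith
  have p: "set (pushl T A) \<subseteq> V" using set_pushl_subset T(1) A(1) by blast
  have "phil (pushl T A) \<le> 9 * length (pushl T A)" by (rule phil_le[OF p])
  then have b: "phil (pushl T A) \<le> 27 + 9 * length vs" using l by linarith
  have push: "call prog PUSH [ents T, ents A] Q"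
    if "\<And>r n. r = ents (pushl T A) \<Longrightarrow> n \<le> 2050 * length vs + 4100 \<Longrightarrow> Q r n" for Q
    by (rule call_push[OF A(1) T(1), of 2000]) (use T A that in auto)
  have compare: "call prog LESS [slist (replicate (phil A) SNil), slist (replicate (phil (pushl T A)) SNil)] Q"
    if "\<And>r n. r = sbool (phil A < phil (pushl T A)) \<Longrightarrow> n \<le> 560 + 180 * length vs \<Longrightarrow> Q r n" for Q
    by (rule call_less) (use that b in auto)
  show ?thesis
  proof (cases "length T = 1")
    case True
    then have "scdr (ents T) = SNil" by (auto simp: length_Suc_conv)
    then show ?thesis
      by (subst call_prog)
        (use l A True in \<open>auto simp: good_body_def wp_simps goodl_def
          intro!: Q call_phi[OF A(1)] call_phi[OF p] push compare\<close>)
  next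
    case False
    define ce where "ce \<longleftrightarrow> (\<exists>v\<in>set vs. \<forall>t\<in>set T. t \<noteq> v \<and> U t \<inter> U v \<noteq> {})"
    from False have "scdr (ents T) \<noteq> SNil" "is_cons (scdr (ents T))" using T(3) by (cases T; cases "tl T"; auto)+
    then show ?thesis
      by (subst call_prog)
        (use l A T False in \<open>auto simp: good_body_def wp_simps goodl_def simp flip: ce_def
          intro!: Q call_center[OF vs T(1,2), folded ce_def] call_phi[OF A(1)] call_phi[OF p] push compare\<close>)
  qed
qed

text \<open>\<open>None\<close> and \<open>Some []\<close> share an encoding, so the search is only
  applied to nonempty candidates.\<close>

definition eo :: "'v list option \<Rightarrow> ('v + 'e) sexp" where
  "eo r = (case r of None \<Rightarrow> SNil | Some T \<Rightarrow> ents T)"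

lemma call_find:
  "set vs \<subseteq> V \<Longrightarrow> set A \<subseteq> V \<Longrightarrow> length A \<le> length vs \<Longrightarrow> 10000 * (length vs + 1) \<le> c \<Longrightarrow>
   (\<And>T. T \<in> set Ts \<Longrightarrow> set T \<subseteq> V \<and> length T \<le> 3 \<and> T \<noteq> []) \<Longrightarrow>
   (\<And>r n. r = eo (find (goodl vs A) Ts) \<Longrightarrow> n \<le> (c + 50) * (length Ts + 1) \<Longrightarrow> Q r n) \<Longrightarrow>
   call prog FIND [ents vs, ents A, slist (map ents Ts)] Q"
proof (induction Ts arbitrary: Q)
  case Nil
  show ?case by (subst call_prog) (auto simp: find_body_def eo_def wp_simps intro!: Nil)
next
  case (Cons T Ts)
  have IH: "call prog FIND [ents vs, ents A, slist (map ents Ts)] Q"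
    if "\<And>r n. r = eo (find (goodl vs A) Ts) \<Longrightarrow> n \<le> (c + 50) * (length Ts + 1) \<Longrightarrow> Q r n" for Q
    by (rule Cons.IH) (use Cons.prems(1-5) that in auto)
  have T: "set T \<subseteq> V" "length T \<le> 3" "T \<noteq> []" using Cons.prems(5)[of T] by auto
  show ?case
    by (subst call_prog, simp add: find_body_def wp_simps, rule call_good[OF Cons.prems(1-3) T])
      (use Cons.prems(4) in \<open>auto simp: algebra_simps intro!: IH Cons.prems(6)\<close>, simp_all add: eo_def)
qed

abbreviation idl :: "'v list \<Rightarrow> ('v + 'e) sexp" where "idl A \<equiv> slist (map (\<lambda>v. SAtom (Inl v)) A)"

lemma call_ids:
  "(\<And>r n. r = idl A \<Longrightarrow> n \<le> 20 * (length A + 1) \<Longrightarrow> Q r n) \<Longrightarrow> call prog IDS [ents A] Q"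
proof (induction A arbitrary: Q)
  case Nil
  show ?case by (subst call_prog) (auto simp: ids_body_def wp_simps intro!: Nil)
next
  case (Cons v A)
  show ?case by (subst call_prog) (auto simp: ids_body_def wp_simps intro!: Cons.prems Cons.IH)
qed

lemma call_strip:
  "(\<And>A. A \<in> set As \<Longrightarrow> length A \<le> k) \<Longrightarrow> 20 * (k + 1) \<le> c \<Longrightarrow>
   (\<And>r n. r = slist (map idl As) \<Longrightarrow> n \<le> (c + 50) * (length As + 1) \<Longrightarrow> Q r n) \<Longrightarrow>
   call prog STRIP [slist (map ents As)] Q"
proof (induction As arbitrary: Q)
  case Nil
  show ?case by (subst call_prog) (auto simp: strip_body_def wp_simps intro!: Nil)
next
  case (Cons A As)
  have A: "length A \<le> k" using Cons.prems(1)[of A] by simp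
  have IH: "call prog (Suc 0) [slist (map ents As)] Q"
    if "\<And>r n. r = slist (map idl As) \<Longrightarrow> n \<le> (c + 50) * (length As + 1) \<Longrightarrow> Q r n" for Q
    by (rule Cons.IH[unfolded One_nat_def]) (use Cons.prems(1,2) that in auto)
  show ?case
    by (subst call_prog)
      (use A Cons.prems(2) in \<open>auto simp: strip_body_def wp_simps intro!: Cons.prems(3) IH call_ids\<close>)
qed

lemma call_trips:
  "set A \<subseteq> V \<Longrightarrow>
   (\<And>r n. r = ents (filter (\<lambda>v. card (U v) = 3) A) \<Longrightarrow> n \<le> 50 * (length A + 1) \<Longrightarrow> Q r n) \<Longrightarrow>
   call prog TRIPS [ents A] Q"
proof (induction A arbitrary: Q)
  case Nil
  show ?case by (subst call_prog) (auto simp: trips_body_def wp_simps intro!: Nil)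
next
  case (Cons v A)
  show ?case using Cons.prems(1)
    by (subst call_prog) (auto simp: trips_body_def wp_simps intro!: Cons.prems(2) Cons.IH)
qed

definition pairsl :: "'v list \<Rightarrow> 'v list \<Rightarrow> 'v list" where
  "pairsl vs T = filter (\<lambda>v. card (U v) = 2 \<and> (\<forall>s\<in>set T. U v \<inter> U s = {})) vs"

lemma call_pairs:
  "set vs \<subseteq> V \<Longrightarrow> set T \<subseteq> V \<Longrightarrow> 500 * (length T + 1) \<le> c \<Longrightarrow>
   (\<And>r n. r = ents (pairsl vs T) \<Longrightarrow> n \<le> (length vs + 1) * (c + 80) \<Longrightarrow> Q r n) \<Longrightarrow>
   call prog PAIRS [ents vs, ents T] Q"
proof (induction vs arbitrary: Q)
  case Nil
  show ?case by (subst call_prog) (auto simp: pairs_body_def pairsl_def wp_simps intro!: Nil)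
next
  case (Cons v vs)
  have v: "v \<in> V" using Cons.prems by simp
  show ?case
  proof (cases "card (U v) = 3")
    case True
    then show ?thesis using Cons.prems(1-3)
      by (subst call_prog)
        (auto simp: pairs_body_def pairsl_def wp_simps intro!: Cons.prems(4) Cons.IH[unfolded pairsl_def])
  next
    case False
    then have "card (U v) = 2" using card_U[OF v] by simp
    then show ?thesis using Cons.prems(1-3)
      by (subst call_prog)
        (auto simp: pairs_body_def pairsl_def wp_simps
          intro!: Cons.prems(4) Cons.IH[unfolded pairsl_def] call_alldisj)
  qed
qed

end

definition encp :: "'e \<times> 'e \<Rightarrow> ('v + 'e) sexp" where "encp e = SCons (el (fst e)) (el (snd e))"

abbreviation ence :: "('e \<times> 'e) list \<Rightarrow> ('v + 'e) sexp" where "ence es \<equiv> slist (map encp es)"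

lemma encp_pair: "encp (x, y) = SCons (el x) (el y)"
  by (simp add: encp_def)

lemma encp_simps [simp]: "scar (encp e) = el (fst e)" "scdr (encp e) = el (snd e)" "is_cons (encp e)"
  "encp e \<noteq> SNil"
  by (simp_all add: encp_def)

context encoded_collection
begin

definition edgesl :: "'v list \<Rightarrow> ('e \<times> 'e) list" where
  "edgesl K = concat (map (\<lambda>v. [(ul v ! 0, ul v ! 1), (ul v ! 1, ul v ! 0)]) K)"

lemma ul_pair:
  assumes "v \<in> V" "card (U v) = 2"
  obtains x y where "ul v = [x, y]" "x \<noteq> y" "U v = {x, y}"
proof -
  have "length (ul v) = 2" using length_ul[OF assms(1)] assms(2) by simp
  then obtain x y where l: "ul v = [x, y]" by (auto simp: numeral_2_eq_2 length_Suc_conv)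
  then show ?thesis using that ul[OF assms(1)] by auto
qed

lemma call_edges:
  "set K \<subseteq> V \<Longrightarrow> (\<And>v. v \<in> set K \<Longrightarrow> card (U v) = 2) \<Longrightarrow>
   (\<And>r n. r = ence (edgesl K @ es) \<Longrightarrow> n \<le> 50 * (length K + 1) \<Longrightarrow> Q r n) \<Longrightarrow>
   call prog EDGES [ents K, ence es] Q"
proof (induction K arbitrary: Q)
  case Nil
  show ?case by (subst call_prog) (auto simp: edges_body_def edgesl_def Let_def wp_simps intro!: Nil)
next
  case (Cons v K)
  have v: "v \<in> V" "card (U v) = 2" using Cons.prems(1,2) by auto
  obtain x y where xy: "ul v = [x, y]" using ul_pair[OF v] by metis
  have IH: "call prog EDGES [ents K, ence es] Q"
    if "\<And>r n. r = ence (edgesl K @ es) \<Longrightarrow> n \<le> 50 * (length K + 1) \<Longrightarrow> Q r n" for Q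
    by (rule Cons.IH) (use Cons.prems(1,2) that in auto)
  show ?case
    by (subst call_prog)
      (auto simp: edges_body_def Let_def wp_simps xy intro!: Cons.prems(3) IH,
       simp_all add: edgesl_def xy encp_pair)
qed

end

section \<open>Decision of maximality\<close>

abbreviation paths :: "'e list list \<Rightarrow> ('v + 'e) sexp" where "paths F \<equiv> slist (map atoms F)"

lemma call_assoc:
  fixes es :: "('v + 'e) sexp list"
  shows "(\<And>r n. r = (case find (\<lambda>e. scar e = el x) es of None \<Rightarrow> SNil | Some e \<Rightarrow> e) \<Longrightarrow>
     n \<le> 20 * (length es + 1) \<Longrightarrow> Q r n) \<Longrightarrow>
   call prog ASSOC [el x, slist es] Q"
proof (induction es arbitrary: Q)
  case Nil
  show ?case by (subst call_prog) (auto simp: assoc_body_def wp_simps intro!: Nil)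
next
  case (Cons e es)
  show ?case
  proof (cases "scar e = el x")
    case True
    then show ?thesis
      by (subst call_prog) (auto simp: assoc_body_def wp_simps intro!: Cons.prems)
  next
    case False
    then have "el x \<noteq> scar e" by metis
    then show ?thesis using False
      by (subst call_prog) (auto simp: assoc_body_def wp_simps intro!: Cons.prems Cons.IH)
  qed
qed

definition lookF :: "'e list list \<Rightarrow> 'e \<Rightarrow> 'e list option" where
  "lookF F x = find (\<lambda>w. hd w = x) F"

definition lookM :: "('e \<times> 'e) list \<Rightarrow> 'e \<Rightarrow> ('e \<times> 'e) option" where
  "lookM M x = find (\<lambda>e. fst e = x) M"

lemma lookF_Some: "lookF F x = Some w \<Longrightarrow> w \<in> set F \<and> hd w = x"
  unfolding lookF_def by (auto simp: find_Some_iff)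

lemma lookF_None: "lookF F x = None \<longleftrightarrow> x \<notin> hd ` set F"
  unfolding lookF_def by (auto simp: find_None_iff)

lemma lookM_Some: "lookM M x = Some e \<Longrightarrow> (x, snd e) \<in> set M"
  unfolding lookM_def by (auto simp: find_Some_iff)

lemma lookM_None: "lookM M x = None \<longleftrightarrow> x \<notin> fst ` set M"
  unfolding lookM_def find_None_iff by force

definition po :: "'e list option \<Rightarrow> ('v + 'e) sexp" where
  "po r = (case r of None \<Rightarrow> SNil | Some w \<Rightarrow> atoms w)"

lemma po_simps [simp]: "po None = SNil" "po (Some w) = atoms w"
  by (simp_all add: po_def)

lemma call_assocF:
  assumes "\<And>w. w \<in> set F \<Longrightarrow> w \<noteq> []"
    and "\<And>r n. r = po (lookF F x) \<Longrightarrow> n \<le> 20 * (length F + 1) \<Longrightarrow> Q r n"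
  shows "call prog ASSOC [el x, paths F] (Q :: ('v + 'e) sexp \<Rightarrow> nat \<Rightarrow> bool)"
proof (rule call_assoc)
  have "(case find (\<lambda>e. scar e = el x) (map atoms F) of None \<Rightarrow> SNil | Some e \<Rightarrow> e) = (po (lookF F x) :: ('v + 'e) sexp)"
    using assms(1)
  proof (induction F)
    case (Cons w F)
    have "w \<noteq> []" using Cons.prems by simp
    then have "scar (atoms w :: ('v + 'e) sexp) = el (hd w)" by (cases w) auto
    then show ?case using Cons by (simp add: lookF_def)
  qed (simp add: lookF_def)
  then show "Q r n" if "r = (case find (\<lambda>e. scar e = el x) (map atoms F) of None \<Rightarrow> SNil | Some e \<Rightarrow> e)"
    "n \<le> 20 * (length (map atoms F :: ('v + 'e) sexp list) + 1)" for r n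
    using assms(2) that by simp
qed

definition mo :: "('e \<times> 'e) option \<Rightarrow> ('v + 'e) sexp" where
  "mo r = (case r of None \<Rightarrow> SNil | Some e \<Rightarrow> encp e)"

lemma mo_simps [simp]: "mo None = SNil" "mo (Some e) = encp e"
  by (simp_all add: mo_def)

lemma call_assocM:
  assumes "\<And>r n. r = mo (lookM M x) \<Longrightarrow> n \<le> 20 * (length M + 1) \<Longrightarrow> Q r n"
  shows "call prog ASSOC [el x, ence M] (Q :: ('v + 'e) sexp \<Rightarrow> nat \<Rightarrow> bool)"
proof (rule call_assoc)
  have "(case find (\<lambda>e. scar e = el x) (map encp M) of None \<Rightarrow> SNil | Some e \<Rightarrow> e) = (mo (lookM M x) :: ('v + 'e) sexp)"
    by (induction M) (simp_all add: lookM_def)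
  then show "Q r n" if "r = (case find (\<lambda>e. scar e = el x) (map encp M) of None \<Rightarrow> SNil | Some e \<Rightarrow> e)"
    "n \<le> 20 * (length (map encp M :: ('v + 'e) sexp list) + 1)" for r n
    using assms that by simp
qed

section \<open>Growing the forest on edge lists\<close>

fun growl :: "('e \<times> 'e) list \<Rightarrow> ('e \<times> 'e) list \<Rightarrow> 'e list list \<Rightarrow> 'e list option" where
  "growl [] M F = None"
| "growl ((x, y) # Es) M F =
    (case lookF F x of
       Some w \<Rightarrow>
         (case lookF F y of
            Some w' \<Rightarrow> growl Es M F
          | None \<Rightarrow>
             (case lookM M y of
                None \<Rightarrow> growl Es M F
              | Some e \<Rightarrow>
                 (case lookF F (snd e) of Some w' \<Rightarrow> growl Es M F | None \<Rightarrow> Some (snd e # y # w))))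
     | None \<Rightarrow> (case lookM M x of Some e \<Rightarrow> growl Es M F | None \<Rightarrow> Some [x]))"

lemma call_grow:
  fixes Q :: "('v + 'e) sexp \<Rightarrow> nat \<Rightarrow> bool"
  assumes F: "\<And>w. w \<in> set F \<Longrightarrow> w \<noteq> []" and c: "200 * (length F + length M + 1) \<le> c"
    and "\<And>r n. r = po (growl Es M F) \<Longrightarrow> n \<le> (length Es + 1) * (c + 100) \<Longrightarrow> Q r n"
  shows "call prog GROW [ence Es, ence M, paths F] Q"
  using assms(3)
proof (induction Es arbitrary: Q)
  case Nil
  show ?case by (subst call_prog) (auto simp: grow_body_def Let_def wp_simps intro!: Nil)
next
  case (Cons e Es)
  obtain x y where e: "e = (x, y)" by fastforce
  have ne: "w \<noteq> []" if "lookF F v = Some w" for v w using lookF_Some[OF that] F by blast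
  note rules = call_assocF[OF F] call_assocM
  show ?case
  proof (cases "lookF F x")
    case None
    show ?thesis using c None
      by (cases "lookM M x"; subst call_prog)
        (auto simp: grow_body_def Let_def wp_simps e intro!: Cons.prems Cons.IH rules)
  next
    case w: (Some w)
    show ?thesis
    proof (cases "lookF F y")
      case (Some w')
      then show ?thesis using c w ne[OF w] ne[OF Some]
        by (subst call_prog) (auto simp: grow_body_def Let_def wp_simps e intro!: Cons.prems Cons.IH rules)
    next
      case y: None
      show ?thesis
      proof (cases "lookM M y")
        case None
        then show ?thesis using c w ne[OF w] y
          by (subst call_prog) (auto simp: grow_body_def Let_def wp_simps e intro!: Cons.prems Cons.IH rules)
      next
        case m: (Some m)
        show ?thesis
        proof (cases "lookF F (snd m)")
          case None
          then show ?thesis using c w ne[OF w] y m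
            by (subst call_prog) (auto simp: grow_body_def Let_def wp_simps e intro!: Cons.prems Cons.IH rules)
        next
          case (Some w')
          then show ?thesis using c w ne[OF w] ne[OF Some] y m
            by (subst call_prog) (auto simp: grow_body_def Let_def wp_simps e intro!: Cons.prems Cons.IH rules)
        qed
      qed
    qed
  qed
qed

definition ed :: "('e \<times> 'e) list \<Rightarrow> 'e set set" where "ed es = {{x, y} | x y. (x, y) \<in> set es}"

text \<open>Edges are listed in both orientations, so a lookup by first component finds every
  neighbour. Repetitions are allowed, since contraction creates parallel edges.\<close>

definition valid :: "('e \<times> 'e) list \<Rightarrow> ('e \<times> 'e) list \<Rightarrow> bool" where
  "valid E M \<longleftrightarrow> (\<forall>(x, y) \<in> set E. (y, x) \<in> set E \<and> x \<noteq> y) \<and> (\<forall>(x, y) \<in> set M. (y, x) \<in> set M) \<and>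
     set M \<subseteq> set E \<and> matching (ed M)"

lemma validD:
  assumes "valid E M"
  shows "{x, y} \<in> ed E \<longleftrightarrow> (x, y) \<in> set E" "{x, y} \<in> ed M \<longleftrightarrow> (x, y) \<in> set M"
    "(x, y) \<in> set E \<Longrightarrow> x \<noteq> y" "matching (ed M)" "ed M \<subseteq> ed E" "set M \<subseteq> set E"
    "e \<in> ed E \<Longrightarrow> card e = 2"
proof -
  note v = assms[unfolded valid_def]
  show "{x, y} \<in> ed E \<longleftrightarrow> (x, y) \<in> set E" "{x, y} \<in> ed M \<longleftrightarrow> (x, y) \<in> set M"
    using v unfolding ed_def by (auto simp: doubleton_eq_iff)
  show "(x, y) \<in> set E \<Longrightarrow> x \<noteq> y" "e \<in> ed E \<Longrightarrow> card e = 2"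
    using v unfolding ed_def by auto
  show "matching (ed M)" "set M \<subseteq> set E" using v by blast+
  then show "ed M \<subseteq> ed E" unfolding ed_def by blast
qed

lemma Union_ed_sym:
  assumes "\<forall>(x, y) \<in> set es. (y, x) \<in> set es" shows "\<Union>(ed es) = fst ` set es"
proof (intro set_eqI iffI)
  fix v assume "v \<in> \<Union>(ed es)"
  then obtain x y where "(x, y) \<in> set es" "v \<in> {x, y}" unfolding ed_def by blast
  then have "\<exists>w. (v, w) \<in> set es" using assms by auto
  then show "v \<in> fst ` set es" by (auto intro: rev_image_eqI)
next
  fix v assume "v \<in> fst ` set es"
  then obtain w where "(v, w) \<in> set es" by auto
  then show "v \<in> \<Union>(ed es)" unfolding ed_def by blast
qed

lemma Union_ed:
  assumes "valid E M" shows "\<Union>(ed M) = fst ` set M" "\<Union>(ed E) = fst ` set E"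
proof -
  have sym: "\<forall>(x, y) \<in> set M. (y, x) \<in> set M" "\<forall>(x, y) \<in> set E. (y, x) \<in> set E"
    using assms unfolding valid_def by fast+
  show "\<Union>(ed M) = fst ` set M" "\<Union>(ed E) = fst ` set E"
    by (rule Union_ed_sym[OF sym(1)], rule Union_ed_sym[OF sym(2)])
qed

lemma finite_ed: "finite (ed es)"
proof -
  have "ed es = (\<lambda>(x, y). {x, y}) ` set es" unfolding ed_def by auto
  then show ?thesis by simp
qed

lemma growl_Some:
  assumes "growl Es M F = Some w"
  shows "(\<exists>x. w = [x] \<and> x \<in> fst ` set Es \<and> x \<notin> hd ` set F \<and> x \<notin> fst ` set M) \<or>
         (\<exists>y z w0. w = z # y # w0 \<and> w0 \<in> set F \<and> (hd w0, y) \<in> set Es \<and> y \<notin> hd ` set F \<and>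
            (y, z) \<in> set M \<and> z \<notin> hd ` set F)"
  using assms
proof (induction Es)
  case (Cons e Es)
  obtain x y where e: "e = (x, y)" by fastforce
  note prem = Cons.prems[unfolded e]
  show ?case
  proof (cases "growl Es M F = Some w")
    case True
    from Cons.IH[OF this] show ?thesis by (elim disjE exE) auto
  next
    case False
    show ?thesis
    proof (cases "lookF F x")
      case None
      then have "lookM M x = None" "w = [x]" using prem False by (auto split: option.splits)
      then show ?thesis using None e unfolding lookF_None lookM_None by auto
    next
      case (Some w0)
      then obtain m where m: "lookF F y = None" "lookM M y = Some m" "lookF F (snd m) = None" "w = snd m # y # w0"
        using prem False by (auto split: option.splits)
      then show ?thesis
        using lookF_Some[OF Some] lookM_Some[OF m(2)] e unfolding lookF_None by auto
    qed
  qed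
qed simp

text \<open>A failed search for a growth step supplies the conditions \<open>exposed\<close> and
  \<open>closed\<close> of \<open>forest_stable\<close>.\<close>

lemma growl_None:
  assumes "growl Es M F = None" "(x, y) \<in> set Es"
  shows "x \<notin> hd ` set F \<Longrightarrow> x \<in> fst ` set M"
    and "x \<in> hd ` set F \<Longrightarrow> y \<notin> hd ` set F \<Longrightarrow> lookM M y = Some m \<Longrightarrow> snd m \<in> hd ` set F"
proof -
  have "(x \<notin> hd ` set F \<longrightarrow> x \<in> fst ` set M) \<and>
    (x \<in> hd ` set F \<longrightarrow> y \<notin> hd ` set F \<longrightarrow> (\<forall>m. lookM M y = Some m \<longrightarrow> snd m \<in> hd ` set F))"
    using assms
  proof (induction Es)
    case (Cons e Es)
    obtain x' y' where e: "e = (x', y')" by fastforce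
    note prem = Cons.prems(1)[unfolded e]
    show ?case
    proof (cases "(x, y) \<in> set Es")
      case True
      have "growl Es M F = None" using prem by (auto split: option.splits)
      from Cons.IH[OF this True] show ?thesis .
    next
      case False
      then have xy: "x' = x" "y' = y" using Cons.prems(2) e by auto
      show ?thesis
      proof (cases "lookF F x")
        case None
        then have "lookM M x \<noteq> None" using prem xy by (auto split: option.splits)
        then show ?thesis using None unfolding lookF_None lookM_None by simp
      next
        case (Some w)
        then have "lookF F x \<noteq> None" by simp
        then have x: "x \<in> hd ` set F" unfolding lookF_None by simp
        have "lookF F (snd m) \<noteq> None" if "lookF F y = None" "lookM M y = Some m" for m
          using prem xy Some that by (auto split: option.splits)
        then show ?thesis using x unfolding lookF_None by blast
      qed
    qed
  qed simp
  then show "x \<notin> hd ` set F \<Longrightarrow> x \<in> fst ` set M"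
    and "x \<in> hd ` set F \<Longrightarrow> y \<notin> hd ` set F \<Longrightarrow> lookM M y = Some m \<Longrightarrow> snd m \<in> hd ` set F" by blast+
qed

lemma forest_heads_distinct: "forest E M F \<Longrightarrow> distinct (map hd F)"
  by (induction rule: forest.induct) auto

definition good_forest where
  "good_forest E M F \<longleftrightarrow> forest (ed E) (ed M) F \<and> hd ` set F \<subseteq> fst ` set E"

text \<open>The heads are distinct first components of edges; this bounds the number of growth
  steps.\<close>

lemma good_forest_length:
  assumes "good_forest E M F" shows "length F \<le> length E"
proof -
  have "length F = card (hd ` set F)"
    using forest_heads_distinct[of "ed E" "ed M" F] assms
    unfolding good_forest_def by (metis distinct_card length_map list.set_map)
  also have "\<dots> \<le> card (fst ` set E)"
    using assms unfolding good_forest_def by (intro card_mono) auto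
  also have "\<dots> \<le> length E" by (metis card_length length_map list.set_map)
  finally show ?thesis .
qed

lemma good_forest_path:
  assumes "good_forest E M F" "valid E M" "w \<in> set F"
  shows "w \<noteq> []" "distinct w" "length w \<le> length E"
proof -
  have F: "forest (ed E) (ed M) F" "hd ` set F \<subseteq> fst ` set E" using assms(1) unfolding good_forest_def by auto
  note ep = forest_even_path[OF F(1) validD(4)[OF assms(2)] assms(3)]
  show "w \<noteq> []" using ep by (auto elim: even_path.cases)
  show d: "distinct w" by (rule even_path_distinct[OF ep validD(4)[OF assms(2)]])
  have "set w \<subseteq> fst ` set E"
  proof
    fix v assume "v \<in> set w"
    from forest_vertex[OF F(1) assms(3) this] show "v \<in> fst ` set E"
    proof
      assume "\<exists>z\<in>hd ` set F. {v, z} \<in> ed M"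
      then have "v \<in> \<Union>(ed E)" using validD(5)[OF assms(2)] by blast
      then show ?thesis using Union_ed(2)[OF assms(2)] by simp
    qed (use F(2) in blast)
  qed
  then have "card (set w) \<le> card (fst ` set E)" by (intro card_mono) auto
  also have "\<dots> \<le> length E" by (metis card_length length_map list.set_map)
  finally show "length w \<le> length E" using distinct_card[OF d] by simp
qed

lemma good_forest_grow:
  assumes F: "good_forest E M F" and v: "valid E M" and w: "growl E M F = Some w"
  shows "good_forest E M (w # F)"
  using growl_Some[OF w]
proof (elim disjE exE conjE)
  fix x assume x: "w = [x]" "x \<in> fst ` set E" "x \<notin> hd ` set F" "x \<notin> fst ` set M"
  have "x \<notin> \<Union>(ed M)" using x(4) Union_ed(1)[OF v] by simp
  then show ?thesis using F x unfolding good_forest_def by (auto intro!: forest.root)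
next
  fix y z w0 assume h: "w = z # y # w0" "w0 \<in> set F" "(hd w0, y) \<in> set E" "y \<notin> hd ` set F"
    "(y, z) \<in> set M" "z \<notin> hd ` set F"
  have "{hd w0, y} \<in> ed E" "{y, z} \<in> ed M" using validD(1,2)[OF v] h by auto
  moreover have "z \<in> fst ` set E"
  proof -
    have "z \<in> \<Union>(ed M)" using \<open>{y, z} \<in> ed M\<close> by blast
    then have "z \<in> \<Union>(ed E)" using validD(5)[OF v] by blast
    then show ?thesis using Union_ed(2)[OF v] by simp
  qed
  ultimately show ?thesis using F h unfolding good_forest_def by (auto intro!: forest.grow)
qed

definition growB :: "nat \<Rightarrow> nat" where "growB N = (N + 1) * (200 * (2 * N + 1) + 100)"

text \<open>The measure \<open>length E - length F\<close> falls with every new path. It is genuine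
  because a good forest is never longer than the edge list.\<close>

lemma call_growloop:
  fixes Q :: "('v + 'e) sexp \<Rightarrow> nat \<Rightarrow> bool"
  assumes v: "valid E M" and N: "length E \<le> N" "length M \<le> N"
    and c: "growB N + 100 \<le> c"
    and "good_forest E M F"
    and "\<And>r n F'. r = paths F' \<Longrightarrow> good_forest E M F' \<Longrightarrow> growl E M F' = None \<Longrightarrow>
           n \<le> (length E - length F + 1) * c \<Longrightarrow> Q r n"
  shows "call prog GROWLOOP [ence E, ence M, paths F] Q"
  using assms(5-)
proof (induction "length E - length F" arbitrary: F Q rule: less_induct)
  case less
  note F = less.prems(1)
  have l: "length F \<le> length E" by (rule good_forest_length[OF F])
  have b: "(length E + 1) * (200 * (length F + length M + 1) + 100) \<le> growB N"
    unfolding growB_def by (rule mult_le_mono) (use N l in auto)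
  have grow: "call prog GROW [ence E, ence M, paths F] Q"
    if "\<And>r n. r = po (growl E M F) \<Longrightarrow> n \<le> growB N \<Longrightarrow> Q r n" for Q :: "('v + 'e) sexp \<Rightarrow> nat \<Rightarrow> bool"
    by (rule call_grow[where c = "200 * (length F + length M + 1)"])
      (use good_forest_path(1)[OF F v] that b in auto)
  show ?case
  proof (cases "growl E M F")
    case None
    have p2: "call prog GROWLOOP2 [ence E, ence M, paths F, SNil] Q'" if "Q' (paths F) 3" for Q' :: "('v + 'e) sexp \<Rightarrow> nat \<Rightarrow> bool"
      using that by (subst call_prog) (simp add: growloop2_body_def wp_simps numeral_eq_Suc)
    show ?thesis using None c
      by (subst call_prog)
        (auto simp: growloop_body_def wp_simps intro!: grow p2 less.prems(2)[OF _ F])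
  next
    case (Some w)
    note F' = good_forest_grow[OF F v Some]
    have l': "length F < length E" using good_forest_length[OF F'] by simp
    have ne: "atoms w \<noteq> (SNil :: ('v + 'e) sexp)" using good_forest_path(1)[OF F' v] by simp
    have IH: "call prog GROWLOOP [ence E, ence M, paths (w # F)] Q'"
      if "\<And>r n F'. r = paths F' \<Longrightarrow> good_forest E M F' \<Longrightarrow> growl E M F' = None \<Longrightarrow>
           n \<le> (length E - length (w # F) + 1) * c \<Longrightarrow> Q' r n" for Q' :: "('v + 'e) sexp \<Rightarrow> nat \<Rightarrow> bool"
      by (rule less.hyps[OF _ F' that]) (use l' in auto)
    have p2: "call prog GROWLOOP2 [ence E, ence M, paths F, atoms w] Q'"
      if "\<And>r n F'. r = paths F' \<Longrightarrow> good_forest E M F' \<Longrightarrow> growl E M F' = None \<Longrightarrow>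
           n \<le> (length E - length (w # F) + 1) * c + 20 \<Longrightarrow> Q' r n" for Q' :: "('v + 'e) sexp \<Rightarrow> nat \<Rightarrow> bool"
      using ne by (subst call_prog)
        (auto simp: growloop2_body_def wp_simps intro!: IH[unfolded list.map slist.simps] that)
    have d: "length E - length F = Suc (length E - length (w # F))" using l' by simp
    show ?thesis using Some c
      by (subst call_prog)
        (auto simp: growloop_body_def wp_simps d intro!: grow p2 less.prems(2))
  qed
qed

section \<open>Conflicts between outer vertices and renaming\<close>

definition confl :: "('e \<times> 'e) list \<Rightarrow> 'e list list \<Rightarrow> ('e list \<times> 'e list) option" where
  "confl Es F = map_option (\<lambda>(x, y). (the (lookF F x), the (lookF F y)))
     (find (\<lambda>(x, y). lookF F x \<noteq> None \<and> lookF F y \<noteq> None) Es)"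

lemma call_conf:
  fixes Q :: "('v + 'e) sexp \<Rightarrow> nat \<Rightarrow> bool"
  assumes F: "\<And>w. w \<in> set F \<Longrightarrow> w \<noteq> []" and c: "80 * (length F + 1) \<le> c"
    and "\<And>r n. r = (case confl Es F of None \<Rightarrow> SNil | Some (w, w') \<Rightarrow> SCons (atoms w) (atoms w')) \<Longrightarrow>
      n \<le> (length Es + 1) * (c + 100) \<Longrightarrow> Q r n"
  shows "call prog CONF [ence Es, paths F] Q"
  using assms(3)
proof (induction Es arbitrary: Q)
  case Nil
  show ?case by (subst call_prog) (auto simp: conf_body_def Let_def confl_def wp_simps intro!: Nil)
next
  case (Cons e Es)
  obtain x y where e: "e = (x, y)" by fastforce
  have ne: "w \<noteq> []" if "lookF F v = Some w" for v w using lookF_Some[OF that] F by blast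
  show ?case
  proof (cases "lookF F x")
    case None
    then have "confl (e # Es) F = confl Es F" by (simp add: confl_def e)
    note prem = Cons.prems[unfolded this]
    show ?thesis using c None
      by (subst call_prog)
        (auto simp: conf_body_def Let_def wp_simps e intro!: prem Cons.IH call_assocF[OF F])
  next
    case w: (Some w)
    show ?thesis
    proof (cases "lookF F y")
      case None
      then have "confl (e # Es) F = confl Es F" by (simp add: confl_def e)
      note prem = Cons.prems[unfolded this]
      show ?thesis using c None w ne[OF w]
        by (subst call_prog)
          (auto simp: conf_body_def Let_def wp_simps e intro!: prem Cons.IH call_assocF[OF F])
    next
      case (Some w')
      then have "confl (e # Es) F = Some (w, w')" using w by (simp add: confl_def e)
      note prem = Cons.prems[unfolded this option.case prod.case]
      show ?thesis using c Some w ne[OF w] ne[OF Some]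
        by (subst call_prog)
          (auto simp: conf_body_def Let_def wp_simps e intro!: prem call_assocF[OF F])
    qed
  qed
qed

lemma call_first:
  "20 * (length w' + 1) \<le> c \<Longrightarrow>
   (\<And>r n. r = (case find (\<lambda>x. x \<in> set w') w of None \<Rightarrow> SNil | Some b \<Rightarrow> el b) \<Longrightarrow>
      n \<le> (length w + 1) * (c + 50) \<Longrightarrow> Q r n) \<Longrightarrow>
   call prog FIRST [atoms w, atoms w'] Q"
proof (induction w arbitrary: Q)
  case Nil
  show ?case by (subst call_prog) (auto simp: first_body_def wp_simps intro!: Nil)
next
  case (Cons x w)
  show ?case using Cons.prems(1)
    by (subst call_prog) (auto simp: first_body_def wp_simps intro!: Cons.prems(2) Cons.IH call_mem)
qed

lemma call_diff:
  "20 * (length w' + 1) \<le> c \<Longrightarrow>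
   (\<And>r n. r = atoms (filter (\<lambda>x. x \<notin> set w') w) \<Longrightarrow> n \<le> (length w + 1) * (c + 50) \<Longrightarrow> Q r n) \<Longrightarrow>
   call prog DIFF [atoms w, atoms w'] Q"
proof (induction w arbitrary: Q)
  case Nil
  show ?case by (subst call_prog) (auto simp: diff_body_def wp_simps intro!: Nil)
next
  case (Cons x w)
  show ?case using Cons.prems(1)
    by (subst call_prog) (auto simp: diff_body_def wp_simps intro!: Cons.prems(2) Cons.IH call_mem)
qed

definition renv :: "'e list \<Rightarrow> 'e \<Rightarrow> 'e \<Rightarrow> 'e" where "renv B b x = (if x \<in> set B then b else x)"

definition renl :: "'e list \<Rightarrow> 'e \<Rightarrow> ('e \<times> 'e) list \<Rightarrow> ('e \<times> 'e) list" where
  "renl B b es = filter (\<lambda>e. fst e \<noteq> snd e) (map (\<lambda>(x, y). (renv B b x, renv B b y)) es)"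

lemma call_sub:
  "(\<And>r n. r = el (renv B b x) \<Longrightarrow> n \<le> 20 * (length B + 1) + 20 \<Longrightarrow> Q r n) \<Longrightarrow>
   call prog SUB [el x, atoms B, el b] Q"
  by (subst call_prog) (auto simp: sub_body_def renv_def wp_simps intro!: call_mem)

lemma call_renc:
  "(\<And>r n. r = ence (if x = y then es else (x, y) # es) \<Longrightarrow> n \<le> 20 \<Longrightarrow> Q r n) \<Longrightarrow>
   call prog RENC [el x, el y, ence es] Q"
  by (subst call_prog) (auto simp: renc_body_def wp_simps encp_pair)

lemma call_ren:
  "50 * (length B + 1) \<le> c \<Longrightarrow>
   (\<And>r n. r = ence (renl B b es) \<Longrightarrow> n \<le> (length es + 1) * (c + 150) \<Longrightarrow> Q r n) \<Longrightarrow>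
   call prog REN [ence es, atoms B, el b] Q"
proof (induction es arbitrary: Q)
  case Nil
  show ?case by (subst call_prog) (auto simp: ren_body_def renl_def wp_simps intro!: Nil)
next
  case (Cons e es)
  have "renl B b (e # es) = (if renv B b (fst e) = renv B b (snd e) then renl B b es
      else (renv B b (fst e), renv B b (snd e)) # renl B b es)"
    by (simp add: renl_def split: prod.splits)
  note prem = Cons.prems(2)[unfolded this]
  show ?case using Cons.prems(1)
    by (subst call_prog)
      (auto simp: ren_body_def wp_simps intro!: prem Cons.IH call_sub call_renc)
qed

lemma confl_None:
  assumes "confl Es F = None" "(x, y) \<in> set Es" "x \<in> hd ` set F" shows "y \<notin> hd ` set F"
proof -
  have "\<not> (lookF F x \<noteq> None \<and> lookF F y \<noteq> None)"
    using assms(1,2) unfolding confl_def by (auto simp: find_None_iff)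
  then show ?thesis using assms(3) unfolding lookF_None by blast
qed

lemma confl_Some:
  assumes "confl Es F = Some (w, w')"
  shows "w \<in> set F" "w' \<in> set F" "(hd w, hd w') \<in> set Es"
proof -
  obtain x y where xy: "find (\<lambda>(x, y). lookF F x \<noteq> None \<and> lookF F y \<noteq> None) Es = Some (x, y)"
    "w = the (lookF F x)" "w' = the (lookF F y)"
    using assms unfolding confl_def by auto
  then have "(x, y) \<in> set Es" by (metis (no_types, lifting) find_Some_iff nth_mem)
  moreover have "lookF F x = Some w" "lookF F y = Some w'"
    using xy by (auto simp: find_Some_iff)
  ultimately show "w \<in> set F" "w' \<in> set F" "(hd w, hd w') \<in> set Es"
    using lookF_Some[of F x w] lookF_Some[of F y w'] by auto
qed

definition improvable :: "('e \<times> 'e) list \<Rightarrow> ('e \<times> 'e) list \<Rightarrow> bool" where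
  "improvable E M \<longleftrightarrow> (\<exists>L\<subseteq>ed E. matching L \<and> card (ed M) < card L)"

lemma improvable_iff:
  "valid E M \<Longrightarrow> improvable E M \<longleftrightarrow> (\<exists>p. augmenting_path (ed E) (ed M) p)"
  unfolding improvable_def by (rule larger_matching_iff[OF validD(4) finite_ed validD(5)])

text \<open>The fruitless searches for growth steps and conflicts together verify all closure
  conditions of \<open>forest_stable\<close>.\<close>

lemma not_improvable:
  assumes v: "valid E M" and F: "good_forest E M F" "growl E M F = None" "confl E F = None"
  shows "\<not> improvable E M"
proof -
  have "\<not> augmenting_path (ed E) (ed M) p" for p
  proof (rule forest_stable)
    show "forest (ed E) (ed M) F" using F(1) unfolding good_forest_def by blast
    show "x \<in> hd ` set F" if "x \<in> \<Union>(ed E)" "x \<notin> \<Union>(ed M)" for x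
    proof -
      have "x \<in> fst ` set E" using that(1) unfolding Union_ed(2)[OF v] .
      then obtain y where "(x, y) \<in> set E" by auto
      then show ?thesis using growl_None(1)[OF F(2)] that(2) Union_ed(1)[OF v] by blast
    qed
    show "z \<in> hd ` set F" if "x \<in> hd ` set F" "{x, y} \<in> ed E" "y \<notin> hd ` set F" "{y, z} \<in> ed M" for x y z
    proof -
      have "(x, y) \<in> set E" using that(2) validD(1)[OF v] by blast
      moreover have "(y, z) \<in> set M" using that(4) validD(2)[OF v] by blast
      then have "lookM M y \<noteq> None" unfolding lookM_None by force
      then obtain m where m: "lookM M y = Some m" by blast
      then have "(y, snd m) \<in> set M" by (rule lookM_Some)
      then have "{y, snd m} \<in> ed M" using validD(2)[OF v] by blast
      then have "snd m = z" using matching_mate[OF validD(4)[OF v]] that(4) by metis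
      ultimately show ?thesis using growl_None(2)[OF F(2)] that(1,3) m by blast
    qed
    show "y \<notin> hd ` set F" if "x \<in> hd ` set F" "{x, y} \<in> ed E" for x y
      using confl_None[OF F(3) _ that(1)] that(2) validD(1)[OF v] by blast
  qed (use validD[OF v] in auto)
  then show ?thesis using improvable_iff[OF v] by blast
qed

text \<open>The list \<open>B\<close> omits the base; inserting it changes nothing, because renaming
  fixes \<open>b\<close>.\<close>

lemma ed_renl: "ed (renl B b es) = contract (insert b (set B)) b (ed es)"
proof -
  let ?r = "\<lambda>v. if v \<in> insert b (set B) then b else v"
  have r: "renv B b = ?r" by (auto simp: renv_def)
  have c: "card {?r x, ?r y} = 2 \<longleftrightarrow> ?r x \<noteq> ?r y" for x y by (simp add: card_insert_if)
  show ?thesis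
  proof (intro set_eqI iffI)
    fix e assume "e \<in> ed (renl B b es)"
    then obtain x y where "(x, y) \<in> set es" "e = {?r x, ?r y}" "?r x \<noteq> ?r y"
      unfolding ed_def renl_def r by auto
    then show "e \<in> contract (insert b (set B)) b (ed es)"
      by (intro contractI[of "{x, y}"]) (use c[of x y] in \<open>auto simp: ed_def\<close>)
  next
    fix e assume "e \<in> contract (insert b (set B)) b (ed es)"
    then obtain x y where xy: "(x, y) \<in> set es" "e = ?r ` {x, y}" "card e = 2"
      unfolding contract_def ed_def by blast
    then have "e = {?r x, ?r y}" "?r x \<noteq> ?r y" using c[of x y] by auto
    moreover have "(?r x, ?r y) \<in> set (renl B b es)"
      using xy(1) calculation(2) unfolding renl_def r by force
    ultimately show "e \<in> ed (renl B b es)" unfolding ed_def by blast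
  qed
qed

text \<open>Recovers the split of \<open>forest_meet\<close> from the bare paths: the first vertex
  of one that lies on the other is the base, and filtering removes the common stem.\<close>

lemma find_meet:
  assumes "set a1 \<inter> set (b # c) = {}" "set a1 \<inter> set a2 = {}"
  shows "find (\<lambda>x. x \<in> set (a2 @ b # c)) (a1 @ b # c) = Some b"
    and "filter (\<lambda>x. x \<notin> set (a2 @ b # c)) (a1 @ b # c) = a1"
proof -
  show "find (\<lambda>x. x \<in> set (a2 @ b # c)) (a1 @ b # c) = Some b"
    using assms by (induction a1) auto
  have "filter (\<lambda>x. x \<notin> set (a2 @ b # c)) a1 = a1"
    using assms by (intro filter_True) auto
  moreover have "filter (\<lambda>x. x \<notin> set (a2 @ b # c)) (b # c) = []"
    by (intro filter_False) auto
  ultimately show "filter (\<lambda>x. x \<notin> set (a2 @ b # c)) (a1 @ b # c) = a1" by simp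
qed

text \<open>Disjoint paths prove improvability at once. Paths that meet bound a blossom, whose
  contraction preserves the answer and swallows a matched edge.\<close>

lemma conflict_cases:
  assumes v: "valid E M" and F: "good_forest E M F" and w: "confl E F = Some (w, w')"
  obtains (disjoint) "find (\<lambda>x. x \<in> set w') w = None" "improvable E M"
  | (blossom) b B where "find (\<lambda>x. x \<in> set w') w = Some b"
      "filter (\<lambda>x. x \<notin> set w') w @ filter (\<lambda>x. x \<notin> set w) w' = B"
      "valid (renl B b E) (renl B b M)" "improvable (renl B b E) (renl B b M) \<longleftrightarrow> improvable E M"
      "length (renl B b M) < length M" "length B \<le> 2 * length E"
proof (cases "set w \<inter> set w' = {}")
  case True
  note F' = F[unfolded good_forest_def, THEN conjunct1]
  have "{hd w, hd w'} \<in> ed E" using confl_Some(3)[OF w] validD(1)[OF v] by blast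
  then have "\<exists>L\<subseteq>ed E. matching L \<and> card (ed M) < card L"
    using disjoint_even_paths_larger[OF validD(4)[OF v] finite_ed validD(5)[OF v]
        forest_even_path[OF F' validD(4)[OF v] confl_Some(1)[OF w]]
        forest_even_path[OF F' validD(4)[OF v] confl_Some(2)[OF w]] True] by blast
  moreover have "find (\<lambda>x. x \<in> set w') w = None" using True by (auto simp: find_None_iff)
  ultimately show thesis using disjoint unfolding improvable_def by blast
next
  case False
  note F' = F[unfolded good_forest_def, THEN conjunct1]
  note ws = confl_Some[OF w]
  obtain a1 a2 b c where s: "w = a1 @ b # c" "w' = a2 @ b # c" "set a1 \<inter> set a2 = {}"
      "paired (ed M) a1" "paired (ed M) a2" "b # c \<in> set F"
    using forest_meet[OF F' validD(4)[OF v] ws(1,2) False] by blast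
  have d: "distinct w" "distinct w'" using good_forest_path(2)[OF F v] ws by blast+
  have len: "length w \<le> length E" "length w' \<le> length E" using good_forest_path(3)[OF F v] ws by blast+
  let ?B = "a1 @ a2"
  have dis: "set a1 \<inter> set (b # c) = {}" "set a2 \<inter> set (b # c) = {}" using d s(1,2) by auto
  have f: "find (\<lambda>x. x \<in> set w') w = Some b" "filter (\<lambda>x. x \<notin> set w') w = a1" "filter (\<lambda>x. x \<notin> set w) w' = a2"
    using find_meet[OF dis(1) s(3)] find_meet(2)[OF dis(2), of a1] s(1-3) by (simp_all add: Int_commute)
  have B: "insert b (set ?B) = set a1 \<union> set a2 \<union> {b}" by auto
  have "{hd w, hd w'} \<in> ed E" using ws(3) validD(1)[OF v] by blast
  note bl' = forest_blossom[OF F' finite_ed _ validD(4,5)[OF v] ws(1,2) this s B]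
  have bl: "(\<exists>N\<subseteq>ed E. matching N \<and> card (ed M) < card N) \<longleftrightarrow>
      (\<exists>N\<subseteq>contract (insert b (set ?B)) b (ed E). matching N \<and> card (contract (insert b (set ?B)) b (ed M)) < card N)"
    "matching (contract (insert b (set ?B)) b (ed M))" "\<exists>e\<in>ed M. e \<subseteq> insert b (set ?B)"
    using bl'(1,2,4) validD(7)[OF v] by blast+
  have r: "ed (renl ?B b es) = contract (insert b (set ?B)) b (ed es)" for es by (rule ed_renl)
  have sym: "(y, x) \<in> set (renl ?B b es)" if "(x, y) \<in> set (renl ?B b es)" "\<forall>(x, y)\<in>set es. (y, x) \<in> set es" for es x y
    using that unfolding renl_def by force
  have symE: "\<forall>(x, y)\<in>set E. (y, x) \<in> set E" "\<forall>(x, y)\<in>set M. (y, x) \<in> set M"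
    using v unfolding valid_def by fast+
  have "valid (renl ?B b E) (renl ?B b M)"
    unfolding valid_def
  proof (intro conjI)
    show "\<forall>(x, y)\<in>set (renl ?B b E). (y, x) \<in> set (renl ?B b E) \<and> x \<noteq> y"
    proof (safe)
      fix x y assume xy: "(x, y) \<in> set (renl ?B b E)"
      show "(y, x) \<in> set (renl ?B b E)" by (rule sym[OF xy symE(1)])
    next
      fix x assume "(x, x) \<in> set (renl ?B b E)"
      then show False unfolding renl_def by auto
    qed
    show "\<forall>(x, y)\<in>set (renl ?B b M). (y, x) \<in> set (renl ?B b M)"
    proof (safe)
      fix x y assume xy: "(x, y) \<in> set (renl ?B b M)"
      show "(y, x) \<in> set (renl ?B b M)" by (rule sym[OF xy symE(2)])
    qed
    show "set (renl ?B b M) \<subseteq> set (renl ?B b E)" using validD(6)[OF v] unfolding renl_def by auto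
    show "matching (ed (renl ?B b M))" unfolding r by (rule bl(2))
  qed
  moreover have "improvable (renl ?B b E) (renl ?B b M) \<longleftrightarrow> improvable E M"
    unfolding improvable_def r using bl(1) by simp
  moreover have "length (renl ?B b M) < length M"
  proof -
    obtain e where e: "e \<in> ed M" "e \<subseteq> set a1 \<union> set a2 \<union> {b}" using bl(3) unfolding B by blast
    then obtain x y where "e = {x, y}" unfolding ed_def by blast
    with e have xy: "{x, y} \<in> ed M" "x \<in> set a1 \<union> set a2 \<union> {b}" "y \<in> set a1 \<union> set a2 \<union> {b}"
      by auto
    then have "(x, y) \<in> set M" using validD(2)[OF v] by blast
    moreover have "renv ?B b x = renv ?B b y" using xy(2,3) by (auto simp: renv_def)
    ultimately have "\<exists>e\<in>set (map (\<lambda>(x, y). (renv ?B b x, renv ?B b y)) M). \<not> fst e \<noteq> snd e" by force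
    then obtain e where e: "e \<in> set (map (\<lambda>(x, y). (renv ?B b x, renv ?B b y)) M)" "\<not> fst e \<noteq> snd e" by blast
    from length_filter_less[where P = "\<lambda>e. fst e \<noteq> snd e", OF this] show ?thesis unfolding renl_def by simp
  qed
  moreover have "length ?B \<le> 2 * length E" using len s(1,2) by simp
  ultimately show thesis using blossom[of b ?B] f by simp
qed

definition conflB :: "nat \<Rightarrow> nat" where "conflB N = (N + 1) * (80 * (N + 1) + 100)"
definition pathB :: "nat \<Rightarrow> nat" where "pathB N = (N + 1) * (20 * (N + 1) + 50)"
definition renB :: "nat \<Rightarrow> nat" where "renB N = (N + 1) * (50 * (2 * N + 1) + 150)"
text \<open>One level of the recursion: forest, conflict, three path scans (the meeting vertex and
  two differences), an append and two renamings.\<close>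

definition decideB :: "nat \<Rightarrow> nat" where
  "decideB N = (N + 1) * (growB N + 100) + conflB N + 3 * pathB N + 20 * (N + 1) + 2 * renB N + 200"

lemma length_renl: "length (renl B b es) \<le> length es"
  unfolding renl_def using length_filter_le[of _ "map _ es"] by (simp add: order_trans[OF length_filter_le])

text \<open>The number of listed matched edges bounds the depth of the recursion. Renaming never
  lengthens a list, so the same \<open>N\<close> and \<open>c\<close> serve at every level.\<close>

lemma call_decide:
  fixes Q :: "('v + 'e) sexp \<Rightarrow> nat \<Rightarrow> bool"
  assumes "valid E M" "length E \<le> N" "length M \<le> N" "decideB N \<le> c"
    and "\<And>r n. r = sbool (improvable E M) \<Longrightarrow> n \<le> (length M + 1) * c \<Longrightarrow> Q r n"
  shows "call prog DECIDE [ence E, ence M] Q"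
  using assms(1-3,5)
proof (induction "length M" arbitrary: E M Q rule: less_induct)
  case less
  note v = less.prems(1) and N = less.prems(2,3) and prem = less.prems(4)
  define gB where "gB = (N + 1) * (growB N + 100)"
  define cB where "cB = conflB N"
  define pB where "pB = pathB N"
  define rB where "rB = renB N"
  have c: "gB + cB + 3 * pB + 20 * (N + 1) + 2 * rB + 200 \<le> c"
    using assms(4) unfolding decideB_def gB_def cB_def pB_def rB_def .
  have g0: "good_forest E M []" unfolding good_forest_def by (simp add: forest.Nil)
  have growloop: "call prog GROWLOOP [ence E, ence M, SNil] Q"
    if "\<And>r n F. r = paths F \<Longrightarrow> good_forest E M F \<Longrightarrow> growl E M F = None \<Longrightarrow> n \<le> gB \<Longrightarrow> Q r n"
    for Q :: "('v + 'e) sexp \<Rightarrow> nat \<Rightarrow> bool"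
  proof -
    have "(length E + 1) * (growB N + 100) \<le> gB" unfolding gB_def by (rule mult_le_mono) (use N in auto)
    then have "call prog GROWLOOP [ence E, ence M, paths []] Q"
      by (intro call_growloop[OF v N order_refl g0]) (use that in auto)
    then show ?thesis by simp
  qed
  have conf: "call prog CONF [ence E, paths F] Q"
    if F: "good_forest E M F" and
      "\<And>r n. r = (case confl E F of None \<Rightarrow> SNil | Some (w, w') \<Rightarrow> SCons (atoms w) (atoms w')) \<Longrightarrow> n \<le> cB \<Longrightarrow> Q r n"
    for F and Q :: "('v + 'e) sexp \<Rightarrow> nat \<Rightarrow> bool"
  proof -
    have "(length E + 1) * (80 * (length F + 1) + 100) \<le> cB"
      unfolding cB_def conflB_def by (rule mult_le_mono) (use N good_forest_length[OF F] in auto)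
    then show ?thesis
      by (intro call_conf[OF good_forest_path(1)[OF F v] order_refl]) (use that(2) in auto)
  qed
  have main: "call prog DECIDE2 [ence E, ence M, case confl E F of None \<Rightarrow> SNil | Some (w, w') \<Rightarrow> SCons (atoms w) (atoms w')] Q"
    if F: "good_forest E M F" "growl E M F = None"
      and Q: "\<And>r n. r = sbool (improvable E M) \<Longrightarrow> n + gB + cB + 50 \<le> (length M + 1) * c \<Longrightarrow> Q r n"
    for F and Q :: "('v + 'e) sexp \<Rightarrow> nat \<Rightarrow> bool"
  proof (cases "confl E F")
    case None
    then show ?thesis using not_improvable[OF v F None] c
      by (subst call_prog) (auto simp: decide2_body_def wp_simps intro!: Q)
  next
    case (Some ww)
    obtain w w' where ww: "ww = (w, w')" by fastforce
    note conf = Some[unfolded ww]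
    have wl: "length w \<le> N" "length w' \<le> N" "w \<noteq> []" "w' \<noteq> []"
      using good_forest_path(1,3)[OF F(1) v] confl_Some(1,2)[OF conf] N(1) by fastforce+
    have pb: "(length u + 1) * (20 * (length u' + 1) + 50) \<le> pB" if "length u \<le> N" "length u' \<le> N" for u u' :: "'e list"
      unfolding pB_def pathB_def by (rule mult_le_mono) (use that in auto)
    have first: "call prog FIRST [atoms w, atoms w'] Q"
      if "\<And>r n. r = (case find (\<lambda>x. x \<in> set w') w of None \<Rightarrow> SNil | Some b \<Rightarrow> el b) \<Longrightarrow> n \<le> pB \<Longrightarrow> Q r n"
      for Q :: "('v + 'e) sexp \<Rightarrow> nat \<Rightarrow> bool"
      by (rule call_first[OF order_refl]) (use that pb[OF wl(1,2)] in \<open>auto intro: order_trans\<close>)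
    have diff: "call prog DIFF [atoms u, atoms u'] Q"
      if "length u \<le> N" "length u' \<le> N" "\<And>r n. r = atoms (filter (\<lambda>x. x \<notin> set u') u) \<Longrightarrow> n \<le> pB \<Longrightarrow> Q r n"
      for u u' and Q :: "('v + 'e) sexp \<Rightarrow> nat \<Rightarrow> bool"
      by (rule call_diff[OF order_refl]) (use that(3) pb[OF that(1,2)] in \<open>auto intro: order_trans\<close>)
    from v F(1) conf show ?thesis
    proof (cases rule: conflict_cases)
      case disjoint
      have d3: "call prog DECIDE3 [ence E, ence M, atoms w, atoms w', SNil] Q"
        if "Q (sbool True) 5" for Q :: "('v + 'e) sexp \<Rightarrow> nat \<Rightarrow> bool"
        using that by (subst call_prog) (simp add: decide3_body_def wp_simps numeral_eq_Suc)
      show ?thesis using disjoint c conf wl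
        by (subst call_prog) (auto simp: decide2_body_def wp_simps intro!: Q first d3)
    next
      case (blossom b B)
      have lB: "length B \<le> 2 * N" using blossom(6) N(1) by linarith
      have ren: "call prog REN [ence es, atoms B, el b] Q"
        if "length es \<le> N" "\<And>r n. r = ence (renl B b es) \<Longrightarrow> n \<le> rB \<Longrightarrow> Q r n"
        for es and Q :: "('v + 'e) sexp \<Rightarrow> nat \<Rightarrow> bool"
      proof -
        have "(length es + 1) * (50 * (length B + 1) + 150) \<le> rB"
          unfolding rB_def renB_def by (rule mult_le_mono) (use that lB in auto)
        then show ?thesis by (intro call_ren[OF order_refl]) (use that(2) in auto)
      qed
      have IH: "call prog DECIDE [ence (renl B b E), ence (renl B b M)] Q"
        if "\<And>r n. r = sbool (improvable E M) \<Longrightarrow> n + c \<le> (length M + 1) * c \<Longrightarrow> Q r n"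
        for Q :: "('v + 'e) sexp \<Rightarrow> nat \<Rightarrow> bool"
      proof (rule less.hyps[OF blossom(5,3)])
        show "length (renl B b E) \<le> N" "length (renl B b M) \<le> N"
          using length_renl[of B b] N by (meson order_trans)+
        fix r :: "('v + 'e) sexp" and n
        assume r: "r = sbool (improvable (renl B b E) (renl B b M))"
          and n: "n \<le> (length (renl B b M) + 1) * c"
        \<comment> \<open>The strict decrease sets one \<open>c\<close> free, which pays for the
          present level.\<close>
        have "(length (renl B b M) + 1) * c \<le> length M * c"
          by (rule mult_le_mono1) (use blossom(5) in auto)
        then have "n + c \<le> (length M + 1) * c" using n by simp
        then show "Q r n" using that r blossom(4) by simp
      qed
      have d4: "call prog DECIDE4 [ence E, ence M, atoms B, el b] Q"
        if "\<And>r n. r = sbool (improvable E M) \<Longrightarrow> n + c \<le> (length M + 1) * c + 2 * rB + 30 \<Longrightarrow> Q r n"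
        for Q :: "('v + 'e) sexp \<Rightarrow> nat \<Rightarrow> bool"
        by (subst call_prog) (use N in \<open>auto simp: decide4_body_def wp_simps intro!: ren IH that\<close>)
      have app: "call prog APP [atoms (filter (\<lambda>x. x \<notin> set w') w), atoms (filter (\<lambda>x. x \<notin> set w) w')] Q"
        if "\<And>r n. r = atoms B \<Longrightarrow> n \<le> 20 * (N + 1) \<Longrightarrow> Q r n" for Q :: "('v + 'e) sexp \<Rightarrow> nat \<Rightarrow> bool"
      proof (rule call_app)
        have "length (filter (\<lambda>x. x \<notin> set w') w) \<le> N"
          using wl(1) by (meson length_filter_le order_trans)
        then show "Q r n" if "r = slist (map el (filter (\<lambda>x. x \<notin> set w') w) @ map el (filter (\<lambda>x. x \<notin> set w) w'))"
          "n \<le> 20 * (length (map el (filter (\<lambda>x. x \<notin> set w') w) :: ('v + 'e) sexp list) + 1)" for r n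
          using that \<open>\<And>r n. r = atoms B \<Longrightarrow> n \<le> 20 * (N + 1) \<Longrightarrow> Q r n\<close> blossom(2)
          by (simp flip: map_append)
      qed
      have d3: "call prog DECIDE3 [ence E, ence M, atoms w, atoms w', el b] Q"
        if "\<And>r n. r = sbool (improvable E M) \<Longrightarrow>
          n + c \<le> (length M + 1) * c + 2 * rB + 2 * pB + 20 * (N + 1) + 80 \<Longrightarrow> Q r n"
        for Q :: "('v + 'e) sexp \<Rightarrow> nat \<Rightarrow> bool"
        by (subst call_prog)
          (use wl(1,2) in \<open>auto simp: decide3_body_def wp_simps intro!: diff app d4 that\<close>)
      show ?thesis using blossom(1) c conf wl(3,4)
        by (subst call_prog) (auto simp: decide2_body_def wp_simps intro!: Q first d3)
    qed
  qed
  show ?case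
    by (subst call_prog) (auto simp: decide_body_def wp_simps intro!: growloop conf main prem)
qed

context encoded_collection
begin

section \<open>The main loop\<close>

lemma set_candsl:
  assumes "T \<in> set (candsl vs)" "set vs \<subseteq> V"
  shows "set T \<subseteq> V" "T \<noteq> []" "length T \<le> 3" "distinct T" "disjoint_family (set T)"
proof -
  let ?ok = "\<lambda>k T. set T \<subseteq> V \<and> length T = k \<and> distinct T \<and> disjoint_family (set T)"
  have step: "?ok (Suc k) L" if L: "L \<in> set (extl vs Ts)" and ok: "\<And>T. T \<in> set Ts \<Longrightarrow> ?ok k T" for L Ts k
  proof -
    obtain v T where vT: "L = v # T" "v \<in> set vs" "T \<in> set Ts" "\<forall>s\<in>set T. U v \<inter> U s = {}"
      using L unfolding set_extl by blast
    have v: "v \<in> V" using vT(2) assms(2) by blast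
    then have "v \<notin> set T" using vT(4) U_nonempty by blast
    moreover have "disjoint_family (insert v (set T))"
      using ok[OF vT(3)] vT(4) unfolding disjoint_family_def by (auto simp: Int_commute)
    ultimately show ?thesis using ok[OF vT(3)] v vT(1) by simp
  qed
  have 0: "?ok 0 T" if "T \<in> set [[]]" for T using that by (simp add: disjoint_family_def)
  note 1 = step[of _ "[[]]" 0, OF _ 0]
  note 2 = step[of _ "extl vs [[]]" "Suc 0", OF _ 1]
  note 3 = step[of _ "extl vs (extl vs [[]])" "Suc (Suc 0)", OF _ 2]
  have "?ok 1 T \<or> ?ok 2 T \<or> ?ok 3 T"
    using assms(1) 1[of T] 2[of T] 3[of T] unfolding candsl_def numeral_eq_Suc by auto
  then show "set T \<subseteq> V" "T \<noteq> []" "length T \<le> 3" "distinct T" "disjoint_family (set T)" by auto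
qed

text \<open>The talons are disjoint and each contains an element of the center, which has at most
  three; hence there are no more than three talons.\<close>

lemma claw_in_candsl:
  assumes "claw G S" "set vs = V"
  shows "\<exists>T\<in>set (candsl vs). set T = S \<and>
    (length T = 1 \<or> (\<exists>v\<in>set vs. \<forall>t\<in>set T. t \<noteq> v \<and> U t \<inter> U v \<noteq> {}))"
proof -
  have S: "S \<subseteq> V" "disjoint_family S" using claw_independent[OF assms(1)] by auto
  have fS: "finite S" "card S \<ge> 1" and
    center: "card S = 1 \<or> (\<exists>v\<in>V. \<forall>t\<in>S. t \<noteq> v \<and> U t \<inter> U v \<noteq> {})"
    using assms(1) unfolding claw_def d_claw_def by (auto simp: adjacent_iff Int_commute)
  have "card S \<le> 3"
  proof (cases "card S = 1")
    case False
    then obtain v where v: "v \<in> V" "\<forall>t\<in>S. t \<noteq> v \<and> U t \<inter> U v \<noteq> {}" using center by blast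
    then have "\<forall>t\<in>S. \<exists>x. x \<in> U t \<inter> U v" by blast
    then obtain f where f: "\<forall>t\<in>S. f t \<in> U t \<inter> U v" by metis
    have "inj_on f S"
    proof (rule inj_onI)
      fix s t assume st: "s \<in> S" "t \<in> S" "f s = f t"
      then show "s = t" using f disjoint_familyD[OF S(2) st(1,2), of "f s"] by auto
    qed
    moreover have "f ` S \<subseteq> U v" using f by blast
    ultimately have "card S \<le> card (U v)" using card_inj_on_le finite_U[OF v(1)] by blast
    then show ?thesis using card_U[OF v(1)] by linarith
  qed simp
  obtain T where T: "set T = S" "distinct T" using finite_distinct_list[OF fS(1)] by blast
  have len: "length T = card S" using T distinct_card by metis
  have ext: "v # L \<in> set (extl vs Ts)" if "distinct (v # L)" "set (v # L) \<subseteq> S" "L \<in> set Ts" for v L Ts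
  proof -
    have "U v \<inter> U s = {}" if "s \<in> set L" for s
      using that \<open>distinct (v # L)\<close> \<open>set (v # L) \<subseteq> S\<close> S(2) unfolding disjoint_family_def by fastforce
    then show ?thesis unfolding set_extl using that assms(2) S(1) by auto
  qed
  have "length T = 1 \<or> length T = 2 \<or> length T = 3" using len fS(2) \<open>card S \<le> 3\<close> by linarith
  then have "T \<in> set (candsl vs)"
  proof (elim disjE)
    assume "length T = 1"
    then obtain a where a: "T = [a]" by (auto simp: length_Suc_conv)
    have "[a] \<in> set (extl vs [[]])" using T a by (intro ext) auto
    then show ?thesis unfolding candsl_def a by simp
  next
    assume "length T = 2"
    then obtain a b where a: "T = [a, b]" by (auto simp: length_Suc_conv numeral_eq_Suc)
    have "[b] \<in> set (extl vs [[]])" using T a by (intro ext) auto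
    then have "[a, b] \<in> set (extl vs (extl vs [[]]))" using T a by (intro ext) auto
    then show ?thesis unfolding candsl_def a by simp
  next
    assume "length T = 3"
    then obtain a b c where a: "T = [a, b, c]" by (auto simp: length_Suc_conv numeral_eq_Suc)
    have "[c] \<in> set (extl vs [[]])" using T a by (intro ext) auto
    then have "[b, c] \<in> set (extl vs (extl vs [[]]))" using T a by (intro ext) auto
    then have "[a, b, c] \<in> set (extl vs (extl vs (extl vs [[]])))" using T a by (intro ext) auto
    then show ?thesis unfolding candsl_def a by simp
  qed
  then show ?thesis using T(1) center len assms(2) by auto
qed

lemma distinct_pushl:
  assumes "distinct T" "distinct A" "set T \<subseteq> V" shows "distinct (pushl T A)"
proof -
  have "v \<notin> set T" if "\<forall>s\<in>set T. U v \<inter> U s = {}" for v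
    using that assms(3) U_nonempty by blast
  then show ?thesis unfolding pushl_def using assms(1,2) by auto
qed

lemma goodl_claw_step:
  assumes vs: "set vs = V" and A: "set A \<subseteq> V" "distinct A" and T: "T \<in> set (candsl vs)" "goodl vs A T"
  shows "claw_step V U (set A) (set (pushl T A))"
proof -
  have sub: "set vs \<subseteq> V" using vs by simp
  note t = set_candsl[OF T(1) sub]
  have "claw G (set T)"
  proof (cases "length T = 1")
    case True
    then obtain a where "T = [a]" by (auto simp: length_Suc_conv)
    then show ?thesis using t(1) claw_singleton by simp
  next
    case False
    then obtain v where "v \<in> V" "\<forall>t\<in>set T. t \<noteq> v \<and> U t \<inter> U v \<noteq> {}"
      using T(2) vs unfolding goodl_def by auto
    then show ?thesis using t by (intro claw_center[of "set T" v]) auto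
  qed
  moreover have "Phi (set A) < Phi (push (set T) (set A))"
    using T(2) phil_eq[OF A(2)] phil_eq[OF distinct_pushl[OF t(4) A(2) t(1)]]
    unfolding goodl_def set_pushl by simp
  ultimately show ?thesis unfolding claw_step_iff[OF A(1)] set_pushl by blast
qed

lemma no_goodl_claw_step:
  assumes vs: "set vs = V" and A: "set A \<subseteq> V" "distinct A" and none: "find (goodl vs A) (candsl vs) = None"
  shows "\<not> claw_step V U (set A) B"
proof
  assume "claw_step V U (set A) B"
  then obtain S where S: "claw G S" "Phi (set A) < Phi (push S (set A))"
    unfolding claw_step_iff[OF A(1)] by blast
  have sub: "set vs \<subseteq> V" using vs by simp
  obtain T where T: "T \<in> set (candsl vs)" "set T = S"
    "length T = 1 \<or> (\<exists>v\<in>set vs. \<forall>t\<in>set T. t \<noteq> v \<and> U t \<inter> U v \<noteq> {})"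
    using claw_in_candsl[OF S(1) vs] by blast
  note t = set_candsl[OF T(1) sub]
  have "phil A < phil (pushl T A)"
    using S(2) phil_eq[OF A(2)] phil_eq[OF distinct_pushl[OF t(4) A(2) t(1)]] T(2) unfolding set_pushl by simp
  then have "goodl vs A T" unfolding goodl_def using T(3) by blast
  then show False using none T(1) by (auto simp: find_None_iff)
qed

lemma set_edgesl:
  assumes K: "\<forall>v\<in>set K. v \<in> V \<and> card (U v) = 2"
  shows "(x, y) \<in> set (edgesl K) \<longleftrightarrow> x \<noteq> y \<and> (\<exists>v\<in>set K. U v = {x, y})"
proof
  assume "(x, y) \<in> set (edgesl K)"
  then obtain v where v: "v \<in> set K" "(x, y) \<in> {(ul v ! 0, ul v ! 1), (ul v ! 1, ul v ! 0)}"
    unfolding edgesl_def by auto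
  obtain a b where "ul v = [a, b]" "a \<noteq> b" "U v = {a, b}" using ul_pair[of v] K v(1) by metis
  then show "x \<noteq> y \<and> (\<exists>v\<in>set K. U v = {x, y})" using v by (intro conjI bexI[of _ v]) auto
next
  assume "x \<noteq> y \<and> (\<exists>v\<in>set K. U v = {x, y})"
  then obtain v where v: "v \<in> set K" "U v = {x, y}" "x \<noteq> y" by blast
  obtain a b where ab: "ul v = [a, b]" "U v = {a, b}" using ul_pair[of v] K v(1) by metis
  then have "(x, y) = (a, b) \<or> (x, y) = (b, a)" using v(2) by (auto simp: doubleton_eq_iff)
  then have "(x, y) \<in> set [(ul v ! 0, ul v ! 1), (ul v ! 1, ul v ! 0)]" using ab(1) by auto
  then show "(x, y) \<in> set (edgesl K)" unfolding edgesl_def using v(1) by fastforce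
qed

lemma ed_edgesl:
  assumes K: "\<forall>v\<in>set K. v \<in> V \<and> card (U v) = 2"
  shows "ed (edgesl K) = U ` set K"
proof (intro set_eqI iffI)
  fix e assume "e \<in> ed (edgesl K)"
  then show "e \<in> U ` set K" unfolding ed_def using set_edgesl[OF K] by auto
next
  fix e assume "e \<in> U ` set K"
  then obtain v where v: "v \<in> set K" "e = U v" by blast
  then obtain x y where "U v = {x, y}" "x \<noteq> y" using K v(1) by (meson card_2_iff)
  then have "(x, y) \<in> set (edgesl K)" "e = {x, y}" using set_edgesl[OF K] v by auto
  then show "e \<in> ed (edgesl K)" unfolding ed_def by blast
qed

lemma ed_append: "ed (es @ es') = ed es \<union> ed es'"
  unfolding ed_def by auto

lemma length_edgesl: "length (edgesl K) = 2 * length K"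
  by (induction K) (simp_all add: edgesl_def)

end

locale encoded_state = encoded_collection +
  fixes vs A :: "'a list"
  assumes vs: "set vs = V" "distinct vs"
    and A: "set A \<subseteq> V" "distinct A" "disjoint_family (set A)"
begin

lemma length_A: "length A \<le> length vs"
  using A(1,2) vs by (metis card_mono distinct_card finite_set)

abbreviation "trips \<equiv> filter (\<lambda>v. card (U v) = 3) A"
abbreviation "pairsA \<equiv> pairsl A trips"
abbreviation "pairsV \<equiv> pairsl vs trips"
abbreviation "Ml \<equiv> edgesl pairsA"

lemma set_pairsA: "set pairsA = {v \<in> set A. card (U v) = 2}"
  using triple_pair_disjoint[OF A(1,3)] unfolding pairsl_def covered_by_triples_eq[OF A(1)] by auto

lemma set_pairsV: "U ` set pairsV = H_edges V U (set A)"
  unfolding H_edges_eq[OF A(1)] covered_by_triples_eq[OF A(1)] pairsl_def using vs(1) by (intro arg_cong[of _ _ "(`) U"]) auto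

lemma pairsA: "\<forall>v\<in>set pairsA. v \<in> V \<and> card (U v) = 2"
  using A(1) unfolding pairsl_def by auto

lemma pairsV: "\<forall>v\<in>set pairsV. v \<in> V \<and> card (U v) = 2"
  using vs(1) unfolding pairsl_def by auto

lemma ed_Ml: "ed Ml = H_matching V U (set A)"
proof -
  have "ed Ml = U ` set pairsA" by (rule ed_edgesl[OF pairsA])
  then show ?thesis unfolding H_matching_eq[OF A(1,3)] set_pairsA .
qed

lemma valid_edgesl:
  assumes "set K \<subseteq> set pairsV" shows "valid (edgesl K @ Ml) Ml"
proof -
  have K: "\<forall>v\<in>set K. v \<in> V \<and> card (U v) = 2" using assms pairsV by blast
  have sym: "(y, x) \<in> set (edgesl L) \<and> x \<noteq> y" if "\<forall>v\<in>set L. v \<in> V \<and> card (U v) = 2" "(x, y) \<in> set (edgesl L)" for L x y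
    using that(2) unfolding set_edgesl[OF that(1)] by (auto simp: insert_commute)
  show ?thesis
    unfolding valid_def
  proof (intro conjI)
    show "\<forall>(x, y)\<in>set (edgesl K @ Ml). (y, x) \<in> set (edgesl K @ Ml) \<and> x \<noteq> y"
      using sym[OF K] sym[OF pairsA] by auto
    show "\<forall>(x, y)\<in>set Ml. (y, x) \<in> set Ml"
      using sym[OF pairsA] by auto
    show "matching (ed Ml)" unfolding ed_Ml by (rule matching_H_matching(1)[OF A(1,3)])
  qed simp
qed

lemma call_edges':
  assumes "\<forall>v\<in>set K. v \<in> V \<and> card (U v) = 2"
    and "\<And>r n. r = ence (edgesl K @ es) \<Longrightarrow> n \<le> 50 * (length K + 1) \<Longrightarrow> Q r n"
  shows "call prog EDGES [ents K, ence es] Q"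
  by (rule call_edges) (use assms in auto)

section \<open>Extraction of an augmenting path by decisions\<close>

text \<open>The whole current matching remains available; only the supply of new edges
  varies.\<close>

definition augmentable :: "'a set \<Rightarrow> bool" where
  "augmentable K \<longleftrightarrow> (\<exists>p. augmenting_path (U ` K \<union> H_matching V U (set A)) (H_matching V U (set A)) p)"

text \<open>Makes the verdicts of the reduction permanent: a vertex that cannot be spared remains
  indispensable after others are removed.\<close>

lemma augmentable_mono: "augmentable K \<Longrightarrow> K \<subseteq> L \<Longrightarrow> augmentable L"
  unfolding augmentable_def augmenting_path_def by (meson image_mono order_refl order_trans sup.mono)

lemma improvable_augmentable:
  assumes "set K \<subseteq> set pairsV" shows "improvable (edgesl K @ Ml) Ml \<longleftrightarrow> augmentable (set K)"
proof -
  have K: "\<forall>v\<in>set K. v \<in> V \<and> card (U v) = 2" using assms pairsV by blast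
  show ?thesis
    unfolding improvable_iff[OF valid_edgesl[OF assms]] augmentable_def ed_append ed_edgesl[OF K] ed_Ml ..
qed

text \<open>
  This is why deciding improvability suffices: if edges are discarded as long as an augmenting
  path remains, then what remains is an augmenting path.
\<close>

lemma minimal_augment_step:
  assumes K: "K \<subseteq> set pairsV" "augmentable K" and min: "\<And>v. v \<in> K \<Longrightarrow> \<not> augmentable (K - {v})"
  shows "augment_step V U (set A) (push K (set A))" "K \<noteq> {}"
proof -
  let ?M = "H_matching V U (set A)"
  obtain p where p: "augmenting_path (U ` K \<union> ?M) ?M p" using K(2) unfolding augmentable_def by blast
  have sub: "path_edges p - ?M \<subseteq> U ` K" using augmenting_path_edges[OF p] by blast
  have needed: "\<not> path_edges p - ?M \<subseteq> U ` (K - {v})" if "v \<in> K" for v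
  proof
    assume "path_edges p - ?M \<subseteq> U ` (K - {v})"
    then have "path_edges p \<subseteq> U ` (K - {v}) \<union> ?M" by blast
    then have "augmenting_path (U ` (K - {v}) \<union> ?M) ?M p" using p unfolding augmenting_path_def by simp
    then show False using min[OF that] unfolding augmentable_def by blast
  qed
  \<comment> \<open>If two vertices carried the same pair, either could be dropped without losing
    the edge, against minimality.\<close>
  have inj: "inj_on U K"
  proof (rule inj_onI, rule ccontr)
    fix v w assume vw: "v \<in> K" "w \<in> K" "U v = U w" "v \<noteq> w"
    then have "U v \<in> U ` (K - {v})" by blast
    then have "U ` K \<subseteq> U ` (K - {v})" by blast
    then show False using needed[OF vw(1)] order_trans[OF sub] by simp
  qed
  \<comment> \<open>A vertex whose pair is not an unmatched edge of \<open>p\<close> could be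
    dropped while \<open>p\<close> survives.\<close>
  have "U v \<in> path_edges p - ?M" if "v \<in> K" for v
  proof (rule ccontr)
    assume n: "U v \<notin> path_edges p - ?M"
    have "path_edges p - ?M \<subseteq> U ` (K - {v})"
    proof
      fix e assume e: "e \<in> path_edges p - ?M"
      then obtain w where "w \<in> K" "e = U w" using sub by blast
      then show "e \<in> U ` (K - {v})" using e n by blast
    qed
    then show False using needed[OF that] by blast
  qed
  then have eq: "U ` K = path_edges p - ?M" using sub by blast
  have "U ` K \<union> ?M \<subseteq> H_edges V U (set A)"
    using K(1) set_pairsV matching_H_matching(2)[OF A(1,3)] by blast
  then have p': "augmenting_path (H_edges V U (set A)) ?M p" using p unfolding augmenting_path_def by blast
  have "K \<subseteq> V" using K(1) pairsV by blast
  from augment_stepI[OF A(1,3) p' this inj eq] show "augment_step V U (set A) (push K (set A))" .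
  show "K \<noteq> {}"
  proof
    assume "K = {}"
    then have e: "path_edges p - ?M = {}" using eq by blast
    from augmenting_path_covered[OF p, unfolded e] have "set p = {}" by simp
    then show False using p unfolding augmenting_path_def by simp
  qed
qed

text \<open>The factor 4 arises because candidates and matching contribute at most
  \<open>length vs\<close> pairs each, and every pair is listed in both orientations.\<close>

definition decB :: nat where "decB = (4 * length vs + 1) * decideB (4 * length vs)"

lemma length_pairsA: "length pairsA \<le> length vs"
  using length_A length_filter_le unfolding pairsl_def by (rule order_trans[rotated])

lemma call_dec:
  assumes K: "set K \<subseteq> set pairsV" "length K \<le> length vs"
    and "\<And>r n. r = sbool (augmentable (set K)) \<Longrightarrow> n \<le> decB \<Longrightarrow> Q r n"
  shows "call prog DECIDE [ence (edgesl K @ Ml), ence Ml] Q"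
proof (rule call_decide[OF valid_edgesl[OF K(1)] _ _ order_refl])
  show l: "length (edgesl K @ Ml) \<le> 4 * length vs" "length Ml \<le> 4 * length vs"
    using K(2) length_pairsA by (simp_all add: length_edgesl)
  have "(length Ml + 1) * decideB (4 * length vs) \<le> decB"
    unfolding decB_def by (rule mult_le_mono1) (use l in simp)
  then show "Q r n" if "r = sbool (improvable (edgesl K @ Ml) Ml)"
    "n \<le> (length Ml + 1) * decideB (4 * length vs)" for r n
    using assms(3) that improvable_augmentable[OF K(1)] by simp
qed

lemma call_reduce:
  assumes "decB + 70 * (length vs + 1) + 100 \<le> c"
  shows "distinct (todo @ K) \<Longrightarrow> set todo \<union> set K \<subseteq> set pairsV \<Longrightarrow> augmentable (set todo \<union> set K) \<Longrightarrow>
    (\<And>v. v \<in> set K \<Longrightarrow> \<not> augmentable (set todo \<union> set K - {v})) \<Longrightarrow>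
    (\<And>r n L. r = ents L \<Longrightarrow> L \<noteq> [] \<Longrightarrow> distinct L \<Longrightarrow> set L \<subseteq> V \<Longrightarrow>
       augment_step V U (set A) (set (pushl L A)) \<Longrightarrow> n \<le> (length todo + 1) * c \<Longrightarrow> Q r n) \<Longrightarrow>
    call prog REDUCE [ents todo, ents K, ence Ml] Q"
proof (induction todo arbitrary: K Q)
  case Nil
  have K: "set K \<subseteq> set pairsV" "augmentable (set K)" "\<And>v. v \<in> set K \<Longrightarrow> \<not> augmentable (set K - {v})"
    using Nil.prems(2-4) by simp_all
  have "augment_step V U (set A) (set (pushl K A))" "set K \<noteq> {}"
    unfolding set_pushl by (rule minimal_augment_step[OF K]; assumption)+
  moreover have "set K \<subseteq> V" using K(1) pairsV by blast
  ultimately show ?case using Nil.prems(1) assms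
    by (subst call_prog) (auto simp: reduce_body_def wp_simps intro!: Nil.prems(5))
next
  case (Cons v todo)
  let ?L = "todo @ K"
  have L1: "set ?L \<subseteq> set pairsV" using Cons.prems(2) by auto
  then have L: "set ?L \<subseteq> set pairsV" "set ?L \<subseteq> V" "\<forall>v\<in>set ?L. v \<in> V \<and> card (U v) = 2"
    using pairsV by blast+
  have len: "length ?L \<le> length vs" "length todo \<le> length vs"
  proof -
    have "length ?L = card (set ?L)" using Cons.prems(1) by (simp add: distinct_card card_Un_disjoint)
    also have "\<dots> \<le> card (set vs)" by (rule card_mono) (use L(2) vs in auto)
    finally show "length ?L \<le> length vs" using vs(2) distinct_card by metis
    then show "length todo \<le> length vs" by simp
  qed
  have app: "call prog APP [ents todo, ents K] Q"
    if "\<And>r n. r = ents ?L \<Longrightarrow> n \<le> 20 * (length vs + 1) \<Longrightarrow> Q r n" for Q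
    by (rule call_app) (use that len in auto)
  have edges: "call prog EDGES [ents ?L, ence Ml] Q"
    if "\<And>r n. r = ence (edgesl ?L @ Ml) \<Longrightarrow> n \<le> 50 * (length vs + 1) \<Longrightarrow> Q r n" for Q
    by (rule call_edges'[OF L(3)]) (use that len in auto)
  note dec = call_dec[OF L(1) len(1)]
  have un: "set ?L = set todo \<union> set K" by simp
  show ?case
  proof (cases "augmentable (set todo \<union> set K)")
    case True
    have IH: "call prog REDUCE [ents todo, ents K, ence Ml] Q"
      if "\<And>r n L. r = ents L \<Longrightarrow> L \<noteq> [] \<Longrightarrow> distinct L \<Longrightarrow> set L \<subseteq> V \<Longrightarrow>
       augment_step V U (set A) (set (pushl L A)) \<Longrightarrow> n \<le> (length todo + 1) * c \<Longrightarrow> Q r n" for Q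
    proof (rule Cons.IH[OF _ _ True _ that])
      show "\<not> augmentable (set todo \<union> set K - {u})" if "u \<in> set K" for u
      proof
        assume "augmentable (set todo \<union> set K - {u})"
        then have "augmentable (set (v # todo) \<union> set K - {u})" by (rule augmentable_mono) auto
        then show False using Cons.prems(4)[OF that] by blast
      qed
    qed (use Cons.prems(1,2) in auto)
    show ?thesis using assms True
      by (subst call_prog)
        (auto simp: reduce_body_def wp_simps simp del: map_append set_append
          intro!: app edges dec[unfolded un] IH Cons.prems(5))
  next
    case False
    have IH: "call prog REDUCE [ents todo, ents (v # K), ence Ml] Q"
      if "\<And>r n L. r = ents L \<Longrightarrow> L \<noteq> [] \<Longrightarrow> distinct L \<Longrightarrow> set L \<subseteq> V \<Longrightarrow>
       augment_step V U (set A) (set (pushl L A)) \<Longrightarrow> n \<le> (length todo + 1) * c \<Longrightarrow> Q r n" for Q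
    proof (rule Cons.IH[OF _ _ _ _ that])
      have eq: "set todo \<union> set (v # K) = set (v # todo) \<union> set K" by auto
      show "augmentable (set todo \<union> set (v # K))" unfolding eq by (rule Cons.prems(3))
      show "\<not> augmentable (set todo \<union> set (v # K) - {u})" if u: "u \<in> set (v # K)" for u
      proof (cases "u = v")
        case True
        have "set todo \<union> set (v # K) - {u} = set todo \<union> set K" using True Cons.prems(1) by auto
        then show ?thesis using False by simp
      next
        case False
        then show ?thesis unfolding eq using Cons.prems(4) u by simp
      qed
    qed (use Cons.prems(1,2) in auto)
    show ?thesis using assms False
      by (subst call_prog)
        (auto simp: reduce_body_def wp_simps simp del: map_append set_append
          intro!: app edges dec[unfolded un] IH[unfolded list.map slist.simps] Cons.prems(5))
  qed
qed

definition redB :: nat where "redB = (length vs + 1) * (decB + 70 * (length vs + 1) + 100)"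

definition augB :: nat where
  "augB = 2 * ((length vs + 1) * (500 * (length vs + 1) + 80)) + decB + redB + 200 * (length vs + 1) + 100"

text \<open>\<open>SNil\<close> reports failure; a success must therefore be a nonempty
  list.\<close>

definition aug_result :: "('a + 'b) sexp \<Rightarrow> bool" where
  "aug_result r \<longleftrightarrow> r = SNil \<and> (\<nexists>B. augment_step V U (set A) B) \<or>
     (\<exists>L. r = ents L \<and> L \<noteq> [] \<and> distinct L \<and> set L \<subseteq> V \<and> augment_step V U (set A) (set (pushl L A)))"

lemma aug_resultI:
  "L \<noteq> [] \<Longrightarrow> distinct L \<Longrightarrow> set L \<subseteq> V \<Longrightarrow> augment_step V U (set A) (set (pushl L A)) \<Longrightarrow>
   aug_result (ents L)"
  unfolding aug_result_def by blast

lemma call_aug: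
  fixes Q :: "('a + 'b) sexp \<Rightarrow> nat \<Rightarrow> bool"
  assumes res: "\<And>r n. aug_result r \<Longrightarrow> n \<le> augB \<Longrightarrow> Q r n"
  shows "call prog AUG [ents vs, ents A] Q"
proof -
  define pB where "pB = (length vs + 1) * (500 * (length vs + 1) + 80)"
  have B: "augB = 2 * pB + decB + redB + 200 * (length vs + 1) + 100" unfolding augB_def pB_def ..
  have tV: "set trips \<subseteq> V" "length trips \<le> length vs"
    using A(1) order_trans[OF length_filter_le length_A] by auto
  have pairsV': "call prog PAIRS [ents vs, ents trips] Q"
    if "\<And>r n. r = ents pairsV \<Longrightarrow> n \<le> pB \<Longrightarrow> Q r n" for Q
    by (rule call_pairs[of vs trips "500 * (length vs + 1)"]) (use that vs tV in \<open>auto simp: pB_def\<close>)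
  have "(length A + 1) * (500 * (length vs + 1) + 80) \<le> pB"
    unfolding pB_def by (rule mult_le_mono1) (use length_A in simp)
  then have pairsA': "call prog PAIRS [ents A, ents trips] Q"
    if "\<And>r n. r = ents pairsA \<Longrightarrow> n \<le> pB \<Longrightarrow> Q r n" for Q
    by (intro call_pairs[of A trips "500 * (length vs + 1)"]) (use that A tV in auto)
  have trips': "call prog TRIPS [ents A] Q"
    if "\<And>r n. r = ents trips \<Longrightarrow> n \<le> 50 * (length vs + 1) \<Longrightarrow> Q r n" for Q
    by (rule call_trips[OF A(1)]) (use that length_A in auto)
  have edgesA: "call prog EDGES [ents pairsA, SNil] Q"
    if "\<And>r n. r = ence Ml \<Longrightarrow> n \<le> 50 * (length vs + 1) \<Longrightarrow> Q r n" for Q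
    using call_edges'[OF pairsA, of "[]" Q] that length_pairsA by simp
  have lV: "length pairsV \<le> length vs" unfolding pairsl_def by (rule length_filter_le)
  have edgesV: "call prog EDGES [ents pairsV, ence Ml] Q"
    if "\<And>r n. r = ence (edgesl pairsV @ Ml) \<Longrightarrow> n \<le> 50 * (length vs + 1) \<Longrightarrow> Q r n" for Q
    by (rule call_edges'[OF pairsV]) (use that lV in auto)
  have augmentable: "augmentable (set pairsV) \<longleftrightarrow> (\<exists>p. augmenting_path (H_edges V U (set A)) (H_matching V U (set A)) p)"
  proof -
    have "H_edges V U (set A) \<union> H_matching V U (set A) = H_edges V U (set A)"
      using matching_H_matching(2)[OF A(1,3)] by blast
    then show ?thesis unfolding augmentable_def set_pairsV by simp
  qed
  have red: "call prog REDUCE [ents pairsV, SNil, ence Ml] Q"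
    if "augmentable (set pairsV)" "\<And>r n. aug_result r \<Longrightarrow> n \<le> redB \<Longrightarrow> Q r n" for Q
  proof -
    have "(length pairsV + 1) * (decB + 70 * (length vs + 1) + 100) \<le> redB"
      unfolding redB_def by (rule mult_le_mono1) (use lV in simp)
    moreover have "distinct pairsV" using vs(2) unfolding pairsl_def by simp
    ultimately have "call prog REDUCE [ents pairsV, ents [], ence Ml] Q"
      by (intro call_reduce[OF order_refl]) (use that(1) in \<open>auto intro!: that(2) aug_resultI\<close>)
    then show ?thesis by simp
  qed
  have aug2: "call prog AUG2 [ents pairsV, ence Ml] Q"
    if Q: "\<And>r n. aug_result r \<Longrightarrow> n \<le> decB + redB + 50 * (length vs + 1) + 50 \<Longrightarrow> Q r n" for Q
  proof (cases "augmentable (set pairsV)")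
    case True
    then show ?thesis
      by (subst call_prog)
        (auto simp: aug2_body_def wp_simps simp del: map_append
          intro!: edgesV call_dec[OF order_refl lV] red Q)
  next
    case False
    then have "\<nexists>p. augmenting_path (H_edges V U (set A)) (H_matching V U (set A)) p" unfolding augmentable .
    then have "\<nexists>B. augment_step V U (set A) B" unfolding augment_step_def Let_def by blast
    then have "aug_result SNil" unfolding aug_result_def by simp
    then show ?thesis using False
      by (subst call_prog)
        (auto simp: aug2_body_def wp_simps simp del: map_append
          intro!: edgesV call_dec[OF order_refl lV] Q)
  qed
  show ?thesis
    by (subst call_prog)
      (auto simp: aug_body_def wp_simps B intro!: trips' pairsV' pairsA' edgesA aug2 res)
qed

definition candsB :: nat where
  "candsB = 20 * ((length vs + 1) * (2200 * (length vs * length vs + length vs + 2) + 50) +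
     2200 * (length vs * length vs + length vs + 2) + 50)"

definition findB :: nat where
  "findB = (10000 * (length vs + 1) + 50) *
     (length vs + length vs * length vs + length vs * (length vs * length vs) + 1)"

definition stepB :: nat where "stepB = candsB + findB + augB + 200"

definition step_result :: "('a + 'b) sexp \<Rightarrow> bool" where
  "step_result r \<longleftrightarrow> r = SNil \<and> (\<nexists>B. alg_step V U (set A) B) \<or>
     (\<exists>L. r = ents L \<and> L \<noteq> [] \<and> distinct L \<and> set L \<subseteq> V \<and> alg_step V U (set A) (set (pushl L A)))"

lemma call_step:
  fixes Q :: "('a + 'b) sexp \<Rightarrow> nat \<Rightarrow> bool"
  assumes res: "\<And>r n. step_result r \<Longrightarrow> n \<le> stepB \<Longrightarrow> Q r n"
  shows "call prog STEP [ents vs, ents A] Q"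
proof -
  have vsV: "set vs \<subseteq> V" using vs by simp
  have cands: "call prog CANDS [ents vs] Q"
    if "\<And>r n. r = slist (map ents (candsl vs)) \<Longrightarrow> n \<le> candsB \<Longrightarrow> Q r n" for Q
    by (rule call_cands[OF vsV order_refl]) (use that in \<open>simp add: candsB_def\<close>)
  have lenc: "length (candsl vs) \<le> length vs + length vs * length vs + length vs * (length vs * length vs)"
  proof -
    have 1: "length (extl vs [[]]) \<le> length vs" using length_extl[of vs "[[]]"] by simp
    then have 2: "length (extl vs (extl vs [[]])) \<le> length vs * length vs"
      using length_extl[of vs "extl vs [[]]"] by (meson le_trans mult_le_mono2)
    then have "length (extl vs (extl vs (extl vs [[]]))) \<le> length vs * (length vs * length vs)"
      using length_extl[of vs "extl vs (extl vs [[]])"] by (meson le_trans mult_le_mono2)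
    then show ?thesis unfolding candsl_def using 1 2 by simp
  qed
  have find: "call prog FIND [ents vs, ents A, slist (map ents (candsl vs))] Q"
    if "\<And>r n. r = eo (find (goodl vs A) (candsl vs)) \<Longrightarrow> n \<le> findB \<Longrightarrow> Q r n" for Q
  proof (rule call_find[OF vsV A(1) length_A order_refl])
    show "set T \<subseteq> V \<and> length T \<le> 3 \<and> T \<noteq> []" if "T \<in> set (candsl vs)" for T
      using set_candsl[OF that vsV] by blast
    have "(10000 * (length vs + 1) + 50) * (length (candsl vs) + 1) \<le> findB"
      unfolding findB_def by (rule mult_le_mono2) (use lenc in simp)
    then show "Q r n" if "r = eo (find (goodl vs A) (candsl vs))"
      "n \<le> (10000 * (length vs + 1) + 50) * (length (candsl vs) + 1)" for r n
      using that \<open>\<And>r n. r = eo (find (goodl vs A) (candsl vs)) \<Longrightarrow> n \<le> findB \<Longrightarrow> Q r n\<close> by simp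
  qed
  have step2: "call prog STEP2 [ents vs, ents A, eo (find (goodl vs A) (candsl vs))] Q"
    if Q: "\<And>r n. step_result r \<Longrightarrow> n \<le> augB + 20 \<Longrightarrow> Q r n" for Q
  proof (cases "find (goodl vs A) (candsl vs)")
    case None
    have no: "\<not> claw_step V U (set A) B" for B by (rule no_goodl_claw_step[OF vs(1) A(1,2) None])
    \<comment> \<open>\<open>alg_step\<close> admits an augmentation only when no claw improves,
      which \<open>no\<close> provides.\<close>
    have "step_result r" if "aug_result r" for r
      using that no unfolding aug_result_def step_result_def alg_step_def by blast
    then show ?thesis using None
      by (subst call_prog) (auto simp: step2_body_def wp_simps eo_def intro!: call_aug Q)
  next
    case (Some T)
    then have T: "T \<in> set (candsl vs)" "goodl vs A T"
      by (auto simp: find_Some_iff)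
    note t = set_candsl[OF T(1) vsV]
    have "step_result (ents T)"
      unfolding step_result_def alg_step_def
      using goodl_claw_step[OF vs(1) A(1,2) T] t by blast
    then show ?thesis using Some t(2)
      by (subst call_prog) (auto simp: step2_body_def wp_simps eo_def intro!: Q)
  qed
  show ?thesis
    by (subst call_prog) (auto simp: step_body_def wp_simps stepB_def intro!: cands find step2 res)
qed

end

section \<open>Complete runs of the program\<close>

context encoded_collection
begin

lemma length_distinct: "set A \<subseteq> V \<Longrightarrow> distinct A \<Longrightarrow> length A \<le> card V"
  by (metis card_mono distinct_card finite_V)

lemma partial_run_append:
  assumes "partial_run V U As" "alg_step V U (last As) B" shows "partial_run V U (As @ [B])"
  unfolding partial_run_def
proof (intro conjI allI impI)
  have As: "As \<noteq> []" "hd As = {}" using assms(1) unfolding partial_run_def by auto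
  then show "As @ [B] \<noteq> []" "hd (As @ [B]) = {}" by auto
  fix i assume i: "Suc i < length (As @ [B])"
  show "alg_step V U ((As @ [B]) ! i) ((As @ [B]) ! Suc i)"
  proof (cases "Suc i = length As")
    case True
    then have i: "i = length As - 1" "i < length As" by auto
    then have "(As @ [B]) ! i = last As" using As(1) by (simp add: nth_append last_conv_nth)
    moreover have "(As @ [B]) ! Suc i = B" using True by (simp add: nth_append)
    ultimately show ?thesis using assms(2) by simp
  next
    case False
    then have "Suc i < length As" using i by simp
    then show ?thesis using assms(1) unfolding partial_run_def by (simp add: nth_append)
  qed
qed

text \<open>Histories are stored latest first, hence the reversal.\<close>

definition good_history :: "'v list list \<Rightarrow> bool" where
  "good_history hs \<longleftrightarrow> (\<forall>A\<in>set hs. distinct A \<and> set A \<subseteq> V) \<and> partial_run V U (rev (map set hs))"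

lemma good_history_length: "good_history hs \<Longrightarrow> length hs \<le> 9 * card V + 1"
  using partial_run_length[of "rev (map set hs)"] unfolding good_history_def by simp

lemma good_history_hd:
  assumes "good_history (A # hs)" shows "set A \<subseteq> V" "distinct A" "disjoint_family (set A)"
proof -
  show "set A \<subseteq> V" "distinct A" using assms unfolding good_history_def by auto
  have "partial_run V U (rev (map set (A # hs)))" using assms unfolding good_history_def by blast
  from partial_run_invariant[OF this, of "length hs"] show "disjoint_family (set A)"
    by (simp add: nth_append)
qed

lemma good_history_Cons:
  assumes "good_history (A # hs)" "alg_step V U (set A) (set B)" "distinct B" "set B \<subseteq> V"
  shows "good_history (B # A # hs)"
  using partial_run_append[of "rev (map set (A # hs))" "set B"] assms unfolding good_history_def by simp

definition pushB :: "nat \<Rightarrow> nat" where "pushB k = (k + 1) * (500 * (k + 1) + 50) + 500 * (k + 1) + 50"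

text \<open>The potential bounds the length of every history, so the number of steps still possible
  serves as the measure.\<close>

lemma call_loop:
  fixes Q :: "('v + 'e) sexp \<Rightarrow> nat \<Rightarrow> bool"
  assumes vs: "set vs = V" "distinct vs"
    and c: "encoded_state.stepB vs + pushB (card V) + 100 \<le> c"
  shows "good_history (A # hs) \<Longrightarrow>
    (\<And>r n hs'. r = slist (map ents hs') \<Longrightarrow> good_history hs' \<Longrightarrow> complete_run V U (rev (map set hs')) \<Longrightarrow>
       n \<le> (9 * card V + 1 - length hs) * c \<Longrightarrow> Q r n) \<Longrightarrow>
    call prog LOOP [ents vs, slist (map ents (A # hs))] Q"
proof (induction "9 * card V + 1 - length hs" arbitrary: A hs Q rule: less_induct)
  case less
  note h = less.prems(1)
  note A = good_history_hd[OF h]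
  interpret encoded_state V U ul vs A by unfold_locales (fact vs A)+
  have lA: "length A \<le> card V" by (rule length_distinct[OF A(1,2)])
  define k where "k = 9 * card V - length hs"
  \<comment> \<open>The history includes \<open>A\<close> besides \<open>hs\<close>, so its length
    bound keeps the truncated subtraction exact.\<close>
  have k: "9 * card V + 1 - length hs = Suc k" "k = 9 * card V + 1 - length (A # hs)"
    using good_history_length[OF h] unfolding k_def by auto
  have loop2: "call prog LOOP2 [ents vs, slist (map ents (A # hs)), s] Q"
    if s: "step_result s" and Q: "\<And>r n hs'. r = slist (map ents hs') \<Longrightarrow> good_history hs' \<Longrightarrow>
      complete_run V U (rev (map set hs')) \<Longrightarrow> n \<le> k * c + pushB (card V) + 50 \<Longrightarrow> Q r n"
    for s and Q :: "('v + 'e) sexp \<Rightarrow> nat \<Rightarrow> bool"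
  proof (cases "s = SNil")
    case True
    then have no: "\<nexists>B. alg_step V U (set A) B" using s unfolding step_result_def by auto
    have "complete_run V U (rev (map set (A # hs)))"
      using h no unfolding complete_run_def good_history_def by simp
    note prem = Q[OF _ h this, unfolded list.map slist.simps]
    show ?thesis using True
      by (subst call_prog) (auto simp: loop2_body_def wp_simps intro!: prem)
  next
    case False
    then obtain L where L: "s = ents L" "L \<noteq> []" "distinct L" "set L \<subseteq> V" "alg_step V U (set A) (set (pushl L A))"
      using s unfolding step_result_def by blast
    have h': "good_history (pushl L A # A # hs)"
      by (rule good_history_Cons[OF h L(5) distinct_pushl[OF L(3) A(2) L(4)] set_pushl_subset[OF L(4) A(1)]])
    have IH: "call prog LOOP [ents vs, slist (map ents (pushl L A # A # hs))] Q"
      if "\<And>r n hs'. r = slist (map ents hs') \<Longrightarrow> good_history hs' \<Longrightarrow>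
        complete_run V U (rev (map set hs')) \<Longrightarrow> n \<le> k * c \<Longrightarrow> Q r n" for Q :: "('v + 'e) sexp \<Rightarrow> nat \<Rightarrow> bool"
      by (rule less.hyps[OF _ h']) (use that k in auto)
    have lL: "length L \<le> card V" by (rule length_distinct[OF L(4,3)])
    have push: "call prog PUSH [ents L, ents A] Q"
      if "\<And>r n. r = ents (pushl L A) \<Longrightarrow> n \<le> pushB (card V) \<Longrightarrow> Q r n" for Q :: "('v + 'e) sexp \<Rightarrow> nat \<Rightarrow> bool"
    proof (rule call_push[OF A(1) L(4), of "500 * (card V + 1)"])
      have le: "(length A + 1) * (500 * (card V + 1) + 50) \<le> (card V + 1) * (500 * (card V + 1) + 50)"
        by (rule mult_le_mono1) (use lA in simp)
      fix r :: "('v + 'e) sexp" and n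
      assume r: "r = ents (pushl L A)"
        and n: "n \<le> (length A + 1) * (500 * (card V + 1) + 50) + 500 * (card V + 1) + 50"
      have "n \<le> pushB (card V)" using n le unfolding pushB_def by linarith
      with r show "Q r n" by (rule that)
    qed (use lL in simp)
    have "s \<noteq> SNil" by (rule False)
    then show ?thesis unfolding L(1)
      by (subst call_prog)
        (auto simp: loop2_body_def wp_simps intro!: push IH[unfolded list.map slist.simps] Q)
  qed
  have cc: "stepB + pushB (card V) + 100 \<le> c" using c .
  show ?case
    unfolding list.map slist.simps
    by (subst call_prog)
      (use cc in \<open>auto simp: loop_body_def wp_simps k(1)
        intro!: call_step loop2[unfolded list.map slist.simps] less.prems(2)[unfolded k(1)]\<close>)
qed

lemma call_main:
  fixes Q :: "('v + 'e) sexp \<Rightarrow> nat \<Rightarrow> bool"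
  assumes vs: "set vs = V" "distinct vs"
    and Q: "\<And>r n As. encodes_run r As \<Longrightarrow> complete_run V U As \<Longrightarrow>
      n \<le> (9 * card V + 1) * (encoded_state.stepB vs + pushB (card V) + 100) +
        (20 * (card V + 1) + 50) * (9 * card V + 2) + 50 \<Longrightarrow> Q r n"
  shows "call prog 0 [ents vs] Q"
proof -
  define c where "c = encoded_state.stepB vs + pushB (card V) + 100"
  have h0: "good_history [[]]" unfolding good_history_def partial_run_def by simp
  have loop: "call prog LOOP [ents vs, SCons SNil SNil] Q"
    if "\<And>r n hs. r = slist (map ents hs) \<Longrightarrow> good_history hs \<Longrightarrow> complete_run V U (rev (map set hs)) \<Longrightarrow>
       n \<le> (9 * card V + 1) * c \<Longrightarrow> Q r n" for Q :: "('v + 'e) sexp \<Rightarrow> nat \<Rightarrow> bool"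
    using call_loop[OF vs order_refl h0, of Q] that unfolding c_def by simp
  have strip: "call prog (Suc 0) [slist (map ents hs)] Q"
    if h: "good_history hs" "complete_run V U (rev (map set hs))" and
      Q: "\<And>r n As. encodes_run r As \<Longrightarrow> complete_run V U As \<Longrightarrow>
        n \<le> (20 * (card V + 1) + 50) * (9 * card V + 2) \<Longrightarrow> Q r n"
    for hs and Q :: "('v + 'e) sexp \<Rightarrow> nat \<Rightarrow> bool"
  proof (rule call_strip[OF _ order_refl, unfolded One_nat_def])
    show "length A \<le> card V" if "A \<in> set hs" for A
      using that h(1) length_distinct unfolding good_history_def by blast
    fix r :: "('v + 'e) sexp" and n
    assume r: "r = slist (map idl hs)" and n: "n \<le> (20 * (card V + Suc 0) + 50) * (length hs + Suc 0)"
    show "Q r n"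
    proof (rule Q[OF _ h(2)])
      have "list_all2 (encodes_set Inl) (map idl hs) (rev (rev (map set hs)))"
        using h(1) unfolding good_history_def by (auto simp: list_all2_conv_all_nth encodes_set_def)
      then show "encodes_run r (rev (map set hs))" unfolding encodes_run_def r by blast
      have "(20 * (card V + Suc 0) + 50) * (length hs + Suc 0) \<le> (20 * (card V + 1) + 50) * (9 * card V + 2)"
        using good_history_length[OF h(1)] by (intro mult_le_mono) auto
      then show "n \<le> (20 * (card V + 1) + 50) * (9 * card V + 2)" using n by linarith
    qed
  qed
  define d where "d = (9 * card V + 1) * c"
  define e where "e = (20 * (card V + 1) + 50) * (9 * card V + 2)"
  show ?thesis
    by (subst call_prog)
      (auto simp: main_body_def wp_simps intro!: loop[folded d_def] strip[folded e_def]
        Q[folded c_def, folded d_def e_def])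
qed

end

section \<open>Polynomial bounds\<close>

text \<open>Only domination is recorded, so bounds combine under sums and products without the
  polynomial being computed.\<close>

definition poly_bounded :: "(nat \<Rightarrow> nat) \<Rightarrow> bool" where
  "poly_bounded f \<longleftrightarrow> (\<exists>p :: nat poly. \<forall>n. f n \<le> poly p n)"

lemma poly_bounded_const: "poly_bounded (\<lambda>n. c)"
  unfolding poly_bounded_def by (intro exI[of _ "[:c:]"]) simp

lemma poly_bounded_id: "poly_bounded (\<lambda>n. n)"
  unfolding poly_bounded_def by (intro exI[of _ "[:0, 1:]"]) simp

lemma poly_bounded_add: "poly_bounded f \<Longrightarrow> poly_bounded g \<Longrightarrow> poly_bounded (\<lambda>n. f n + g n)"
  unfolding poly_bounded_def by (metis add_mono poly_add)

lemma poly_bounded_mult: "poly_bounded f \<Longrightarrow> poly_bounded g \<Longrightarrow> poly_bounded (\<lambda>n. f n * g n)"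
  unfolding poly_bounded_def by (metis mult_le_mono poly_mult)

lemmas poly_bounded_intros = poly_bounded_add poly_bounded_mult poly_bounded_const poly_bounded_id

text \<open>The cost bounds of the locales as one function of the number of vertices, so that a
  single polynomial can serve all instances.\<close>

definition total_bound :: "nat \<Rightarrow> nat" where
  "total_bound n =
    (let decB = (4 * n + 1) * decideB (4 * n);
         redB = (n + 1) * (decB + 70 * (n + 1) + 100);
         augB = 2 * ((n + 1) * (500 * (n + 1) + 80)) + decB + redB + 200 * (n + 1) + 100;
         candsB = 20 * ((n + 1) * (2200 * (n * n + n + 2) + 50) + 2200 * (n * n + n + 2) + 50);
         findB = (10000 * (n + 1) + 50) * (n + n * n + n * (n * n) + 1);
         stepB = candsB + findB + augB + 200
     in (9 * n + 1) * (stepB + ((n + 1) * (500 * (n + 1) + 50) + 500 * (n + 1) + 50) + 100) +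
        (20 * (n + 1) + 50) * (9 * n + 2) + 100)"

lemma poly_bounded_total_bound: "poly_bounded total_bound"
  unfolding total_bound_def Let_def decideB_def growB_def conflB_def pathB_def renB_def
  by (intro poly_bounded_intros)

lemma carries_out:
  fixes V :: "'v set" and U :: "'v \<Rightarrow> 'e set"
  assumes hered: "hereditary_23_collection V U" and inp: "encodes_collection inp V U"
  shows "\<exists>out t As. computes_in_time prog inp out t \<and> t \<le> total_bound (card V) \<and>
           encodes_run out As \<and> complete_run V U As"
proof -
  obtain vs us where vs: "distinct vs" "set vs = V" and us: "\<forall>v\<in>V. encodes_set Inr (us v) (U v)"
    and inp_eq: "inp = slist (map (\<lambda>v. SCons (SAtom (Inl v)) (us v)) vs)"
    using inp unfolding encodes_collection_def by blast
  have "\<forall>v\<in>V. \<exists>l. distinct l \<and> set l = U v \<and> us v = slist (map (\<lambda>y. SAtom (Inr y)) l)"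
    using us unfolding encodes_set_def by blast
  then obtain ul where us_eq: "\<forall>v\<in>V. distinct (ul v) \<and> set (ul v) = U v \<and> us v = slist (map (\<lambda>y. SAtom (Inr y)) (ul v))"
    by metis
  interpret encoded_collection V U ul
    by unfold_locales (use hered us_eq in auto)
  \<comment> \<open>The empty list stands in for the current set; it gives access to the cost
    bounds, which depend only on \<open>vs\<close>.\<close>
  interpret st: encoded_state V U ul vs "[]"
    by unfold_locales (use vs in \<open>simp_all add: disjoint_family_def\<close>)
  have inp': "inp = ents vs" unfolding inp_eq using us_eq vs(2) by (auto simp: ent_def intro!: arg_cong[of _ _ slist])
  have n: "length vs = card V" using vs distinct_card by metis
  \<comment> \<open>The slack of 10 pays for the outer call that starts the program.\<close>
  have "call prog 0 [ents vs] (\<lambda>r n. (\<exists>As. encodes_run r As \<and> complete_run V U As) \<and> n + 10 \<le> total_bound (card V))"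
  proof (rule call_main[OF vs(2,1)], intro conjI)
    fix r :: "('v + 'e) sexp" and m As
    assume "encodes_run r As" "complete_run V U As"
    then show "\<exists>As. encodes_run r As \<and> complete_run V U As" by blast
    assume m: "m \<le> (9 * card V + 1) * (st.stepB + pushB (card V) + 100) + (20 * (card V + 1) + 50) * (9 * card V + 2) + 50"
    show "m + 10 \<le> total_bound (card V)"
      using m unfolding total_bound_def Let_def st.stepB_def st.candsB_def st.findB_def st.augB_def st.redB_def
        st.decB_def pushB_def n by linarith
  qed
  then have "wp prog [inp] (CallE 0 [Var 0]) (\<lambda>r n. (\<exists>As. encodes_run r As \<and> complete_run V U As) \<and> n \<le> total_bound (card V))"
    unfolding wp_simps inp' by (auto simp: call_def wp_def elim!: ex_forward)
  then show ?thesis unfolding wp_def computes_in_time_def by blast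
qed

theorem theorem6:
  shows "(\<exists>(P :: program) (p :: nat poly).
            \<forall>(V :: 'v set) (U :: 'v \<Rightarrow> 'e set). hereditary_23_collection V U \<longrightarrow>
              polynomially_many_steps p V U \<and> carries_out_in_time P p V U) \<and>
         (\<forall>(V :: 'v set) (U :: 'v \<Rightarrow> 'e set) A. hereditary_23_collection V U \<and> returns V U A \<longrightarrow>
            independent_set (intersection_graph V U) A \<and>
            (\<forall>A_opt. max_weight_independent_set (intersection_graph V U) A_opt \<longrightarrow>
               real (total_weight (intersection_graph V U) A_opt)
                 \<le> 7 / 5 * real (total_weight (intersection_graph V U) A)))"
proof (intro conjI allI impI)
  \<comment> \<open>One polynomial has to bound both the running time and the number of iterations,
    hence the sum.\<close>
  have "poly_bounded (\<lambda>n. total_bound n + (9 * n + 1))"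
    by (intro poly_bounded_add poly_bounded_total_bound poly_bounded_intros)
  then obtain p :: "nat poly" where p: "\<And>n. total_bound n + (9 * n + 1) \<le> poly p n"
    unfolding poly_bounded_def by blast
  have "polynomially_many_steps p V U \<and> carries_out_in_time prog p V U"
    if hered: "hereditary_23_collection V U" for V :: "'v set" and U :: "'v \<Rightarrow> 'e set"
  proof
    interpret hereditary_collection V U by unfold_locales (rule hered)
    show "polynomially_many_steps p V U"
      unfolding polynomially_many_steps_def
    proof (intro allI impI)
      fix As assume "partial_run V U As"
      from partial_run_length[OF this] p[of "card V"] show "length As \<le> poly p (card V)" by linarith
    qed
    show "carries_out_in_time prog p V U"
      unfolding carries_out_in_time_def
    proof (intro allI impI)
      fix inp :: "('v + 'e) sexp" assume "encodes_collection inp V U"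
      from carries_out[OF hered this] obtain out t As where
        o: "computes_in_time prog inp out t" "t \<le> total_bound (card V)" "encodes_run out As" "complete_run V U As"
        by blast
      have "t \<le> poly p (card V)" using o(2) p[of "card V"] by linarith
      with o show "\<exists>out t As. computes_in_time prog inp out t \<and> t \<le> poly p (card V) \<and>
          encodes_run out As \<and> complete_run V U As" by blast
    qed
  qed
  then show "\<exists>P p. \<forall>(V :: 'v set) (U :: 'v \<Rightarrow> 'e set). hereditary_23_collection V U \<longrightarrow>
      polynomially_many_steps p V U \<and> carries_out_in_time P p V U" by blast
next
  fix V :: "'v set" and U :: "'v \<Rightarrow> 'e set" and A
  assume h: "hereditary_23_collection V U \<and> returns V U A"
  interpret hereditary_collection V U by unfold_locales (use h in blast)
  have "returns V U A" using h by blast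
  note A = returns_optimal[OF this]
  show "independent_set (intersection_graph V U) A" using A(1,2) independent_iff by blast
  fix S assume "max_weight_independent_set (intersection_graph V U) S"
  then have "independent_set (intersection_graph V U) S"
    unfolding max_weight_independent_set_def by (rule conjunct1)
  then have S: "S \<subseteq> V" "disjoint_family S" unfolding independent_iff by blast+
  interpret local_optimum V U A S
    by unfold_locales (fact A S)+
  have "real (5 * total_weight G S) \<le> real (7 * total_weight G A)"
    using approximation by (rule of_nat_mono)
  then show "real (total_weight (intersection_graph V U) S)
                 \<le> 7 / 5 * real (total_weight (intersection_graph V U) A)" by simp
qed

end
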